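(* Every weakly convex star-shaped parabolic polyhedron is parabolically infinitesimally rigid. That is, if $(P,G)$ is a weakly convex star-shaped parabolic polyhedron, then every parabolic deformation $Z$ of $\partial P$ is trivial.
   Context: A star-shaped parabolic polyhedron is a pair $(P,G)$, where $P\subset\mathbb{H}^3$ is the cone with apex $c\in\partial\overline{\mathbb{H}^3}$ over a polyhedral surface that projects bijectively (along geodesics ending at $c$) onto horospheres with center $c$, and $G$ is a discrete subgroup of $\mathrm{Iso}^+(\mathbb{H}^3)$ that acts freely and cocompactly on horospheres with center $c$ and leaves $P$ invariant. It is called weakly convex if its vertices are the vertices of some convex polyhedron. A Killing field of $\mathbb{H}^3$ is a vector field whose local $1$-parameter group consists of isometries. An infinitesimal isometric deformation of a polyhedral surface $F\subset\mathbb{H}^3$ is a choice of a Killing field on each face of a triangulation of $F$ having the same set of vertices as $F$, such that the two Killing fields on two adjacent triangles are equal on the common edge; it is determined by its values at the vertices of $F$. It is called trivial if it is the restriction to $F$ of a global Killing field of $\mathbb{H}^3$. An infinitesimal isometric deformation $Z$ of $\partial P$ is a parabolic deformation if for every $g\in G$ there is a parabolic Killing field $\vec g$ such that for every vertex $i$ of $P$ $$Z(g(i))=dg\bigl(Z(i)+\vec g(i)\bigr).$$ Here a parabolic Killing field $\vec g$ is one obtained as follows: let $g_t$ be a smooth path of isometries of $\mathbb{H}^3$ leaving invariant each horosphere centered at $c$, with $g_0=g$; then $\vec g:=dg^{-1}\,\frac{\partial}{\partial t}g_t\big|_{t=0}$. In particular $\vec g$ is a Killing field of $\mathbb{H}^3$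 tangent to all horospheres centered at $c$. *)

theory Defs
  imports "HOL-Analysis.Analysis"
begin

section \<open>Hyperbolic space (hyperboloid model)\<close>

definition mink :: "real^4 \<Rightarrow> real^4 \<Rightarrow> real" where
  "mink x y = x$1 * y$1 + x$2 * y$2 + x$3 * y$3 - x$4 * y$4"

definition hyp3 :: "(real^4) set" where
  "hyp3 = {x. mink x x = -1 \<and> x$4 > 0}"

definition hyp_dist :: "real^4 \<Rightarrow> real^4 \<Rightarrow> real" where
  "hyp_dist x y = arcosh (- mink x y)"

text \<open>A point of the boundary at infinity is a ray of future light-like vectors; it is given by
  any vector on that ray.\<close>

definition ideal_point :: "real^4 \<Rightarrow> bool" where
  "ideal_point c \<longleftrightarrow> mink c c = 0 \<and> c$4 > 0"

text \<open>Hyperbolic convex hull. For \<open>x, y \<in> hyp3\<close>, \<open>hyp_hull {x, y}\<close> is the geodesic segment, and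
  for an ideal point \<open>c\<close>, \<open>hyp_hull {x, c}\<close> is the geodesic ray from \<open>x\<close> to \<open>c\<close>.\<close>

definition hyp_hull :: "(real^4) set \<Rightarrow> (real^4) set" where
  "hyp_hull S = hyp3 \<inter> convex_cone hull S"

definition horosphere :: "real^4 \<Rightarrow> real \<Rightarrow> (real^4) set" where
  "horosphere c s = {x \<in> hyp3. mink x c = - s}"

text \<open>Every isometry of \<open>hyp3\<close> is the restriction of exactly one linear map of the ambient space,
  so isometries are represented by matrices, and the differential of \<open>g\<close> acts on tangent
  vectors (elements of \<open>real^4\<close>) by the same matrix.\<close>

definition hyp_isometry :: "real^4^4 \<Rightarrow> bool" where
  "hyp_isometry A \<longleftrightarrow> (\<lambda>x. A *v x) ` hyp3 = hyp3 \<and>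
     (\<forall>x\<in>hyp3. \<forall>y\<in>hyp3. hyp_dist (A *v x) (A *v y) = hyp_dist x y)"

definition Iso_plus :: "(real^4^4) set" where
  "Iso_plus = {A. hyp_isometry A \<and> det A > 0}"

text \<open>Killing fields of the complete space \<open>hyp3\<close> are complete, so the 1-parameter group is
  defined for all times. Only the values of the field on \<open>hyp3\<close> matter.\<close>

definition killing_field :: "(real^4 \<Rightarrow> real^4) \<Rightarrow> bool" where
  "killing_field X \<longleftrightarrow> (\<exists>\<Phi> :: real \<Rightarrow> real^4^4.
     (\<forall>t. hyp_isometry (\<Phi> t)) \<and> \<Phi> 0 = mat 1 \<and> (\<forall>s t. \<Phi> (s + t) = \<Phi> s ** \<Phi> t) \<and>
     (\<forall>t. \<forall>x\<in>hyp3. ((\<lambda>s. \<Phi> s *v x) has_vector_derivative X (\<Phi> t *v x)) (at t)))"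

section \<open>Polyhedral surfaces\<close>

text \<open>A triangle is represented by the set of its three vertices. Triangles of a triangulation meet
  along common faces; the family is locally finite but may be infinite.\<close>

definition hyp_triangulation :: "(real^4) set set \<Rightarrow> (real^4) set \<Rightarrow> bool" where
  "hyp_triangulation T F \<longleftrightarrow>
     (\<forall>t\<in>T. t \<subseteq> hyp3 \<and> card t = 3 \<and> independent t) \<and>
     (\<forall>s\<in>T. \<forall>t\<in>T. hyp_hull s \<inter> hyp_hull t = hyp_hull (s \<inter> t)) \<and>
     (\<forall>K. compact K \<and> K \<subseteq> hyp3 \<longrightarrow> finite {t\<in>T. hyp_hull t \<inter> K \<noteq> {}}) \<and>
     F = (\<Union>t\<in>T. hyp_hull t)"

definition polyhedral_surface :: "(real^4) set \<Rightarrow> bool" where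
  "polyhedral_surface F \<longleftrightarrow> (\<exists>T. hyp_triangulation T F) \<and>
     (\<forall>x\<in>F. \<exists>U. openin (top_of_set F) U \<and> x \<in> U \<and> U homeomorphic (UNIV :: (real^2) set))"

text \<open>Near a point \<open>x\<close> in the interior of a face or of an edge, the surface is the union of two
  half-planes with a common boundary line through \<open>x\<close>; the vertices are the other points.
  (On a surface, degenerate choices of \<open>p\<close> and \<open>q\<close> are excluded automatically.)\<close>

definition wedge_point :: "(real^4) set \<Rightarrow> real^4 \<Rightarrow> bool" where
  "wedge_point F x \<longleftrightarrow> (\<exists>a\<in>hyp3. \<exists>b\<in>hyp3. \<exists>p\<in>hyp3. \<exists>q\<in>hyp3. \<exists>U.
     x \<in> hyp_hull {a, b} - {a, b} \<and> open U \<and> x \<in> U \<and>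
     F \<inter> U = (hyp_hull {a, b, p} \<union> hyp_hull {a, b, q}) \<inter> U)"

definition surface_vertices :: "(real^4) set \<Rightarrow> (real^4) set" where
  "surface_vertices F = {x\<in>F. \<not> wedge_point F x}"

text \<open>The Killing fields chosen on the triangles are encoded by their restrictions: a Killing field is
  determined by its restriction to a nondegenerate triangle, and the restrictions agree on
  common edges iff they come from one field \<open>Z\<close> along the surface.\<close>

definition inf_isometric_deformation ::
  "(real^4) set \<Rightarrow> (real^4 \<Rightarrow> real^4) \<Rightarrow> bool" where
  "inf_isometric_deformation F Z \<longleftrightarrow> (\<exists>T. hyp_triangulation T F \<and> \<Union>T = surface_vertices F \<and>
     (\<forall>t\<in>T. \<exists>X. killing_field X \<and> (\<forall>x\<in>hyp_hull t. Z x = X x)))"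

definition trivial_deformation :: "(real^4) set \<Rightarrow> (real^4 \<Rightarrow> real^4) \<Rightarrow> bool" where
  "trivial_deformation F Z \<longleftrightarrow> (\<exists>X. killing_field X \<and> (\<forall>x\<in>F. Z x = X x))"

section \<open>Convex polyhedra\<close>

text \<open>The half-spaces are bounded by the geodesic planes orthogonal to unit space-like vectors.\<close>

definition convex_polyhedron :: "(real^4) set \<Rightarrow> bool" where
  "convex_polyhedron Q \<longleftrightarrow> (\<exists>N. (\<forall>n\<in>N. mink n n = 1) \<and>
     (\<forall>K. compact K \<and> K \<subseteq> hyp3 \<longrightarrow> finite {n\<in>N. \<exists>x\<in>K. mink n x = 0}) \<and>
     Q = {x\<in>hyp3. \<forall>n\<in>N. mink n x \<le> 0})"

definition convex_vertices :: "(real^4) set \<Rightarrow> (real^4) set" where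
  "convex_vertices Q = {x\<in>Q. \<forall>y\<in>Q. \<forall>z\<in>Q. x \<notin> hyp_hull {y, z} - {y, z}}"

section \<open>Parabolic polyhedra\<close>

definition preserves_horospheres :: "real^4 \<Rightarrow> real^4^4 \<Rightarrow> bool" where
  "preserves_horospheres c A \<longleftrightarrow> (\<forall>s>0. (\<lambda>x. A *v x) ` horosphere c s = horosphere c s)"

text \<open>The point of \<open>horosphere c s\<close> on the geodesic through \<open>x\<close> that ends at \<open>c\<close>.\<close>

definition horo_proj :: "real^4 \<Rightarrow> real \<Rightarrow> real^4 \<Rightarrow> real^4" where
  "horo_proj c s x = (THE y. y \<in> horosphere c s \<and> y \<in> span {x, c})"

definition cone_over :: "real^4 \<Rightarrow> (real^4) set \<Rightarrow> (real^4) set" where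
  "cone_over c F = (\<Union>x\<in>F. hyp_hull {x, c})"

definition hyp_boundary :: "(real^4) set \<Rightarrow> (real^4) set" where
  "hyp_boundary P = top_of_set hyp3 frontier_of P"

definition discrete_isometry_group :: "(real^4^4) set \<Rightarrow> bool" where
  "discrete_isometry_group G \<longleftrightarrow> G \<subseteq> Iso_plus \<and> mat 1 \<in> G \<and>
     (\<forall>g\<in>G. \<forall>h\<in>G. g ** h \<in> G) \<and> (\<forall>g\<in>G. matrix_inv g \<in> G) \<and> discrete G"

definition acts_freely_cocompactly_on_horospheres :: "real^4 \<Rightarrow> (real^4^4) set \<Rightarrow> bool" where
  "acts_freely_cocompactly_on_horospheres c G \<longleftrightarrow>
     (\<forall>g\<in>G. preserves_horospheres c g) \<and>
     (\<forall>s>0. \<forall>g\<in>G. \<forall>x\<in>horosphere c s. g *v x = x \<longrightarrow> g = mat 1) \<and>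
     (\<forall>s>0. \<exists>K. compact K \<and> (\<Union>g\<in>G. (\<lambda>x. g *v x) ` K) = horosphere c s)"

definition star_shaped_parabolic_polyhedron ::
  "real^4 \<Rightarrow> (real^4) set \<Rightarrow> (real^4^4) set \<Rightarrow> bool" where
  "star_shaped_parabolic_polyhedron c P G \<longleftrightarrow> ideal_point c \<and>
     (\<exists>F. polyhedral_surface F \<and> (\<forall>s>0. bij_betw (horo_proj c s) F (horosphere c s)) \<and>
          P = cone_over c F) \<and>
     discrete_isometry_group G \<and> acts_freely_cocompactly_on_horospheres c G \<and>
     (\<forall>g\<in>G. (\<lambda>x. g *v x) ` P = P)"

text \<open>The vertices of \<open>P\<close> are those of its boundary surface; the ideal apex is not counted.\<close>

definition vertices_of :: "(real^4) set \<Rightarrow> (real^4) set" where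
  "vertices_of P = surface_vertices (hyp_boundary P)"

definition weakly_convex :: "(real^4) set \<Rightarrow> bool" where
  "weakly_convex P \<longleftrightarrow> (\<exists>Q. convex_polyhedron Q \<and> vertices_of P = convex_vertices Q)"

definition smooth_path :: "(real \<Rightarrow> 'a::real_normed_vector) \<Rightarrow> bool" where
  "smooth_path f \<longleftrightarrow> (\<exists>D :: nat \<Rightarrow> real \<Rightarrow> 'a. D 0 = f \<and>
     (\<forall>n t. (D n has_vector_derivative D (Suc n) t) (at t)))"

definition parabolic_killing_field ::
  "real^4 \<Rightarrow> real^4^4 \<Rightarrow> (real^4 \<Rightarrow> real^4) \<Rightarrow> bool" where
  "parabolic_killing_field c g X \<longleftrightarrow> (\<exists>\<gamma> :: real \<Rightarrow> real^4^4. smooth_path \<gamma> \<and> \<gamma> 0 = g \<and>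
     (\<forall>t. hyp_isometry (\<gamma> t) \<and> preserves_horospheres c (\<gamma> t)) \<and>
     (\<forall>x\<in>hyp3. X x = matrix_inv g *v vector_derivative (\<lambda>t. \<gamma> t *v x) (at 0)))"

definition parabolic_deformation ::
  "real^4 \<Rightarrow> (real^4) set \<Rightarrow> (real^4^4) set \<Rightarrow> (real^4 \<Rightarrow> real^4) \<Rightarrow> bool" where
  "parabolic_deformation c P G Z \<longleftrightarrow> inf_isometric_deformation (hyp_boundary P) Z \<and>
     (\<forall>g\<in>G. \<exists>X. parabolic_killing_field c g X \<and>
        (\<forall>i\<in>vertices_of P. Z (g *v i) = g *v (Z i + X i)))"

end

theory Submission
  imports Defs
begin

text \<open>
  Use the chart in which geodesics ending at the apex are vertical and horospheres are vertical
  translates of the paraboloid \<open>z = |x|\<^sup>2 / 2\<close>. The boundary of the polyhedron becomes a piecewise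
  linear graph \<open>z = f x\<close> over a triangulated plane, the group acts on the plane by a lattice of
  translations, and \<open>f x - |x|\<^sup>2 / 2\<close> is periodic. The Pogorelov map turns the deformation into a field
  \<open>(q, w)\<close> along the vertices, infinitesimally isometric on each triangle for the Euclidean metric,
  in which \<open>w\<close> is periodic. Extend \<open>w\<close> linearly over the triangles.

  Isometry says that the mixed Hessian measure \<open>[f, w]\<close> vanishes at all vertices, whence
  \<open>\<integral> f [w, w] = \<integral> w [f, w] = 0\<close> per period. The measure \<open>[w, w]\<close> is concentrated at the
  vertices, so this integral only depends on the values of \<open>f\<close> at the vertices. As these are in
  convex position, \<open>f\<close> may be replaced by a smooth strictly convex function \<open>g\<close> with (almost) the same
  values there, although \<open>f\<close> itself need not be convex. But \<open>- \<integral> g [w, w]\<close> is the integral of the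
  Hessian of \<open>g\<close> evaluated on the rotated gradient of \<open>w\<close>, hence \<open>w\<close> is constant. What is left is an
  infinitesimal isometry of a triangulated plane, which is trivial.

  The triangulation itself need not be periodic. Therefore the identity is applied with a cutoff on
  large parallelograms, where the boundary terms are of lower order.
\<close>

section \<open>Means of monotone vector fields along edges\<close>

text \<open>The sign of \<open>[w, w]\<close> cannot be read off the edges of \<open>f\<close>,
  which may bend either way. So \<open>edge_form\<close> carries edge means of the gradient of the
  smooth function, and its sum over a triangle is compared with a contour integral that has a sign
  for every monotone field, whatever the triangulation. Strictness must be quantitative. Strict
  support at each vertex, together with periodicity of the vertex set, yields one \<epsilon> such
  that \<epsilon> / 2 * |x|^2 can be subtracted from the heights without losing the supporting
  planes. The subtracted part contributes a negative multiple of the Dirichlet energy of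
  \<open>w\<close>; the rest has the same sign up to the interpolation error. On a parallelogram of
  size n the energy enters with weights of order n, so a non-constant \<open>w\<close> would produce
  a sum of order n^3, whereas the boundary terms and the interpolation error contribute order n^2.
  The comparison needs uniform local bounds without a periodic triangulation: translates of
  triangles still have their vertices in the vertex set, hence only finitely many shapes
  occur.\<close>

definition cross2 :: "complex \<Rightarrow> complex \<Rightarrow> real" where
  "cross2 x y = Re x * Im y - Im x * Re y"

definition edge_mean :: "(complex \<Rightarrow> complex) \<Rightarrow> complex \<Rightarrow> complex \<Rightarrow> complex" where
  "edge_mean H a b = integral {0..1} (\<lambda>t. H (a + t *\<^sub>R (b - a)))"

lemma edge_integrable:
  fixes H :: "complex \<Rightarrow> complex"
  assumes "continuous_on UNIV H"
  shows "(\<lambda>t. H (a + t *\<^sub>R v)) integrable_on {x..y}"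
proof -
  have "continuous_on {x..y} (\<lambda>t. H (a + t *\<^sub>R v))"
    by (rule continuous_on_compose2[OF assms]) (auto intro!: continuous_intros)
  then show ?thesis
    by (rule integrable_continuous_real)
qed

lemma edge_mean_commute:
  assumes "continuous_on UNIV H"
  shows "edge_mean H a b = edge_mean H b a"
proof -
  have "((\<lambda>t. H (a + t *\<^sub>R (b - a))) has_integral edge_mean H a b) (cbox 0 1)"
    unfolding edge_mean_def using edge_integrable[OF assms, of a "b - a" 0 1]
    by (simp add: has_integral_integral)
  from has_integral_affinity[OF this, of "-1" 1]
  have "((\<lambda>t. H (a + (1 - t) *\<^sub>R (b - a))) has_integral edge_mean H a b) ((\<lambda>x. 1 - x) ` {0..1})"
    by simp
  moreover have "(\<lambda>x. 1 - x) ` {0..1::real} = {0..1}"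
    by (auto simp: image_iff intro!: bexI[where x="1 - _"])
  moreover have "a + (1 - t) *\<^sub>R (b - a) = b + t *\<^sub>R (a - b)" for t
    by (simp add: algebra_simps)
  ultimately have "((\<lambda>t. H (b + t *\<^sub>R (a - b))) has_integral edge_mean H a b) {0..1}"
    by simp
  then show ?thesis
    by (simp add: edge_mean_def integral_unique)
qed

lemma edge_mean_split:
  fixes H :: "complex \<Rightarrow> complex"
  assumes H: "continuous_on UNIV H" and \<theta>: "0 \<le> \<theta>" "\<theta> \<le> 1"
    and x: "x = a + \<theta> *\<^sub>R (c - a)"
  shows "edge_mean H a c = \<theta> *\<^sub>R edge_mean H a x + (1 - \<theta>) *\<^sub>R edge_mean H x c"
proof -
  let ?h = "\<lambda>t. H (a + t *\<^sub>R (c - a))"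
  have 1: "integral {0..\<theta>} ?h = \<theta> *\<^sub>R edge_mean H a x"
  proof (cases "\<theta> = 0")
    case False
    have "(?h has_integral integral {0..\<theta>} ?h) (cbox 0 \<theta>)"
      using edge_integrable[OF H] by (simp add: has_integral_integral)
    from has_integral_affinity'[OF this, of \<theta> 0] False \<theta>
    have "((\<lambda>t. H (a + t *\<^sub>R (x - a))) has_integral (integral {0..\<theta>} ?h /\<^sub>R \<theta>)) {0..1}"
      by (simp add: x mult.commute)
    then show ?thesis using False by (simp add: edge_mean_def integral_unique)
  qed simp
  have 2: "integral {\<theta>..1} ?h = (1 - \<theta>) *\<^sub>R edge_mean H x c"
  proof (cases "\<theta> = 1")
    case False
    have "(?h has_integral integral {\<theta>..1} ?h) (cbox \<theta> 1)"
      using edge_integrable[OF H] by (simp add: has_integral_integral)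
    from has_integral_affinity'[OF this, of "1 - \<theta>" \<theta>] False \<theta>
    have "((\<lambda>t. H (a + ((1 - \<theta>) * t + \<theta>) *\<^sub>R (c - a))) has_integral (integral {\<theta>..1} ?h /\<^sub>R (1 - \<theta>))) {0..1}"
      by simp
    moreover have "a + ((1 - \<theta>) * t + \<theta>) *\<^sub>R (c - a) = x + t *\<^sub>R (c - x)" for t
      by (simp add: x algebra_simps)
    ultimately have "((\<lambda>t. H (x + t *\<^sub>R (c - x))) has_integral (integral {\<theta>..1} ?h /\<^sub>R (1 - \<theta>))) {0..1}"
      by simp
    then show ?thesis using False by (simp add: edge_mean_def integral_unique)
  qed simp
  have "edge_mean H a c = integral {0..\<theta>} ?h + integral {\<theta>..1} ?h"
    unfolding edge_mean_def
    by (rule Henstock_Kurzweil_Integration.integral_combine[symmetric]) (use \<theta> edge_integrable[OF H] in auto)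
  then show ?thesis unfolding 1 2 .
qed

text \<open>At equal parameter \<open>t\<close> the points on the two edges from \<open>a\<close>
  differ by \<open>t *\<^sub>R (b - x)\<close>, so monotonicity of \<open>H\<close> applies under
  the integral.\<close>

lemma edge_mean_mono:
  fixes H :: "complex \<Rightarrow> complex"
  assumes H: "continuous_on UNIV H" and mono: "\<And>x y. 0 \<le> (H y - H x) \<bullet> (y - x)"
  shows "0 \<le> (edge_mean H a b - edge_mean H a x) \<bullet> (b - x)"
proof -
  have 0: "0 \<le> (H (a + t *\<^sub>R (b - a)) - H (a + t *\<^sub>R (x - a))) \<bullet> (b - x)" if "t \<in> {0..1}" for t
  proof (cases "t = 0")
    case False
    have "0 \<le> (H (a + t *\<^sub>R (b - a)) - H (a + t *\<^sub>R (x - a))) \<bullet> (t *\<^sub>R (b - x))"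
      using mono[of "a + t *\<^sub>R (b - a)" "a + t *\<^sub>R (x - a)"] by (simp add: algebra_simps)
    then show ?thesis using False that by (simp add: zero_le_mult_iff)
  qed simp
  have i: "(\<lambda>t. H (a + t *\<^sub>R (b - a)) - H (a + t *\<^sub>R (x - a))) integrable_on {0..1}"
    by (intro integrable_diff edge_integrable H)
  have "(edge_mean H a b - edge_mean H a x) \<bullet> (b - x)
     = integral {0..1} (\<lambda>t. H (a + t *\<^sub>R (b - a)) - H (a + t *\<^sub>R (x - a))) \<bullet> (b - x)"
    unfolding edge_mean_def by (simp add: integral_diff edge_integrable H)
  also have "\<dots> = integral {0..1} (\<lambda>t. (H (a + t *\<^sub>R (b - a)) - H (a + t *\<^sub>R (x - a))) \<bullet> (b - x))"
    using integral_linear[OF i bounded_linear_inner_left[of "b - x"]] by (simp add: o_def)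
  also have "\<dots> \<ge> 0"
    using integrable_linear[OF i bounded_linear_inner_left[of "b - x"]] 0
    by (intro integral_nonneg) (auto simp: o_def)
  finally show ?thesis by simp
qed

lemma edge_mean_gradient:
  fixes G :: "complex \<Rightarrow> real"
  assumes "\<And>x. (G has_derivative (\<lambda>h. H x \<bullet> h)) (at x)" and H: "continuous_on UNIV H"
  shows "edge_mean H a b \<bullet> (b - a) = G b - G a"
proof -
  have i: "(\<lambda>t. H (a + t *\<^sub>R (b - a))) integrable_on {0..1}"
    by (rule edge_integrable[OF H])
  have "((\<lambda>t. G (a + t *\<^sub>R (b - a))) has_vector_derivative H (a + t *\<^sub>R (b - a)) \<bullet> (b - a)) (at t within {0..1})" for t
  proof -
    have "((\<lambda>t. a + t *\<^sub>R (b - a)) has_derivative (\<lambda>h. h *\<^sub>R (b - a))) (at t within {0..1})"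
      by (auto intro!: derivative_eq_intros)
    from has_derivative_compose[OF this assms(1)] show ?thesis
      by (simp add: has_vector_derivative_def)
  qed
  then have "((\<lambda>t. H (a + t *\<^sub>R (b - a)) \<bullet> (b - a)) has_integral G (a + 1 *\<^sub>R (b - a)) - G (a + 0 *\<^sub>R (b - a))) {0..1}"
    by (intro fundamental_theorem_of_calculus) auto
  moreover have "integral {0..1} (\<lambda>t. H (a + t *\<^sub>R (b - a)) \<bullet> (b - a)) = edge_mean H a b \<bullet> (b - a)"
    using integral_linear[OF i bounded_linear_inner_left[of "b - a"]] by (simp add: o_def edge_mean_def)
  ultimately show ?thesis
    by (simp add: has_integral_iff)
qed

text \<open>The contour integral of \<open>H \<bullet> (\<i> * \<alpha>)\<close> against the differential of the linear form \<open>\<alpha>\<close>, taken along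
  the boundary of the triangle \<open>a b c\<close>. Its sign for monotone \<open>H\<close> is obtained by pairing the
  entry and exit points of each level line of \<open>\<alpha>\<close>, whose direction is \<open>\<i> * \<alpha>\<close>.\<close>

definition slice_sum :: "complex \<Rightarrow> (complex \<Rightarrow> complex) \<Rightarrow> complex \<Rightarrow> complex \<Rightarrow> complex \<Rightarrow> real" where
  "slice_sum \<alpha> H a b c = (\<alpha> \<bullet> (b - a)) * (edge_mean H a b \<bullet> (\<i> * \<alpha>)) +
     (\<alpha> \<bullet> (c - b)) * (edge_mean H b c \<bullet> (\<i> * \<alpha>)) +
     (\<alpha> \<bullet> (a - c)) * (edge_mean H c a \<bullet> (\<i> * \<alpha>))"

text \<open>The level line of \<alpha> through the middle vertex \<open>b\<close> meets the side
  from \<open>a\<close> to \<open>c\<close> in \<open>x\<close> and cuts the triangle in two. In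
  each part \<open>edge_mean_mono\<close> compares the two edges that start at \<open>a\<close> or
  at \<open>c\<close>. The orientation makes \<open>b - x\<close> a negative multiple of
  \<open>\<i> * \<alpha>\<close>, which fixes the sign.\<close>

lemma slice_sum_sorted:
  fixes H :: "complex \<Rightarrow> complex"
  assumes H: "continuous_on UNIV H" and mono: "\<And>x y. 0 \<le> (H y - H x) \<bullet> (y - x)"
    and ccw: "cross2 (b - a) (c - a) > 0"
    and sorted: "\<alpha> \<bullet> a \<le> \<alpha> \<bullet> b" "\<alpha> \<bullet> b \<le> \<alpha> \<bullet> c"
  shows "slice_sum \<alpha> H a b c \<le> 0"
proof (cases "\<alpha> \<bullet> a = \<alpha> \<bullet> c")
  case True
  then have "\<alpha> \<bullet> a = \<alpha> \<bullet> b" "\<alpha> \<bullet> a = \<alpha> \<bullet> c" using sorted by auto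
  then show ?thesis by (simp add: slice_sum_def inner_diff_right)
next
  case False
  define m where "m = \<alpha> \<bullet> (c - a)"
  have m: "m > 0" using False sorted by (simp add: m_def inner_diff_right)
  define \<theta> where "\<theta> = (\<alpha> \<bullet> (b - a)) / m"
  define x where "x = a + \<theta> *\<^sub>R (c - a)"
  define k where "k = cross2 (b - a) (c - a) / m"
  have k: "k > 0" using m ccw by (simp add: k_def)
  have \<theta>: "0 \<le> \<theta>" "\<theta> \<le> 1" using sorted m by (auto simp: \<theta>_def m_def inner_diff_right)
  have bx: "b - x = - (k *\<^sub>R (\<i> * \<alpha>))"
  proof -
    have "m *\<^sub>R (b - x) = m *\<^sub>R (b - a) - (\<alpha> \<bullet> (b - a)) *\<^sub>R (c - a)"
    proof -
      have "m *\<^sub>R (b - x) = m *\<^sub>R (b - a) - (m * \<theta>) *\<^sub>R (c - a)"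
        by (simp add: x_def algebra_simps)
      then show ?thesis using m by (simp add: \<theta>_def)
    qed
    also have "\<dots> = - (cross2 (b - a) (c - a) *\<^sub>R (\<i> * \<alpha>))"
      by (simp add: m_def complex_eq_iff inner_complex_def cross2_def) algebra
    also have "\<dots> = m *\<^sub>R (- (k *\<^sub>R (\<i> * \<alpha>)))"
      using m by (simp add: k_def)
    finally show ?thesis using m by (subst (asm) scaleR_cancel_left) auto
  qed
  have 1: "(edge_mean H a b - edge_mean H a x) \<bullet> (\<i> * \<alpha>) \<le> 0"
    using edge_mean_mono[OF H mono, of a b x] k by (simp add: bx mult_le_0_iff)
  have 2: "(edge_mean H b c - edge_mean H x c) \<bullet> (\<i> * \<alpha>) \<le> 0"
    using edge_mean_mono[OF H mono, of c b x] k
    by (simp add: bx mult_le_0_iff edge_mean_commute[OF H, of c])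
  have e: "edge_mean H c a = \<theta> *\<^sub>R edge_mean H a x + (1 - \<theta>) *\<^sub>R edge_mean H x c"
    using edge_mean_split[OF H \<theta> x_def] edge_mean_commute[OF H] by simp
  have ab: "\<alpha> \<bullet> (b - a) = m * \<theta>" and bc: "\<alpha> \<bullet> (c - b) = m * (1 - \<theta>)" and ac: "\<alpha> \<bullet> (a - c) = - m"
    using m by (auto simp: \<theta>_def m_def inner_diff_right field_simps)
  have "slice_sum \<alpha> H a b c = m * \<theta> * ((edge_mean H a b - edge_mean H a x) \<bullet> (\<i> * \<alpha>))
     + m * (1 - \<theta>) * ((edge_mean H b c - edge_mean H x c) \<bullet> (\<i> * \<alpha>))"
    unfolding slice_sum_def ab bc ac e by (simp add: inner_diff_left inner_add_left algebra_simps del: scaleR_conv_of_real)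
  also have "\<dots> \<le> 0"
    using m \<theta> 1 2 by (intro add_nonpos_nonpos) (auto simp: mult_le_0_iff)
  finally show ?thesis .
qed

text \<open>Cyclic symmetry and the change of sign of \<alpha> reduce all six orders of the values
  of \<alpha> at the vertices to the sorted one.\<close>

lemma slice_sum_nonpos:
  fixes H :: "complex \<Rightarrow> complex"
  assumes H: "continuous_on UNIV H" and mono: "\<And>x y. 0 \<le> (H y - H x) \<bullet> (y - x)"
    and ccw: "cross2 (b - a) (c - a) > 0"
  shows "slice_sum \<alpha> H a b c \<le> 0"
proof -
  have r: "slice_sum \<alpha> H a b c = slice_sum \<alpha> H b c a" "slice_sum \<alpha> H a b c = slice_sum \<alpha> H c a b"
    by (simp_all add: slice_sum_def)
  have n: "slice_sum \<alpha> H a b c = slice_sum (-\<alpha>) H a b c" for a b c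
    by (simp add: slice_sum_def)
  have c: "cross2 (c - b) (a - b) > 0" "cross2 (a - c) (b - c) > 0"
    using ccw by (auto simp: cross2_def algebra_simps)
  note s = slice_sum_sorted[OF H mono]
  show ?thesis
    using s[OF ccw, of \<alpha>] s[OF c(1), of \<alpha>] s[OF c(2), of \<alpha>]
      s[OF ccw, of "-\<alpha>"] s[OF c(1), of "-\<alpha>"] s[OF c(2), of "-\<alpha>"] r n
    by (smt (verit) inner_minus_left)
qed

text \<open>On the right, the first term is a summand of \<open>slice_sum\<close>, the second adds
  up to zero around a triangle, and the third is an error: it compares the height difference
  \<open>z\<close> along the edge with the difference \<open>M \<bullet> e\<close> of the smooth
  function whose mean gradient is \<open>M\<close>.\<close>

lemma edge_identity:
  fixes e \<alpha> M M' Q :: complex and w z \<omega> :: real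
  assumes "e \<noteq> 0" and w: "w = \<alpha> \<bullet> e" and Q: "Q = - (z *\<^sub>R \<alpha>) + \<omega> *\<^sub>R (\<i> * e)"
  shows "(w * (Q \<bullet> (\<i> * e)) + w\<^sup>2 * (M \<bullet> (\<i> * e))) / (norm e)\<^sup>2
     = w * (M \<bullet> (\<i> * \<alpha>)) + \<omega> * w + (\<alpha> \<bullet> (\<i> * e)) * w * (M \<bullet> e - z) / (norm e)\<^sup>2"
proof -
  have n: "(norm e)\<^sup>2 = (Re e)\<^sup>2 + (Im e)\<^sup>2" by (simp add: cmod_power2)
  have "(norm e)\<^sup>2 \<noteq> 0" using assms(1) by simp
  moreover have "w * (Q \<bullet> (\<i> * e)) + w\<^sup>2 * (M \<bullet> (\<i> * e)) =
     (w * (M \<bullet> (\<i> * \<alpha>)) + \<omega> * w) * (norm e)\<^sup>2 + (\<alpha> \<bullet> (\<i> * e)) * w * (M \<bullet> e - z)"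
    unfolding n w Q by (simp add: inner_complex_def) algebra
  ultimately show ?thesis by (simp add: field_simps)
qed

text \<open>A plane vector orthogonal to \<open>p\<close> is a real multiple of
  \<open>\<i> * p\<close>. This gives rotation rates for two sides, and the third side forces them
  to agree.\<close>

lemma rigid_triangle:
  fixes y :: "complex \<Rightarrow> complex"
  assumes ccw: "cross2 (b - a) (c - a) \<noteq> 0"
    and r: "(b - a) \<bullet> (y b - y a) = 0" "(c - a) \<bullet> (y c - y a) = 0" "(c - b) \<bullet> (y c - y b) = 0"
  obtains \<omega> where "y b - y a = \<omega> *\<^sub>R (\<i> * (b - a))" "y c - y a = \<omega> *\<^sub>R (\<i> * (c - a))"
proof -
  have *: "\<exists>\<omega>. Y = \<omega> *\<^sub>R (\<i> * p)" if "p \<bullet> Y = 0" "p \<noteq> 0" for p Y :: complex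
  proof
    have n: "(norm p)\<^sup>2 = (Re p)\<^sup>2 + (Im p)\<^sup>2" by (simp add: cmod_power2)
    have "(norm p)\<^sup>2 *\<^sub>R Y = (Y \<bullet> (\<i> * p)) *\<^sub>R (\<i> * p)"
      unfolding n using that(1) by (simp add: inner_complex_def complex_eq_iff) algebra
    moreover have "(norm p)\<^sup>2 \<noteq> 0" using that by simp
    ultimately show "Y = ((Y \<bullet> (\<i> * p)) / (norm p)\<^sup>2) *\<^sub>R (\<i> * p)"
      by (metis (no_types, opaque_lifting) divide_inverse_commute scaleR_scaleR real_vector.scale_one left_inverse)
  qed
  have "b - a \<noteq> 0" "c - a \<noteq> 0" using ccw by (auto simp: cross2_def)
  then obtain \<omega> \<omega>' where w: "y b - y a = \<omega> *\<^sub>R (\<i> * (b - a))" "y c - y a = \<omega>' *\<^sub>R (\<i> * (c - a))"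
    using * r(1,2) by metis
  have "((c - a) - (b - a)) \<bullet> ((y c - y a) - (y b - y a)) = 0"
    using r(3) by simp
  then have "(\<omega> - \<omega>') * cross2 (b - a) (c - a) = 0"
    unfolding w by (simp add: inner_complex_def cross2_def) algebra
  with ccw have "\<omega> = \<omega>'" by simp
  with w that show ?thesis by blast
qed

section \<open>The edge form\<close>

lemma edge_mean_same [simp]: "edge_mean H a a = H a"
  by (simp add: edge_mean_def)

lemma gradient_inequality:
  fixes G :: "complex \<Rightarrow> real"
  assumes "\<And>x. (G has_derivative (\<lambda>h. H x \<bullet> h)) (at x)" and H: "continuous_on UNIV H"
    and mono: "\<And>x y. 0 \<le> (H y - H x) \<bullet> (y - x)"
  shows "G x + H x \<bullet> (y - x) \<le> G y"
  using edge_mean_gradient[OF assms(1,2), of x y] edge_mean_mono[OF H mono, of x y x]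
  by (simp add: inner_diff_left)

text \<open>Log-sum-exp with sharpness \<open>N\<close>. It exceeds the maximum by at most
  \<open>ln (card S) / N\<close>, and its gradient is a weighted mean of the slopes
  \<open>b i\<close>.\<close>

lemma smooth_maximum:
  fixes b :: "'i \<Rightarrow> complex" and c :: "'i \<Rightarrow> real"
  assumes S: "finite S" "S \<noteq> {}" and \<delta>: "\<delta> > 0"
  obtains G H where "\<And>x. (G has_derivative (\<lambda>h. H x \<bullet> h)) (at x)" "continuous_on UNIV H"
    "\<And>x y. 0 \<le> (H y - H x) \<bullet> (y - x)"
    "\<And>x i. i \<in> S \<Longrightarrow> b i \<bullet> x + c i \<le> G x"
    "\<And>x u. (\<And>i. i \<in> S \<Longrightarrow> b i \<bullet> x + c i \<le> u) \<Longrightarrow> G x \<le> u + \<delta>"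
proof -
  have cardS: "real (card S) \<ge> 1" using S by (simp add: Suc_leI card_gt_0_iff)
  \<comment> \<open>This sharpness keeps the excess over the maximum below \<delta>; the summand
    \<open>1\<close> makes \<open>N\<close> positive when \<open>S\<close> is a singleton.\<close>
  define N where "N = ln (card S) / \<delta> + 1"
  have N: "N > 0" "ln (card S) / N \<le> \<delta>"
  proof -
    have l: "ln (card S) \<ge> 0" using cardS by simp
    then have "ln (card S) / \<delta> \<ge> 0" using \<delta> by simp
    then show "N > 0" by (simp add: N_def)
    moreover have "ln (card S) \<le> \<delta> * N" using \<delta> by (simp add: N_def field_simps)
    ultimately show "ln (card S) / N \<le> \<delta>" by (simp add: field_simps)
  qed
  define E where "E i x = exp (N * (b i \<bullet> x + c i))" for i x
  define s where "s x = (\<Sum>i\<in>S. E i x)" for x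
  have Epos: "E i x > 0" for i x by (simp add: E_def)
  have spos: "s x > 0" for x unfolding s_def using S Epos by (intro sum_pos) auto
  define G where "G x = ln (s x) / N" for x
  define H where "H x = (\<Sum>i\<in>S. E i x *\<^sub>R b i) /\<^sub>R s x" for x
  have dE: "(E i has_derivative (\<lambda>h. N * E i x * (b i \<bullet> h))) (at x)" for i x
    unfolding E_def by (auto intro!: derivative_eq_intros)
  have ds: "(s has_derivative (\<lambda>h. \<Sum>i\<in>S. N * E i x * (b i \<bullet> h))) (at x)" for x
    unfolding s_def by (intro has_derivative_sum dE)
  have 1: "(G has_derivative (\<lambda>h. H x \<bullet> h)) (at x)" for x
  proof -
    have "(G has_derivative (\<lambda>h. ((\<Sum>i\<in>S. N * E i x * (b i \<bullet> h)) / s x) / N)) (at x)"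
      unfolding G_def using spos[of x] N
      by (auto intro!: derivative_eq_intros ds simp: divide_inverse mult.commute)
    moreover have "((\<Sum>i\<in>S. N * E i x * (b i \<bullet> h)) / s x) / N = H x \<bullet> h" for h
    proof -
      have "(\<Sum>i\<in>S. N * E i x * (b i \<bullet> h)) = N * (\<Sum>i\<in>S. E i x * (b i \<bullet> h))"
        by (simp add: sum_distrib_left mult.assoc)
      then show ?thesis using N by (simp add: H_def inner_sum_left divide_inverse mult.commute)
    qed
    ultimately show ?thesis by simp
  qed
  have cE: "continuous_on UNIV (E i)" for i
    unfolding E_def by (intro continuous_intros)
  have 2: "continuous_on UNIV H"
    unfolding H_def s_def using spos unfolding s_def
    by (intro continuous_intros cE) (metis less_irrefl)
  have 3: "0 \<le> (H y - H x) \<bullet> (y - x)" for x y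
  proof -
    define l where "l i = b i \<bullet> (y - x)" for i
    have E: "E i y = E i x * exp (N * l i)" for i
      by (simp add: E_def l_def exp_add[symmetric] inner_diff_right algebra_simps)
    have Hl: "H v \<bullet> (y - x) * s v = (\<Sum>i\<in>S. E i v * l i)" for v
      using spos[of v] by (simp add: H_def inner_sum_left l_def)
    have nn: "0 \<le> E i x * E j x * ((l i - l j) * (exp (N * l i) - exp (N * l j)))" for i j
    proof (rule mult_nonneg_nonneg)
      show "0 \<le> E i x * E j x" using Epos by (simp add: less_imp_le)
      show "0 \<le> (l i - l j) * (exp (N * l i) - exp (N * l j))"
        using N by (simp add: zero_le_mult_iff) linarith
    qed
    \<comment> \<open>The argument of Chebyshev's sum inequality: \<open>exp (N * l)\<close>
      increases with \<open>l\<close>, and expanding the product turns the double sum into a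
      positive multiple of the desired expression.\<close>
    have "0 \<le> (\<Sum>i\<in>S. \<Sum>j\<in>S. E i x * E j x * ((l i - l j) * (exp (N * l i) - exp (N * l j))))"
      by (intro sum_nonneg nn)
    also have "\<dots> = (\<Sum>i\<in>S. \<Sum>j\<in>S. (E i y * l i) * E j x - (E i x * l i) * E j y
        - E i y * (E j x * l j) + E i x * (E j y * l j))"
      unfolding E by (intro sum.cong refl) (simp add: algebra_simps)
    also have "\<dots> = (\<Sum>i\<in>S. E i y * l i) * s x - (\<Sum>i\<in>S. E i x * l i) * s y
        - s y * (\<Sum>i\<in>S. E i x * l i) + s x * (\<Sum>i\<in>S. E i y * l i)"
      unfolding s_def sum_product by (simp only: sum.distrib sum_subtractf)
    also have "\<dots> = 2 * (s x * s y) * ((H y - H x) \<bullet> (y - x))"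
      unfolding Hl[symmetric] inner_diff_left by (simp add: algebra_simps)
    finally show ?thesis using spos[of x] spos[of y]
      by (smt (verit) mult_pos_pos zero_le_mult_iff)
  qed
  have 4: "b i \<bullet> x + c i \<le> G x" if "i \<in> S" for i x
  proof -
    have "E i x \<le> s x" unfolding s_def using S that Epos by (intro member_le_sum) (auto simp: less_imp_le)
    then have "N * (b i \<bullet> x + c i) \<le> ln (s x)"
      using spos[of x] by (simp add: E_def ln_ge_iff)
    then show ?thesis using N by (simp add: G_def field_simps)
  qed
  have 5: "G x \<le> u + \<delta>" if "\<And>i. i \<in> S \<Longrightarrow> b i \<bullet> x + c i \<le> u" for x u
  proof -
    have "s x \<le> (\<Sum>i\<in>S. exp (N * u))"
      unfolding s_def E_def using that N by (intro sum_mono) simp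
    then have "s x \<le> card S * exp (N * u)" by simp
    then have "ln (s x) \<le> ln (card S * exp (N * u))"
      using spos[of x] by (subst ln_le_cancel_iff) (auto intro: less_le_trans)
    also have "\<dots> = ln (card S) + N * u" using cardS by (simp add: ln_mult)
    finally have "G x \<le> (ln (card S) + N * u) / N"
      using N by (simp add: G_def divide_right_mono)
    also have "\<dots> = ln (card S) / N + u" using N by (simp add: add_divide_distrib)
    finally show ?thesis using N by simp
  qed
  show ?thesis by (rule that[of G H]) (use 1 2 3 4 5 in auto)
qed

text \<open>This form changes sign when the edge is reversed, so that its sum over a closed triangulated surface
  vanishes. The field \<open>H\<close> is the gradient of a convex function \<open>G\<close>, and \<open>G x + \<epsilon> / 2 * |x|\<^sup>2\<close>
  approximates the heights of the vertices; subtracting the gradient of \<open>|x|\<^sup>2 / 2\<close> makes the form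
  invariant under the translations of the polyhedron.\<close>

definition edge_form ::
  "real \<Rightarrow> (complex \<Rightarrow> complex) \<Rightarrow> (complex \<Rightarrow> real) \<Rightarrow> (complex \<Rightarrow> complex) \<Rightarrow> complex \<Rightarrow> complex \<Rightarrow> real" where
  "edge_form \<epsilon> H w u a b =
     ((w b - w a) * ((u b - u a) \<bullet> (\<i> * (b - a))) +
      (w b - w a)\<^sup>2 * ((edge_mean H a b - ((1 - \<epsilon>) / 2) *\<^sub>R (a + b)) \<bullet> (\<i> * (b - a)))) / (norm (b - a))\<^sup>2"

lemma edge_form_swap:
  assumes "continuous_on UNIV H"
  shows "edge_form \<epsilon> H w u b a = - edge_form \<epsilon> H w u a b"
proof -
  have "\<i> * (a - b) = - (\<i> * (b - a))" by (simp add: algebra_simps)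
  moreover have "u a - u b = - (u b - u a)" by simp
  moreover have "norm (a - b) = norm (b - a)" by (simp add: norm_minus_commute)
  ultimately show ?thesis
    unfolding edge_form_def edge_mean_commute[OF assms, of b a]
    by (simp only: inner_minus_left inner_minus_right add.commute[of b a])
       (simp add: divide_simps power2_eq_square, simp add: algebra_simps)
qed

text \<open>Each edge is resolved by \<open>edge_identity\<close>. The \<open>slice_sum\<close> of
  \<open>H\<close> is non-positive, the rotation terms cancel, each of the three edges has an error
  of at most \<open>2 * \<delta> * (norm \<alpha>)\<^sup>2\<close>, and the quadratic part of the
  heights contributes the negative term.\<close>

lemma edge_form_triangle_le:
  fixes w z :: "complex \<Rightarrow> real" and u :: "complex \<Rightarrow> complex"
  assumes G: "\<And>x. (G has_derivative (\<lambda>h. H x \<bullet> h)) (at x)" and H: "continuous_on UNIV H"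
    and mono: "\<And>x y. 0 \<le> (H y - H x) \<bullet> (y - x)"
    and ccw: "cross2 (b - a) (c - a) > 0"
    and \<alpha>: "\<alpha> \<bullet> (b - a) = w b - w a" "\<alpha> \<bullet> (c - a) = w c - w a"
    and strain: "\<And>x y. x \<in> {a,b,c} \<Longrightarrow> y \<in> {a,b,c} \<Longrightarrow>
      (y - x) \<bullet> ((u y - w y *\<^sub>R y) - (u x - w x *\<^sub>R x)) + (z y - z x) * (w y - w x) = 0"
    and z: "\<And>x. x \<in> {a,b,c} \<Longrightarrow> \<bar>z x - (G x + \<epsilon> / 2 * (norm x)\<^sup>2)\<bar> \<le> \<delta>"
  shows "edge_form \<epsilon> H w u a b + edge_form \<epsilon> H w u b c + edge_form \<epsilon> H w u c a
     \<le> 6 * \<delta> * (norm \<alpha>)\<^sup>2 - \<epsilon> / 2 * cross2 (b - a) (c - a) * (norm \<alpha>)\<^sup>2"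
proof -
  let ?Q = "\<lambda>x. u x - w x *\<^sub>R x"
  have alg: "d * (X + d * k) + d\<^sup>2 * (Y - k) = d * X + d\<^sup>2 * Y" for d X Y k :: real
    by (simp add: power2_eq_square algebra_simps)
  have sum3: "x1 + x2 + x3 = s + e1 + e2 + e3"
    if "x1 = a1 + w1 + e1" "x2 = a2 + w2 + e2" "x3 = a3 + w3 + e3" "w1 + w2 + w3 = 0" "a1 + a2 + a3 = s"
    for x1 x2 x3 a1 a2 a3 w1 w2 w3 e1 e2 e3 s :: real
    using that by simp
  \<comment> \<open>As \<alpha> is the gradient of \<open>w\<close> on the triangle, this correction
    absorbs the vertical part of the strain and leaves an infinitesimal isometry of the plane
    triangle, with rotation rate \<omega>.\<close>
  define y where "y x = ?Q x + z x *\<^sub>R \<alpha>" for x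
  have \<alpha>': "\<alpha> \<bullet> (q - p) = w q - w p" if "p \<in> {a,b,c}" "q \<in> {a,b,c}" for p q
    using that \<alpha> by (auto simp: inner_diff_right)
  have yrig: "(q - p) \<bullet> (y q - y p) = 0" if "p \<in> {a,b,c}" "q \<in> {a,b,c}" for p q
  proof -
    have "y q - y p = (?Q q - ?Q p) + (z q - z p) *\<^sub>R \<alpha>" by (simp add: y_def algebra_simps)
    then have "(q - p) \<bullet> (y q - y p) = (q - p) \<bullet> (?Q q - ?Q p) + (z q - z p) * (\<alpha> \<bullet> (q - p))"
      by (simp only: inner_add_right inner_scaleR_right inner_commute[of "q - p" \<alpha>])
    with strain[OF that] \<alpha>'[OF that] show ?thesis by simp
  qed
  obtain \<omega> where \<omega>: "y b - y a = \<omega> *\<^sub>R (\<i> * (b - a))" "y c - y a = \<omega> *\<^sub>R (\<i> * (c - a))"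
    using rigid_triangle[of b a c y] ccw yrig by auto
  have y: "y q - y p = \<omega> *\<^sub>R (\<i> * (q - p))" if "p \<in> {a,b,c}" "q \<in> {a,b,c}" for p q
  proof -
    have "y q - y a = \<omega> *\<^sub>R (\<i> * (q - a))" "y p - y a = \<omega> *\<^sub>R (\<i> * (p - a))"
      using that \<omega> by auto
    then have "y q - y p = \<omega> *\<^sub>R (\<i> * (q - a)) - \<omega> *\<^sub>R (\<i> * (p - a))"
      by (metis diff_diff_eq2 diff_add_cancel add_diff_cancel_right)
    then show ?thesis by (simp add: algebra_simps)
  qed
  \<comment> \<open>The edge mean of the gradient of
    \<open>G x + \<epsilon> / 2 * (norm x)\<^sup>2\<close>.\<close>
  let ?N = "\<lambda>p q. edge_mean H p q + (\<epsilon> / 2) *\<^sub>R (p + q)"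
  let ?err = "\<lambda>p q. (\<alpha> \<bullet> (\<i> * (q - p))) * (w q - w p) * (?N p q \<bullet> (q - p) - (z q - z p)) / (norm (q - p))\<^sup>2"
  have edge: "edge_form \<epsilon> H w u p q = (\<alpha> \<bullet> (q - p)) * (?N p q \<bullet> (\<i> * \<alpha>)) + \<omega> * (w q - w p) + ?err p q"
    and err: "?err p q \<le> 2 * \<delta> * (norm \<alpha>)\<^sup>2"
    if pq: "p \<in> {a,b,c}" "q \<in> {a,b,c}" "p \<noteq> q" for p q
  proof -
    define e where "e = q - p"
    have e0: "e \<noteq> 0" using pq by (simp add: e_def)
    have Q: "?Q q - ?Q p = - ((z q - z p) *\<^sub>R \<alpha>) + \<omega> *\<^sub>R (\<i> * e)"
      using y[OF pq(1,2)] by (simp add: y_def e_def algebra_simps)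
    \<comment> \<open>The difference between \<open>u\<close> and \<open>?Q\<close> cancels the
      gradient of |x|^2 / 2 that \<open>edge_form\<close> subtracts. Hence the form in the periodic
      data equals the form in the Pogorelov data.\<close>
    have "(w q *\<^sub>R q - w p *\<^sub>R p) \<bullet> (\<i> * e) = (w q - w p) * (((1 / 2) *\<^sub>R (p + q)) \<bullet> (\<i> * e))"
      unfolding e_def by (simp add: inner_complex_def field_simps)
    moreover have "u q - u p = (?Q q - ?Q p) + (w q *\<^sub>R q - w p *\<^sub>R p)" by simp
    moreover have "edge_mean H p q - ((1 - \<epsilon>) / 2) *\<^sub>R (p + q) = ?N p q - (1 / 2) *\<^sub>R (p + q)"
      by (simp add: diff_divide_distrib scaleR_diff_left)
    ultimately have "(w q - w p) * ((u q - u p) \<bullet> (\<i> * e)) +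
        (w q - w p)\<^sup>2 * ((edge_mean H p q - ((1 - \<epsilon>) / 2) *\<^sub>R (p + q)) \<bullet> (\<i> * e))
      = (w q - w p) * ((?Q q - ?Q p) \<bullet> (\<i> * e)) + (w q - w p)\<^sup>2 * (?N p q \<bullet> (\<i> * e))"
      by (simp only: inner_add_left[of "?Q q - ?Q p"] inner_diff_left[of "?N p q"] alg)
    then have "edge_form \<epsilon> H w u p q =
       ((w q - w p) * ((?Q q - ?Q p) \<bullet> (\<i> * e)) + (w q - w p)\<^sup>2 * (?N p q \<bullet> (\<i> * e))) / (norm e)\<^sup>2"
      by (simp add: edge_form_def e_def)
    also have "\<dots> = (w q - w p) * (?N p q \<bullet> (\<i> * \<alpha>)) + \<omega> * (w q - w p) + ?err p q"
      using edge_identity[OF e0 _ Q, of "w q - w p" "?N p q"] \<alpha>'[OF pq(1,2)] by (simp add: e_def)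
    finally show "edge_form \<epsilon> H w u p q = (\<alpha> \<bullet> (q - p)) * (?N p q \<bullet> (\<i> * \<alpha>)) + \<omega> * (w q - w p) + ?err p q"
      using \<alpha>'[OF pq(1,2)] by simp
    have Ne: "?N p q \<bullet> e = (G q + \<epsilon> / 2 * (norm q)\<^sup>2) - (G p + \<epsilon> / 2 * (norm p)\<^sup>2)"
    proof -
      have "(p + q) \<bullet> (q - p) = (norm q)\<^sup>2 - (norm p)\<^sup>2"
        by (simp add: power2_norm_eq_inner inner_diff_right inner_add_left inner_commute[of q p])
      then show ?thesis unfolding e_def
        using edge_mean_gradient[OF G H, of p q]
        by (simp only: inner_add_left inner_scaleR_left) (simp add: algebra_simps)
    qed
    have d: "\<bar>?N p q \<bullet> e - (z q - z p)\<bar> \<le> 2 * \<delta>"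
      using z[OF pq(1)] z[OF pq(2)] unfolding Ne by linarith
    have 1: "\<bar>\<alpha> \<bullet> (\<i> * e)\<bar> \<le> norm \<alpha> * norm e" "\<bar>w q - w p\<bar> \<le> norm \<alpha> * norm e"
      using Cauchy_Schwarz_ineq2[of \<alpha> "\<i> * e"] Cauchy_Schwarz_ineq2[of \<alpha> e] \<alpha>'[OF pq(1,2)]
      by (simp_all add: norm_mult e_def)
    have "\<bar>(\<alpha> \<bullet> (\<i> * e)) * (w q - w p) * (?N p q \<bullet> e - (z q - z p))\<bar>
      \<le> (norm \<alpha> * norm e) * (norm \<alpha> * norm e) * (2 * \<delta>)"
      unfolding abs_mult by (intro mult_mono 1 d mult_nonneg_nonneg) auto
    also have "\<dots> = 2 * \<delta> * (norm \<alpha>)\<^sup>2 * (norm e)\<^sup>2" by (simp add: power2_eq_square)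
    finally have "(\<alpha> \<bullet> (\<i> * e)) * (w q - w p) * (?N p q \<bullet> e - (z q - z p)) \<le> 2 * \<delta> * (norm \<alpha>)\<^sup>2 * (norm e)\<^sup>2"
      by linarith
    then show "?err p q \<le> 2 * \<delta> * (norm \<alpha>)\<^sup>2"
      using e0 by (simp add: e_def[symmetric] pos_divide_le_eq)
  qed
  have ne: "a \<noteq> b" "b \<noteq> c" "c \<noteq> a" using ccw by (auto simp: cross2_def)
  have sl: "(\<alpha> \<bullet> (b - a)) * (?N a b \<bullet> (\<i> * \<alpha>)) + (\<alpha> \<bullet> (c - b)) * (?N b c \<bullet> (\<i> * \<alpha>)) + (\<alpha> \<bullet> (a - c)) * (?N c a \<bullet> (\<i> * \<alpha>))
    = slice_sum \<alpha> H a b c - \<epsilon> / 2 * cross2 (b - a) (c - a) * (norm \<alpha>)\<^sup>2"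
  proof -
    define X where "X p q = (\<alpha> \<bullet> (q - p)) * ((p + q) \<bullet> (\<i> * \<alpha>))" for p q
    \<comment> \<open>This is twice the slice sum of the identity field, whose edge means are
      \<open>(p + q) / 2\<close>.\<close>
    have "X a b + X b c + X c a = - (cross2 (b - a) (c - a) * (norm \<alpha>)\<^sup>2)"
      unfolding cmod_power2
      by (simp add: X_def inner_complex_def cross2_def power2_eq_square algebra_simps)
    then have X: "\<epsilon> / 2 * X a b + \<epsilon> / 2 * X b c + \<epsilon> / 2 * X c a
        = - (\<epsilon> / 2 * cross2 (b - a) (c - a) * (norm \<alpha>)\<^sup>2)"
      unfolding distrib_left[symmetric] by simp
    have "(\<alpha> \<bullet> (q - p)) * (?N p q \<bullet> (\<i> * \<alpha>)) =
        (\<alpha> \<bullet> (q - p)) * (edge_mean H p q \<bullet> (\<i> * \<alpha>)) + \<epsilon> / 2 * X p q" for p q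
      unfolding X_def inner_add_left[of "edge_mean H p q"] inner_scaleR_left by algebra
    with X show ?thesis
      unfolding slice_sum_def by (simp only:)
  qed
  have "edge_form \<epsilon> H w u a b + edge_form \<epsilon> H w u b c + edge_form \<epsilon> H w u c a
    = slice_sum \<alpha> H a b c - \<epsilon> / 2 * cross2 (b - a) (c - a) * (norm \<alpha>)\<^sup>2 + ?err a b + ?err b c + ?err c a"
  proof (rule sum3)
    show "\<omega> * (w b - w a) + \<omega> * (w c - w b) + \<omega> * (w a - w c) = 0" by (simp add: algebra_simps)
  qed (rule edge sl; use ne in simp)+
  moreover have "slice_sum \<alpha> H a b c \<le> 0" by (rule slice_sum_nonpos[OF H mono ccw])
  moreover have "?err a b \<le> 2 * \<delta> * (norm \<alpha>)\<^sup>2" "?err b c \<le> 2 * \<delta> * (norm \<alpha>)\<^sup>2" "?err c a \<le> 2 * \<delta> * (norm \<alpha>)\<^sup>2"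
    using err ne by auto
  ultimately show ?thesis by linarith
qed

section \<open>Periodic triangulations of the plane\<close>

lemma cross2_simps:
  "cross2 (x + y) v = cross2 x v + cross2 y v" "cross2 v (x + y) = cross2 v x + cross2 v y"
  "cross2 (x - y) v = cross2 x v - cross2 y v" "cross2 v (x - y) = cross2 v x - cross2 v y"
  "cross2 (k *\<^sub>R x) v = k * cross2 x v" "cross2 v (k *\<^sub>R x) = k * cross2 v x"
  "cross2 x x = 0"
  by (simp_all add: cross2_def algebra_simps)

lemma cross2_le: "\<bar>cross2 x y\<bar> \<le> norm x * norm y"
proof -
  have "cross2 x y = (\<i> * x) \<bullet> y" by (simp add: cross2_def inner_complex_def)
  then show ?thesis using Cauchy_Schwarz_ineq2[of "\<i> * x" y] by (simp add: norm_mult)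
qed

text \<open>The vertex over \<open>x\<close> lies at height \<open>r x + |x|\<^sup>2 / 2\<close>. In a chart in which a polyhedron is a graph over
  the plane, a deformation moves the planar position of the vertex with velocity \<open>u x\<close>, and
  \<open>w x\<close> is half the logarithmic derivative of \<open>r x\<close>. The pair \<open>(u x - w x *\<^sub>R x, w x)\<close> is the
  image under the Pogorelov map: it is an infinitesimal isometric deformation of the Euclidean
  graph, which is the assumption \<open>strain\<close>.\<close>

locale periodic_framework =
  fixes T :: "complex set set" and \<Lambda> :: "complex set" and a1 a2 :: complex
    and r w :: "complex \<Rightarrow> real" and u :: "complex \<Rightarrow> complex" and L :: real
  assumes triangle: "\<And>t. t \<in> T \<Longrightarrow> \<exists>a b c. t = {a,b,c} \<and> cross2 (b - a) (c - a) > 0"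
    and inter: "\<And>s t. s \<in> T \<Longrightarrow> t \<in> T \<Longrightarrow> convex hull s \<inter> convex hull t = convex hull (s \<inter> t)"
    and locfin: "\<And>K. compact K \<Longrightarrow> finite {t\<in>T. convex hull t \<inter> K \<noteq> {}}"
    and cover: "(\<Union>t\<in>T. convex hull t) = UNIV"
    and edge_le: "\<And>t a b. t \<in> T \<Longrightarrow> a \<in> t \<Longrightarrow> b \<in> t \<Longrightarrow> norm (a - b) \<le> L"
    and \<Lambda>_diff: "\<And>x y. x \<in> \<Lambda> \<Longrightarrow> y \<in> \<Lambda> \<Longrightarrow> x - y \<in> \<Lambda>"
    and a12: "a1 \<in> \<Lambda>" "a2 \<in> \<Lambda>" "cross2 a1 a2 > 0"
    and V_shift: "\<And>x l. x \<in> \<Union>T \<Longrightarrow> l \<in> \<Lambda> \<Longrightarrow> x + l \<in> \<Union>T"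
    and r_shift: "\<And>x l. x \<in> \<Union>T \<Longrightarrow> l \<in> \<Lambda> \<Longrightarrow> r (x + l) = r x"
    and w_shift: "\<And>x l. x \<in> \<Union>T \<Longrightarrow> l \<in> \<Lambda> \<Longrightarrow> w (x + l) = w x"
    and u_shift: "\<And>x y l. x \<in> \<Union>T \<Longrightarrow> y \<in> \<Union>T \<Longrightarrow> l \<in> \<Lambda> \<Longrightarrow> u (x + l) - u (y + l) = u x - u y"
    and strain: "\<And>t x y. t \<in> T \<Longrightarrow> x \<in> t \<Longrightarrow> y \<in> t \<Longrightarrow>
      (y - x) \<bullet> ((u y - w y *\<^sub>R y) - (u x - w x *\<^sub>R x))
        + ((r y + (norm y)\<^sup>2 / 2) - (r x + (norm x)\<^sup>2 / 2)) * (w y - w x) = 0"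
    and support: "\<And>i. i \<in> \<Union>T \<Longrightarrow> \<exists>\<beta>. \<forall>j\<in>\<Union>T - {i}. \<beta> \<bullet> (j - i) < r j - r i + (norm (j - i))\<^sup>2 / 2"
begin

abbreviation V :: "complex set" where "V \<equiv> \<Union>T"

definition lat :: "int \<Rightarrow> int \<Rightarrow> complex" where
  "lat m n = real_of_int m *\<^sub>R a1 + real_of_int n *\<^sub>R a2"

text \<open>The coordinates in the basis \<open>a1\<close>, \<open>a2\<close>, by Cramer's
  rule.\<close>

definition cs :: "complex \<Rightarrow> real" where "cs x = cross2 x a2 / cross2 a1 a2"
definition ct :: "complex \<Rightarrow> real" where "ct x = cross2 a1 x / cross2 a1 a2"

lemma coords: "x = cs x *\<^sub>R a1 + ct x *\<^sub>R a2"
proof -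
  have "cross2 a1 a2 *\<^sub>R x = cross2 x a2 *\<^sub>R a1 + cross2 a1 x *\<^sub>R a2"
    by (simp add: cross2_def complex_eq_iff algebra_simps)
  also have "\<dots> = cross2 a1 a2 *\<^sub>R (cs x *\<^sub>R a1 + ct x *\<^sub>R a2)"
    using a12(3) by (simp add: cs_def ct_def scaleR_add_right)
  finally show ?thesis using a12(3) by (simp only: scaleR_cancel_left) auto
qed

lemma coord_simps:
  "cs (x + y) = cs x + cs y" "cs (x - y) = cs x - cs y" "ct (x + y) = ct x + ct y" "ct (x - y) = ct x - ct y"
  "cs (lat m n) = m" "ct (lat m n) = n"
  using a12(3) by (simp_all add: cs_def ct_def lat_def cross2_simps add_divide_distrib diff_divide_distrib)

lemma coord_bound: obtains K where "K > 0" "\<And>x. \<bar>cs x\<bar> \<le> K * norm x" "\<And>x. \<bar>ct x\<bar> \<le> K * norm x"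
proof
  let ?K = "(norm a1 + norm a2) / cross2 a1 a2"
  have "a1 \<noteq> 0" using a12(3) by (auto simp: cross2_def)
  then show "0 < ?K" using a12(3) by (intro divide_pos_pos add_pos_nonneg) auto
  show "\<bar>cs x\<bar> \<le> ?K * norm x" for x
  proof -
    have "\<bar>cross2 x a2\<bar> \<le> (norm a1 + norm a2) * norm x"
      using cross2_le[of x a2] mult_right_mono[of "norm a2" "norm a1 + norm a2" "norm x"]
      by (simp add: mult.commute)
    then show ?thesis using a12(3) by (simp add: cs_def abs_div_pos[symmetric] divide_right_mono)
  qed
  show "\<bar>ct x\<bar> \<le> ?K * norm x" for x
  proof -
    have "\<bar>cross2 a1 x\<bar> \<le> (norm a1 + norm a2) * norm x"
      using cross2_le[of a1 x] mult_right_mono[of "norm a1" "norm a1 + norm a2" "norm x"]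
      by (simp add: mult.commute)
    then show ?thesis using a12(3) by (simp add: ct_def abs_div_pos[symmetric] divide_right_mono)
  qed
qed

lemma lat_in: "lat m n \<in> \<Lambda>"
proof -
  have 0: "0 \<in> \<Lambda>" using \<Lambda>_diff[OF a12(1) a12(1)] by simp
  have neg: "- x \<in> \<Lambda>" if "x \<in> \<Lambda>" for x using \<Lambda>_diff[OF 0 that] by simp
  have add: "x + y \<in> \<Lambda>" if "x \<in> \<Lambda>" "y \<in> \<Lambda>" for x y
    using \<Lambda>_diff[OF that(1) neg[OF that(2)]] by simp
  have nat: "real k *\<^sub>R x \<in> \<Lambda>" if "x \<in> \<Lambda>" for k x
    by (induction k) (use 0 add that in \<open>auto simp: scaleR_add_left simp del: scaleR_conv_of_real\<close>)
  have int: "real_of_int k *\<^sub>R x \<in> \<Lambda>" if "x \<in> \<Lambda>" for k x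
  proof (cases "k \<ge> 0")
    case True then show ?thesis using nat[OF that, of "nat k"] by simp
  next
    case False then show ?thesis using neg[OF nat[OF that, of "nat (-k)"]] by simp
  qed
  show ?thesis unfolding lat_def by (intro add int a12)
qed

lemma lat_neg: "- lat m n = lat (- m) (- n)"
  by (simp add: lat_def)

lemma V_minus: "x \<in> V \<Longrightarrow> x - lat m n \<in> V"
  using V_shift[of x "lat (-m) (-n)"] lat_in[of "-m" "-n"] by (simp add: lat_neg[symmetric])

definition D where "D = norm a1 + norm a2"

lemma reduce: "norm (x - lat \<lfloor>cs x\<rfloor> \<lfloor>ct x\<rfloor>) \<le> D"
proof -
  have "x - lat \<lfloor>cs x\<rfloor> \<lfloor>ct x\<rfloor> = frac (cs x) *\<^sub>R a1 + frac (ct x) *\<^sub>R a2"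
    using coords[of x] by (simp add: lat_def frac_def scaleR_diff_left algebra_simps)
  then have "norm (x - lat \<lfloor>cs x\<rfloor> \<lfloor>ct x\<rfloor>) \<le> frac (cs x) * norm a1 + frac (ct x) * norm a2"
    using norm_triangle_ineq[of "frac (cs x) *\<^sub>R a1" "frac (ct x) *\<^sub>R a2"] by simp
  also have "\<dots> \<le> D"
    unfolding D_def using frac_lt_1[of "cs x"] frac_lt_1[of "ct x"]
    by (intro add_mono mult_left_le_one_le) (auto simp: less_imp_le)
  finally show ?thesis .
qed

lemma D_nonneg: "0 \<le> D" by (simp add: D_def)

lemma finite_T: "t \<in> T \<Longrightarrow> finite t"
  using triangle by fastforce

lemma finite_V: "finite (V \<inter> cball 0 R)"
proof (rule finite_subset)
  show "V \<inter> cball 0 R \<subseteq> \<Union>{t\<in>T. convex hull t \<inter> cball 0 R \<noteq> {}}"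
    using hull_inc by fastforce
  show "finite (\<Union>{t\<in>T. convex hull t \<inter> cball 0 R \<noteq> {}})"
    using locfin[of "cball 0 R"] finite_T by (auto intro!: finite_Union)
qed

lemma V_nonempty: "V \<noteq> {}"
proof -
  have "T \<noteq> {}" using cover by auto
  then show ?thesis using triangle by fastforce
qed

lemma V_near: obtains i where "i \<in> V" "norm (x - i) \<le> D"
proof -
  obtain v where v: "v \<in> V" using V_nonempty by blast
  have "v + lat \<lfloor>cs (x - v)\<rfloor> \<lfloor>ct (x - v)\<rfloor> \<in> V" by (intro V_shift v lat_in)
  moreover have "norm (x - (v + lat \<lfloor>cs (x - v)\<rfloor> \<lfloor>ct (x - v)\<rfloor>)) \<le> D"
    using reduce[of "x - v"] by (simp add: algebra_simps)
  ultimately show ?thesis using that by blast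
qed

text \<open>Each triangle occurs three times, once for every choice of its first vertex, so that
  sums over directed edges become sums over triples.\<close>

definition oriented :: "(complex \<times> complex \<times> complex) set" where
  "oriented = {(a,b,c). {a,b,c} \<in> T \<and> cross2 (b - a) (c - a) > 0}"

lemma oriented_rot: "(a,b,c) \<in> oriented \<Longrightarrow> (b,c,a) \<in> oriented"
  by (auto simp: oriented_def cross2_def insert_commute algebra_simps)

lemma oriented_distinct: "(a,b,c) \<in> oriented \<Longrightarrow> a \<noteq> b \<and> b \<noteq> c \<and> c \<noteq> a"
  by (auto simp: oriented_def cross2_def)

lemma oriented_V: "(a,b,c) \<in> oriented \<Longrightarrow> a \<in> V \<and> b \<in> V \<and> c \<in> V"
  unfolding oriented_def by (blast intro: UnionI)

lemma T_imp_oriented: assumes "t \<in> T" obtains a b c where "t = {a,b,c}" "(a,b,c) \<in> oriented"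
  using triangle[OF assms] assms by (auto simp: oriented_def)

text \<open>Every triangle can be translated into this ball: \<open>reduce\<close> bounds one vertex
  by \<open>D\<close>, and the edges have length at most \<open>L\<close>.\<close>

definition V0 where "V0 = V \<inter> cball 0 (D + L)"

lemma L_nonneg: "0 \<le> L"
  using V_nonempty edge_le norm_ge_zero by (metis UnionE all_not_in_conv order_trans)

lemma reduce_oriented:
  assumes "(a,b,c) \<in> oriented"
  defines "l \<equiv> lat \<lfloor>cs a\<rfloor> \<lfloor>ct a\<rfloor>"
  shows "a - l \<in> V0" "b - l \<in> V0" "c - l \<in> V0"
proof -
  have n: "norm (a - l) \<le> D" unfolding l_def by (rule reduce)
  have "norm (b - a) \<le> L" "norm (c - a) \<le> L" using assms edge_le by (auto simp: oriented_def)
  then have "norm (b - l) \<le> D + L" "norm (c - l) \<le> D + L"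
    using n norm_triangle_ineq[of "b - a" "a - l"] norm_triangle_ineq[of "c - a" "a - l"] by auto
  with n L_nonneg show "a - l \<in> V0" "b - l \<in> V0" "c - l \<in> V0"
    using oriented_V[OF assms(1)] V_minus by (auto simp: V0_def l_def)
qed

lemma finite_V0: "finite V0" unfolding V0_def by (rule finite_V)

text \<open>A translate of a triangle need not belong to \<open>T\<close>, but its vertices belong
  to \<open>V\<close>, and after reduction they lie in the finite set \<open>V0\<close>. This
  replaces periodicity of the triangulation.\<close>

lemma finite_types:
  fixes \<Phi> :: "complex \<Rightarrow> complex \<Rightarrow> complex \<Rightarrow> 'a"
  assumes "\<And>a b c l. a \<in> V \<Longrightarrow> b \<in> V \<Longrightarrow> c \<in> V \<Longrightarrow> l \<in> \<Lambda> \<Longrightarrow> \<Phi> (a + l) (b + l) (c + l) = \<Phi> a b c"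
  shows "finite {\<Phi> a b c | a b c. (a,b,c) \<in> oriented}"
proof (rule finite_subset)
  show "{\<Phi> a b c | a b c. (a,b,c) \<in> oriented} \<subseteq> (\<lambda>(a,b,c). \<Phi> a b c) ` (V0 \<times> V0 \<times> V0)"
  proof clarify
    fix a b c assume t: "(a,b,c) \<in> oriented"
    define l where "l = lat \<lfloor>cs a\<rfloor> \<lfloor>ct a\<rfloor>"
    have v: "a - l \<in> V0" "b - l \<in> V0" "c - l \<in> V0" using reduce_oriented[OF t] by (auto simp: l_def)
    have "\<Phi> (a - l) (b - l) (c - l) = \<Phi> a b c"
      using assms[of "a - l" "b - l" "c - l" l] v lat_in by (auto simp: V0_def l_def)
    then show "\<Phi> a b c \<in> (\<lambda>(a,b,c). \<Phi> a b c) ` (V0 \<times> V0 \<times> V0)"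
      using v by (intro rev_image_eqI[where x="(a - l, b - l, c - l)"]) auto
  qed
qed (intro finite_imageI finite_cartesian_product finite_V0)

lemma types_bounded:
  fixes \<Phi> :: "complex \<Rightarrow> complex \<Rightarrow> complex \<Rightarrow> real"
  assumes "\<And>a b c l. a \<in> V \<Longrightarrow> b \<in> V \<Longrightarrow> c \<in> V \<Longrightarrow> l \<in> \<Lambda> \<Longrightarrow> \<Phi> (a + l) (b + l) (c + l) = \<Phi> a b c"
  obtains C where "C > 0" "\<And>a b c. (a,b,c) \<in> oriented \<Longrightarrow> \<Phi> a b c \<le> C"
proof -
  let ?F = "insert 1 {\<Phi> a b c | a b c. (a,b,c) \<in> oriented}"
  have fin: "finite ?F" using finite_types[of \<Phi>, OF assms] by simp
  show ?thesis
  proof (rule that[of "Max ?F"])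
    show "0 < Max ?F" using Max_ge[OF fin, of 1] by auto
    show "\<Phi> a b c \<le> Max ?F" if "(a,b,c) \<in> oriented" for a b c
      by (rule Max_ge[OF fin]) (use that in auto)
  qed
qed

lemma types_positive:
  fixes \<Phi> :: "complex \<Rightarrow> complex \<Rightarrow> complex \<Rightarrow> real"
  assumes "\<And>a b c l. a \<in> V \<Longrightarrow> b \<in> V \<Longrightarrow> c \<in> V \<Longrightarrow> l \<in> \<Lambda> \<Longrightarrow> \<Phi> (a + l) (b + l) (c + l) = \<Phi> a b c"
  obtains e where "e > 0" "\<And>a b c. (a,b,c) \<in> oriented \<Longrightarrow> \<Phi> a b c > 0 \<Longrightarrow> \<Phi> a b c \<ge> e"
proof -
  let ?F = "insert 1 ({\<Phi> a b c | a b c. (a,b,c) \<in> oriented} \<inter> {0<..})"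
  have fin: "finite ?F" using finite_types[of \<Phi>, OF assms] by simp
  show ?thesis
  proof (rule that[of "Min ?F"])
    show "0 < Min ?F" using fin by (subst Min_gr_iff) auto
    show "Min ?F \<le> \<Phi> a b c" if "(a,b,c) \<in> oriented" "\<Phi> a b c > 0" for a b c
      by (rule Min_le[OF fin]) (use that in auto)
  qed
qed

end

section \<open>Triangles on the two sides of an edge\<close>

lemma ccw_midpoint_inside:
  assumes ccw: "cross2 (b - a) (c - a) > 0"
  obtains \<eta> where "\<eta> > 0" "midpoint a b + \<eta> *\<^sub>R (\<i> * (b - a)) \<in> convex hull {a,b,c}"
proof -
  define e A where "e = b - a" and "A = cross2 e (c - a)"
  have A: "A > 0" using ccw by (simp add: A_def e_def)
  have e0: "e \<noteq> 0" using ccw by (auto simp: e_def cross2_def)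
  then have ne: "(norm e)\<^sup>2 > 0" by simp
  define \<sigma> where "\<sigma> = (c - a) \<bullet> e / (norm e)\<^sup>2"
  \<comment> \<open>The weight given to \<open>c\<close>. The weight of \<open>b\<close> is shifted
    by \<open>\<gamma> * \<sigma>\<close> so that the point stays over the midpoint, and \<gamma> is
    small enough for the weights of \<open>a\<close> and \<open>b\<close> to remain
    non-negative.\<close>
  define \<gamma> where "\<gamma> = 1 / (2 * (1 + \<bar>\<sigma>\<bar>))"
  have \<gamma>: "\<gamma> > 0" by (simp add: \<gamma>_def add_pos_nonneg)
  have g1: "\<gamma> * (1 + \<bar>\<sigma>\<bar>) = 1/2" by (simp add: \<gamma>_def field_simps)
  have g2: "\<bar>\<gamma> * \<sigma>\<bar> + \<gamma> = 1/2" using g1 \<gamma> by (simp add: abs_mult algebra_simps)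
  have c: "(norm e)\<^sup>2 *\<^sub>R (c - a) = ((c - a) \<bullet> e) *\<^sub>R e + A *\<^sub>R (\<i> * e)"
    unfolding cmod_power2
    by (simp add: A_def cross2_def inner_complex_def complex_eq_iff power2_eq_square algebra_simps)
  have c': "c - a = \<sigma> *\<^sub>R e + (A / (norm e)\<^sup>2) *\<^sub>R (\<i> * e)"
  proof -
    have "(norm e)\<^sup>2 *\<^sub>R (\<sigma> *\<^sub>R e + (A / (norm e)\<^sup>2) *\<^sub>R (\<i> * e)) = (norm e)\<^sup>2 *\<^sub>R (c - a)"
      unfolding c using ne by (simp add: scaleR_add_right \<sigma>_def)
    then show ?thesis using ne by (simp only: scaleR_cancel_left) auto
  qed
  show ?thesis
  proof (rule that[of "\<gamma> * A / (norm e)\<^sup>2"])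
    show "\<gamma> * A / (norm e)\<^sup>2 > 0" using \<gamma> A ne by simp
    have "midpoint a b + (\<gamma> * A / (norm e)\<^sup>2) *\<^sub>R (\<i> * (b - a))
      = (1/2 + \<gamma> * \<sigma> - \<gamma>) *\<^sub>R a + (1/2 - \<gamma> * \<sigma>) *\<^sub>R b + \<gamma> *\<^sub>R c"
    proof -
      have m: "midpoint a b = a + (1/2) *\<^sub>R e" by (simp add: midpoint_def e_def complex_eq_iff field_simps)
      have "\<gamma> *\<^sub>R (c - a) = (\<gamma> * \<sigma>) *\<^sub>R e + (\<gamma> * A / (norm e)\<^sup>2) *\<^sub>R (\<i> * e)"
        by (simp add: c' scaleR_add_right)
      then have "(\<gamma> * A / (norm e)\<^sup>2) *\<^sub>R (\<i> * (b - a)) = \<gamma> *\<^sub>R (c - a) - (\<gamma> * \<sigma>) *\<^sub>R (b - a)"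
        by (simp add: e_def)
      then have "midpoint a b + (\<gamma> * A / (norm e)\<^sup>2) *\<^sub>R (\<i> * (b - a))
        = a + (1/2) *\<^sub>R (b - a) + (\<gamma> *\<^sub>R (c - a) - (\<gamma> * \<sigma>) *\<^sub>R (b - a))"
        by (simp only: m e_def)
      also have "\<dots> = (1/2 + \<gamma> * \<sigma> - \<gamma>) *\<^sub>R a + (1/2 - \<gamma> * \<sigma>) *\<^sub>R b + \<gamma> *\<^sub>R c"
        by (simp add: complex_eq_iff algebra_simps)
      finally show ?thesis .
    qed
    then show "midpoint a b + (\<gamma> * A / (norm e)\<^sup>2) *\<^sub>R (\<i> * (b - a)) \<in> convex hull {a, b, c}"
      unfolding convex_hull_3 using \<gamma> g2
      by (intro CollectI exI[of _ "1/2 + \<gamma> * \<sigma> - \<gamma>"] exI[of _ "1/2 - \<gamma> * \<sigma>"] exI[of _ \<gamma>]) (auto; linarith)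
  qed
qed

lemma halfplane_hull:
  assumes "\<And>v. v \<in> S \<Longrightarrow> cross2 e (v - a) \<le> k" and x: "x \<in> convex hull S"
  shows "cross2 e (x - a) \<le> k"
proof -
  have "convex {v. cross2 e (v - a) \<le> k}"
  proof -
    have "{v. cross2 e (v - a) \<le> k} = {v. (\<i> * e) \<bullet> v \<le> k + (\<i> * e) \<bullet> a}"
      by (auto simp: cross2_def inner_complex_def algebra_simps)
    then show ?thesis by (simp add: convex_halfspace_le)
  qed
  then have "convex hull S \<subseteq> {v. cross2 e (v - a) \<le> k}"
    by (intro hull_minimal) (use assms(1) in auto)
  then show ?thesis using x by blast
qed

lemma halfplane_hull_ge:
  assumes "\<And>v. v \<in> S \<Longrightarrow> cross2 e (v - a) \<ge> k" and x: "x \<in> convex hull S"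
  shows "cross2 e (x - a) \<ge> k"
  using halfplane_hull[of S "-e" a "-k" x] assms by (force simp: cross2_def)

lemma ccw_midpoint_inside':
  assumes "cross2 (b - a) (c - a) > 0"
  obtains \<eta> where "\<eta> > 0"
    "\<And>s. 0 \<le> s \<Longrightarrow> s \<le> \<eta> \<Longrightarrow> midpoint a b + s *\<^sub>R (\<i> * (b - a)) \<in> convex hull {a,b,c}"
proof -
  let ?v = "\<i> * (b - a)" and ?C = "convex hull {a,b,c}"
  obtain \<eta> where \<eta>: "\<eta> > 0" "midpoint a b + \<eta> *\<^sub>R ?v \<in> ?C"
    using ccw_midpoint_inside[OF assms] .
  have m: "midpoint a b \<in> ?C"
    using midpoints_in_convex_hull[of a "{a,b,c}" b] by (simp add: hull_inc)
  show ?thesis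
  proof (rule that[OF \<eta>(1)])
    fix s assume s: "0 \<le> s" "s \<le> \<eta>"
    have "(1 - s / \<eta>) *\<^sub>R midpoint a b + (s / \<eta>) *\<^sub>R (midpoint a b + \<eta> *\<^sub>R ?v) \<in> ?C"
      using s \<eta> m by (intro convexD convex_convex_hull) auto
    also have "(1 - s / \<eta>) *\<^sub>R midpoint a b + (s / \<eta>) *\<^sub>R (midpoint a b + \<eta> *\<^sub>R ?v) = midpoint a b + s *\<^sub>R ?v"
      using \<eta>(1) by (simp add: scaleR_diff_left scaleR_add_right)
    finally show "midpoint a b + s *\<^sub>R ?v \<in> ?C" .
  qed
qed

lemma max_diff_le:
  fixes a b a' b' C :: real
  assumes "\<bar>a - a'\<bar> \<le> C" "\<bar>b - b'\<bar> \<le> C"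
  shows "\<bar>max a b - max a' b'\<bar> \<le> C"
  using assms by (auto simp: max_def)

lemma minus_diff_le: "\<bar>p - q\<bar> \<le> C \<Longrightarrow> \<bar>(n - p) - (n - q)\<bar> \<le> C" for p q n C :: real
  by simp

context periodic_framework begin

text \<open>Two triangles on the same side of an edge overlap just beside its midpoint. If their
  third vertices differed, \<open>inter\<close> would confine the overlap to the edge
  itself.\<close>

lemma oriented_unique:
  assumes 1: "(a,b,c) \<in> oriented" and 2: "(a,b,d) \<in> oriented"
  shows "c = d"
proof (rule ccontr)
  assume ne: "c \<noteq> d"
  let ?v = "\<i> * (b - a)"
  obtain \<eta> where \<eta>: "\<eta> > 0" "\<And>s. 0 \<le> s \<Longrightarrow> s \<le> \<eta> \<Longrightarrow> midpoint a b + s *\<^sub>R ?v \<in> convex hull {a,b,c}"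
    using ccw_midpoint_inside'[of b a c] 1 by (auto simp: oriented_def)
  obtain \<eta>' where \<eta>': "\<eta>' > 0" "\<And>s. 0 \<le> s \<Longrightarrow> s \<le> \<eta>' \<Longrightarrow> midpoint a b + s *\<^sub>R ?v \<in> convex hull {a,b,d}"
    using ccw_midpoint_inside'[of b a d] 2 by (auto simp: oriented_def)
  define s where "s = min \<eta> \<eta>'"
  have s: "s > 0" using \<eta> \<eta>' by (simp add: s_def)
  have "midpoint a b + s *\<^sub>R ?v \<in> convex hull {a,b,c} \<inter> convex hull {a,b,d}"
    using \<eta> \<eta>' s by (auto simp: s_def)
  also have "\<dots> = convex hull ({a,b,c} \<inter> {a,b,d})"
    using 1 2 by (intro inter) (auto simp: oriented_def)
  also have "{a,b,c} \<inter> {a,b,d} = {a,b}" using ne oriented_distinct[OF 1] oriented_distinct[OF 2] by auto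
  finally have "cross2 (b - a) (midpoint a b + s *\<^sub>R ?v - a) \<le> 0"
    by (rule halfplane_hull[rotated]) (auto simp: cross2_def)
  moreover have "cross2 (b - a) (midpoint a b + s *\<^sub>R ?v - a) = s * (norm (b - a))\<^sup>2"
    unfolding cmod_power2 by (simp add: cross2_def midpoint_def power2_eq_square field_simps)
  moreover have "s * (norm (b - a))\<^sup>2 > 0"
    by (intro mult_pos_pos s zero_less_power) (use oriented_distinct[OF 1] in auto)
  ultimately show False by linarith
qed

text \<open>A point close to the midpoint \<open>m\<close> on the far side of the edge lies in some
  triangle \<open>t\<close>. By local finiteness \<open>t\<close> also contains \<open>m\<close>;
  this forces \<open>a\<close> and \<open>b\<close> to be vertices of \<open>t\<close>, and a vertex
  of \<open>t\<close> must lie on the far side.\<close>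

lemma oriented_adjacent:
  assumes t: "(a,b,c) \<in> oriented"
  shows "\<exists>d. (b,a,d) \<in> oriented"
proof -
  define e m where "e = b - a" and "m = midpoint a b"
  have A: "cross2 e (c - a) > 0" and sT: "{a,b,c} \<in> T" using t by (auto simp: oriented_def e_def)
  have e0: "norm e > 0" using oriented_distinct[OF t] by (auto simp: e_def)
  define F where "F = {t\<in>T. convex hull t \<inter> cball m (norm e) \<noteq> {}}"
  have F: "finite F" unfolding F_def by (rule locfin) simp
  \<comment> \<open>The nearby triangles that miss \<open>m\<close> form a closed set, so a small
    ball around \<open>m\<close> meets only triangles that contain \<open>m\<close>.\<close>
  define A where "A = (\<Union>t\<in>{t\<in>F. m \<notin> convex hull t}. convex hull t)"
  have "closed A" unfolding A_def
    using F finite_T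
    by (intro closed_UN finite_subset[OF _ F])
       (auto simp: F_def intro!: compact_imp_closed finite_imp_compact_convex_hull)
  moreover have "m \<notin> A" by (auto simp: A_def)
  ultimately obtain \<delta> where \<delta>: "\<delta> > 0" "ball m \<delta> \<subseteq> - A"
    by (metis ComplI open_Compl open_contains_ball)
  define s where "s = min 1 (\<delta> / (2 * norm e))"
  have s: "s > 0" "s \<le> 1" "s * norm e < \<delta>"
    using \<delta> e0 by (auto simp: s_def min_def field_simps)
  define y where "y = m - s *\<^sub>R (\<i> * e)"
  have "dist m y = s * norm e" using s by (simp add: y_def dist_norm norm_mult)
  with s e0 have y: "y \<in> ball m \<delta>" "y \<in> cball m (norm e)" by (auto simp: mult_left_le_one_le)
  obtain t where t: "t \<in> T" "y \<in> convex hull t" using cover by blast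
  have "t \<in> F" using t y by (auto simp: F_def)
  then have mt: "m \<in> convex hull t" using t y(1) \<delta>(2) by (auto simp: A_def)
  \<comment> \<open>The common vertices span a face containing \<open>m\<close>. Neither of the
    other two sides of the given triangle does, hence both \<open>a\<close> and \<open>b\<close> are
    common vertices.\<close>
  have m: "m \<in> convex hull ({a,b,c} \<inter> t)"
    using mt midpoints_in_convex_hull[of a "{a,b,c}" b] inter[OF sT t(1)] by (auto simp: m_def hull_inc)
  have at: "a \<in> t"
  proof (rule ccontr)
    assume "a \<notin> t"
    then have "{a,b,c} \<inter> t \<subseteq> {b,c}" by auto
    then have "m \<in> convex hull {b,c}" using m hull_mono by blast
    then have "cross2 (c - b) (m - b) \<le> 0"
      by (rule halfplane_hull[rotated]) (auto simp: cross2_def)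
    moreover have "cross2 (c - b) (m - b) = cross2 e (c - a) / 2"
      by (simp add: m_def e_def midpoint_def cross2_def field_simps)
    ultimately show False using A by simp
  qed
  have bt: "b \<in> t"
  proof (rule ccontr)
    assume "b \<notin> t"
    then have "{a,b,c} \<inter> t \<subseteq> {a,c}" by auto
    then have "m \<in> convex hull {a,c}" using m hull_mono by blast
    then have "cross2 (a - c) (m - a) \<le> 0"
      by (rule halfplane_hull[rotated]) (auto simp: cross2_def algebra_simps)
    moreover have "cross2 (a - c) (m - a) = cross2 e (c - a) / 2"
      by (simp add: m_def e_def midpoint_def cross2_def field_simps)
    ultimately show False using A by simp
  qed
  have "cross2 e (y - a) = - (s * (norm e)\<^sup>2)"
    unfolding cmod_power2
    by (simp add: y_def m_def e_def midpoint_def cross2_def power2_eq_square field_simps)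
  moreover have "s * (norm e)\<^sup>2 > 0" using s e0 by simp
  ultimately have "cross2 e (y - a) < 0" by linarith
  then obtain d where d: "d \<in> t" "cross2 e (d - a) < 0"
    using halfplane_hull_ge[of t 0 e a y] t(2) by (meson not_le)
  obtain p q r' where pqr: "t = {p,q,r'}" "(p,q,r') \<in> oriented" using T_imp_oriented[OF t(1)] .
  have "d \<noteq> a" "d \<noteq> b" using d(2) by (auto simp: cross2_def e_def)
  then have "{a,b,d} = t"
    using at bt d(1) e0 pqr(1) oriented_distinct[OF pqr(2)]
    by (intro card_subset_eq) (auto simp: e_def)
  moreover have "cross2 (a - b) (d - b) > 0"
    using d(2) by (simp add: e_def cross2_def algebra_simps)
  ultimately show ?thesis using t(1) by (auto simp: oriented_def insert_commute)
qed

section \<open>The cutoff and cancellation across edges\<close>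

definition chi :: "nat \<Rightarrow> complex \<Rightarrow> real" where
  "chi n x = max 0 (real n - max \<bar>cs x\<bar> \<bar>ct x\<bar>)"

definition oriented_near :: "nat \<Rightarrow> (complex \<times> complex \<times> complex) set" where
  "oriented_near n = {(a,b,c)\<in>oriented. chi n a > 0 \<or> chi n b > 0 \<or> chi n c > 0}"

lemma chi_nonneg: "0 \<le> chi n x" and chi_le: "chi n x \<le> n"
  by (auto simp: chi_def)

lemma oriented_near_rot: "(a,b,c) \<in> oriented_near n \<Longrightarrow> (b,c,a) \<in> oriented_near n"
  using oriented_rot by (auto simp: oriented_near_def)

text \<open>The bound is uniform in \<open>n\<close>: \<open>chi n\<close> is a pyramid whose slopes
  do not depend on its height, and the triangles have finitely many shapes up to
  translation.\<close>

lemma coord_diff_bound: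
  obtains C where "C > 0"
    "\<And>n a b c x y. (a,b,c) \<in> oriented \<Longrightarrow> x \<in> {a,b,c} \<Longrightarrow> y \<in> {a,b,c} \<Longrightarrow>
       \<bar>cs x - cs y\<bar> \<le> C \<and> \<bar>ct x - ct y\<bar> \<le> C \<and> \<bar>chi n x - chi n y\<bar> \<le> C"
proof -
  let ?\<Phi> = "\<lambda>a b c. \<bar>cs b - cs a\<bar> + \<bar>ct b - ct a\<bar> + \<bar>cs c - cs a\<bar> + \<bar>ct c - ct a\<bar>"
  obtain C where C: "C > 0" "\<And>a b c. (a,b,c) \<in> oriented \<Longrightarrow> ?\<Phi> a b c \<le> C"
    using types_bounded[of ?\<Phi>] by (auto simp: coord_simps)
  show ?thesis
  proof (rule that[OF C(1)])
    fix n a b c x y assume *: "(a,b,c) \<in> oriented" "x \<in> {a,b,c}" "y \<in> {a,b,c}"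
    have "\<bar>cs x - cs y\<bar> \<le> C" "\<bar>ct x - ct y\<bar> \<le> C" using C(2)[OF *(1)] *(2,3) by auto
    moreover from this have "\<bar>max \<bar>cs x\<bar> \<bar>ct x\<bar> - max \<bar>cs y\<bar> \<bar>ct y\<bar>\<bar> \<le> C"
      by (intro max_diff_le) linarith+
    then have "\<bar>chi n x - chi n y\<bar> \<le> C"
      unfolding chi_def using C(1) by (intro max_diff_le[OF _ minus_diff_le]) simp_all
    ultimately show "\<bar>cs x - cs y\<bar> \<le> C \<and> \<bar>ct x - ct y\<bar> \<le> C \<and> \<bar>chi n x - chi n y\<bar> \<le> C"
      by simp
  qed
qed

text \<open>A triple is determined by the lattice cell of its first vertex and by its reduced shape.
  The cells lie in a box of side proportional to \<open>n\<close>, the shapes in a fixed finite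
  set.\<close>

lemma card_oriented_near:
  obtains C where "C > 0" "\<And>n. n \<ge> 1 \<Longrightarrow> finite (oriented_near n) \<and> card (oriented_near n) \<le> C * (real n)\<^sup>2"
proof -
  obtain C1 where C1: "C1 > 0" "\<And>a b c x y. (a,b,c) \<in> oriented \<Longrightarrow> x \<in> {a,b,c} \<Longrightarrow> y \<in> {a,b,c} \<Longrightarrow>
       \<bar>cs x - cs y\<bar> \<le> C1 \<and> \<bar>ct x - ct y\<bar> \<le> C1"
    using coord_diff_bound by metis
  define k where "k = nat \<lceil>C1\<rceil>"
  have k: "C1 \<le> real k" by (simp add: k_def of_nat_ceiling)
  define W where "W = V0 \<times> V0 \<times> V0"
  have W: "finite W" by (simp add: W_def finite_V0)
  \<comment> \<open>For \<open>n \<ge> 1\<close> the number \<open>2 * n + 2 * k + 3\<close> of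
    cells in each direction is at most \<open>(2 * k + 5) * n\<close>. Here \<open>k\<close> allows
    for a first vertex outside the support of the cutoff.\<close>
  let ?C = "(2 * k + 5)\<^sup>2 * (card W + 1)"
  show ?thesis
  proof (rule that[of "real ?C"])
    show "real ?C > 0" by (simp add: add_pos_nonneg)
    fix n :: nat assume n: "n \<ge> 1"
    define N where "N = int n + int k + 1"
    define l where "l a = lat \<lfloor>cs a\<rfloor> \<lfloor>ct a\<rfloor>" for a
    define f where "f = (\<lambda>(a,b,c). ((\<lfloor>cs a\<rfloor>, \<lfloor>ct a\<rfloor>), (a - l a, b - l a, c - l a)))"
    have inj: "inj_on f (oriented_near n)"
      by (rule inj_onI) (auto simp: f_def l_def)
    have sub: "f ` oriented_near n \<subseteq> ({-N..N} \<times> {-N..N}) \<times> W"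
    proof (rule image_subsetI)
      fix x assume "x \<in> oriented_near n"
      moreover obtain a b c where x: "x = (a,b,c)" by (cases x)
      ultimately have *: "(a,b,c) \<in> oriented_near n" by simp
      then have t: "(a,b,c) \<in> oriented" by (auto simp: oriented_near_def)
      obtain v where v: "v \<in> {a,b,c}" "chi n v > 0" using * by (auto simp: oriented_near_def)
      then have "\<bar>cs v\<bar> < n" "\<bar>ct v\<bar> < n" by (auto simp: chi_def)
      then have "\<bar>cs a\<bar> < real n + real k" "\<bar>ct a\<bar> < real n + real k"
        using C1(2)[OF t v(1), of a] k by auto
      then have "\<lfloor>cs a\<rfloor> \<in> {-N..N}" "\<lfloor>ct a\<rfloor> \<in> {-N..N}"
        by (auto simp: N_def le_floor_iff floor_le_iff)
      then show "f x \<in> ({-N..N} \<times> {-N..N}) \<times> W"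
        using reduce_oriented[OF t] by (auto simp: x f_def W_def l_def)
    qed
    have fin: "finite (({-N..N} \<times> {-N..N}) \<times> W)" using W by simp
    have "card (oriented_near n) \<le> card (({-N..N} \<times> {-N..N}) \<times> W)"
      by (rule card_inj_on_le[OF inj sub fin])
    also have "\<dots> = (2 * n + 2 * k + 3)\<^sup>2 * card W"
    proof -
      have "nat (N - (- N) + 1) = 2 * n + 2 * k + 3" unfolding N_def by linarith
      then have "card {-N..N} = 2 * n + 2 * k + 3" by simp
      then show ?thesis by (simp add: card_cartesian_product power2_eq_square)
    qed
    also have "\<dots> \<le> ((2 * k + 5) * n)\<^sup>2 * (card W + 1)"
    proof (intro mult_mono power_mono)
      have "2 * k * 1 \<le> 2 * k * n" "3 * 1 \<le> 3 * n" using n by (auto intro: mult_le_mono2)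
      then show "2 * n + 2 * k + 3 \<le> (2 * k + 5) * n" by (simp add: algebra_simps)
    qed auto
    also have "\<dots> = ?C * n\<^sup>2" by (simp only: power_mult_distrib mult_ac)
    finally have "real (card (oriented_near n)) \<le> real (?C * n\<^sup>2)" by (rule of_nat_mono)
    moreover have "finite (oriented_near n)" by (rule inj_on_finite[OF inj sub fin])
    ultimately show "finite (oriented_near n) \<and> card (oriented_near n) \<le> real ?C * (real n)\<^sup>2" by simp
  qed
qed

text \<open>Every directed edge of a triangle is traversed backwards by the unique triangle across
  it, so the terms cancel in pairs.\<close>

lemma edge_sum_zero:
  assumes fin: "finite (oriented_near n)" and B: "\<And>a b. B b a = - B a b"
  shows "(\<Sum>(a,b,c)\<in>oriented_near n. (chi n a + chi n b) * B a b) = (0::real)"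
proof -
  \<comment> \<open>The neighbour across the edge may leave \<open>oriented_near n\<close> if only
    \<open>c\<close> lies in the support of the cutoff. Restricting to edges of positive weight
    makes \<open>opp\<close> an involution and discards only zero terms.\<close>
  define S where "S = {(a,b,c)\<in>oriented. chi n a + chi n b > 0}"
  define opp where "opp = (\<lambda>(a,b,c::complex). (b, a, THE d. (b,a,d) \<in> oriented))"
  define f where "f = (\<lambda>(a,b,c::complex). (chi n a + chi n b) * B a b)"
  have oppT: "(b, a, THE d. (b,a,d) \<in> oriented) \<in> oriented" if t: "(a,b,c) \<in> oriented" for a b c
    using oriented_adjacent[OF t] oriented_unique by (metis (mono_tags, lifting) the_equality)
  have opp: "opp x \<in> S" "opp (opp x) = x" "f (opp x) = - f x" if x: "x \<in> S" for x
  proof -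
    obtain a b c where abc: "x = (a,b,c)" "(a,b,c) \<in> oriented" "chi n a + chi n b > 0"
      using x by (auto simp: S_def)
    show "opp x \<in> S" using oppT[OF abc(2)] abc by (auto simp: opp_def S_def add.commute)
    have "(THE d. (a,b,d) \<in> oriented) = c" using abc(2) oriented_unique by blast
    then show "opp (opp x) = x" by (simp add: opp_def abc)
    show "f (opp x) = - f x" using B[of a b] by (simp add: opp_def abc f_def add.commute)
  qed
  have sub: "S \<subseteq> oriented_near n"
  proof clarify
    fix a b c assume "(a,b,c) \<in> S"
    then show "(a,b,c) \<in> oriented_near n" using chi_nonneg[of n a] chi_nonneg[of n b]
      by (auto simp: S_def oriented_near_def)
  qed
  have eq: "sum f (oriented_near n) = sum f S"
    using fin sub
  proof (intro sum.mono_neutral_right)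
    show "\<forall>x\<in>oriented_near n - S. f x = 0"
    proof clarify
      fix a b c assume "(a,b,c) \<in> oriented_near n" "(a,b,c) \<notin> S"
      then have "chi n a + chi n b = 0" using chi_nonneg[of n a] chi_nonneg[of n b]
        by (auto simp: S_def oriented_near_def)
      then show "f (a,b,c) = 0" by (simp add: f_def)
    qed
  qed
  have "sum f S = sum (\<lambda>x. f (opp x)) S"
    by (rule sum.reindex_bij_witness[of S opp opp]) (use opp in auto)
  also have "\<dots> = - sum f S" using opp(3) by (simp add: sum_negf)
  finally have "sum f S = 0" by linarith
  then show ?thesis using eq by (simp add: f_def)
qed

text \<open>Rotation permutes the triples, so the three edge terms have equal sums.\<close>

lemma triangle_sum_zero:
  assumes fin: "finite (oriented_near n)" and B: "\<And>a b. B b a = - B a b"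
  shows "(\<Sum>(a,b,c)\<in>oriented_near n. (chi n a + chi n b) * B a b + (chi n b + chi n c) * B b c
     + (chi n c + chi n a) * B c a) = (0::real)"
proof -
  define g where "g = (\<lambda>(a,b,c::complex). (chi n a + chi n b) * B a b)"
  define rot where "rot = (\<lambda>(a::complex,b::complex,c::complex). (b, c, a))"
  have g0: "sum g (oriented_near n) = 0" using edge_sum_zero[OF assms] by (simp add: g_def)
  have rot: "rot x \<in> oriented_near n" "rot (rot (rot x)) = x" if "x \<in> oriented_near n" for x
    using that oriented_near_rot by (auto simp: rot_def split: prod.splits)
  have r1: "sum (\<lambda>x. g (rot x)) (oriented_near n) = sum g (oriented_near n)"
    by (rule sum.reindex_bij_witness[of _ "\<lambda>x. rot (rot x)" rot]) (use rot in auto)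
  have r2: "sum (\<lambda>x. g (rot (rot x))) (oriented_near n) = sum g (oriented_near n)"
    by (rule sum.reindex_bij_witness[of _ rot "\<lambda>x. rot (rot x)"]) (use rot in auto)
  have "sum (\<lambda>x. g x + g (rot x) + g (rot (rot x))) (oriented_near n) = 0"
    using r1 r2 g0 by (simp add: sum.distrib)
  then show ?thesis by (simp add: g_def rot_def case_prod_beta' split_def)
qed

end

section \<open>Strong convexity and smooth interpolation of the heights\<close>

context periodic_framework begin

lemma r_bounded: obtains R where "R > 0" "\<And>x. x \<in> V \<Longrightarrow> \<bar>r x\<bar> \<le> R"
proof -
  let ?F = "insert 1 ((\<lambda>x. \<bar>r x\<bar>) ` (V \<inter> cball 0 D))"
  have fin: "finite ?F" using finite_V by simp
  show ?thesis
  proof (rule that[of "Max ?F"])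
    show "0 < Max ?F" using fin by (subst Max_gr_iff) auto
    fix x assume x: "x \<in> V"
    let ?l = "lat \<lfloor>cs x\<rfloor> \<lfloor>ct x\<rfloor>"
    have v: "x - ?l \<in> V" using V_minus[OF x] .
    then have "r x = r (x - ?l)" using r_shift[OF v lat_in[of "\<lfloor>cs x\<rfloor>" "\<lfloor>ct x\<rfloor>"]] by simp
    moreover have "x - ?l \<in> V \<inter> cball 0 D" using v reduce[of x] by simp
    ultimately have "\<bar>r x\<bar> \<in> ?F" by (intro insertI2 rev_image_eqI[of "x - ?l"]) simp_all
    then show "\<bar>r x\<bar> \<le> Max ?F" using fin by (intro Max_ge)
  qed
qed

text \<open>Far from \<open>i\<close> the quadratic term dominates both the slope \<beta> and the
  bounded function \<open>r\<close>. The remaining vertices are finitely many, each with a positive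
  gap, so a minimum supplies \<epsilon>.\<close>

lemma support_strong_at:
  assumes i: "i \<in> V"
  obtains \<beta> \<epsilon> where "\<epsilon> > 0" "\<epsilon> \<le> 1/2"
    "\<And>j. j \<in> V \<Longrightarrow> \<epsilon> / 2 * (norm (j - i))\<^sup>2 \<le> r j - r i + (norm (j - i))\<^sup>2 / 2 - \<beta> \<bullet> (j - i)"
proof -
  obtain R where R: "R > 0" "\<And>x. x \<in> V \<Longrightarrow> \<bar>r x\<bar> \<le> R" using r_bounded by blast
  obtain \<beta> where \<beta>: "\<And>j. j \<in> V \<Longrightarrow> j \<noteq> i \<Longrightarrow> \<beta> \<bullet> (j - i) < r j - r i + (norm (j - i))\<^sup>2 / 2"
    using support[OF i] by blast
  define gap where "gap j = r j - r i + (norm (j - i))\<^sup>2 / 2 - \<beta> \<bullet> (j - i)" for j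
  \<comment> \<open>From distance \<open>h \<ge> M\<close> on, the linear term and the variation of
    \<open>r\<close> each cost at most \<open>h\<^sup>2 / 8\<close>, which leaves
    \<open>h\<^sup>2 / 4\<close> of the quadratic term.\<close>
  define M where "M = 8 * norm \<beta> + 4 * (R + 1)"
  have far: "1 / 4 * (norm (j - i))\<^sup>2 \<le> gap j" if j: "j \<in> V" "norm (j - i) \<ge> M" for j
  proof -
    define h where "h = norm (j - i)"
    have h: "h \<ge> 8 * norm \<beta>" "h \<ge> 4 * (R + 1)"
      using j(2) R(1) norm_ge_zero[of \<beta>] unfolding h_def M_def by (simp_all, linarith)
    have "\<beta> \<bullet> (j - i) \<le> norm \<beta> * h" unfolding h_def by (rule norm_cauchy_schwarz)
    also have "\<dots> \<le> h / 8 * h" using h by (intro mult_right_mono) (auto simp: h_def)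
    finally have 1: "\<beta> \<bullet> (j - i) \<le> h\<^sup>2 / 8" by (simp add: power2_eq_square)
    have "(4 * (R + 1)) * (4 * (R + 1)) \<le> h * h" using h R by (intro mult_mono) auto
    moreover have "16 * R \<le> (4 * (R + 1)) * (4 * (R + 1))" using R by (simp add: algebra_simps)
    ultimately have 2: "16 * R \<le> h\<^sup>2" by (simp add: power2_eq_square)
    have "\<bar>r i\<bar> \<le> R" "\<bar>r j\<bar> \<le> R" using R i j by auto
    then show ?thesis unfolding gap_def h_def[symmetric] using 1 2 by linarith
  qed
  define J where "J = {j\<in>V. norm (j - i) < M \<and> j \<noteq> i}"
  have "J \<subseteq> V \<inter> cball 0 (M + norm i)"
  proof
    fix j assume "j \<in> J"
    then show "j \<in> V \<inter> cball 0 (M + norm i)"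
      using norm_triangle_ineq[of "j - i" i] by (auto simp: J_def)
  qed
  then have J: "finite J" using finite_V finite_subset by blast
  define E where "E = insert (1/2) ((\<lambda>j. 2 * gap j / (norm (j - i))\<^sup>2) ` J)"
  have E: "finite E" "E \<noteq> {}" using J by (auto simp: E_def)
  have gap_pos: "gap j > 0" if "j \<in> J" for j using that \<beta>[of j] by (auto simp: J_def gap_def)
  define \<epsilon> where "\<epsilon> = Min E"
  have "\<epsilon> > 0" unfolding \<epsilon>_def using E gap_pos by (subst Min_gr_iff) (auto simp: E_def J_def)
  moreover have e2: "\<epsilon> \<le> 1/2" unfolding \<epsilon>_def using E(1) by (intro Min_le) (auto simp: E_def)
  moreover have "\<epsilon> / 2 * (norm (j - i))\<^sup>2 \<le> gap j" if j: "j \<in> V" for j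
  proof -
    consider "j = i" | "j \<in> J" | "norm (j - i) \<ge> M" using j by (fastforce simp: J_def)
    then show ?thesis
    proof cases
      case 1 then show ?thesis by (simp add: gap_def)
    next
      case 2
      then have n: "(norm (j - i))\<^sup>2 > 0" by (simp add: J_def)
      have "\<epsilon> \<le> 2 * gap j / (norm (j - i))\<^sup>2"
        unfolding \<epsilon>_def using E(1) 2 by (intro Min_le) (auto simp: E_def)
      then show ?thesis using n by (simp add: pos_le_divide_eq)
    next
      case 3
      have "\<epsilon> / 2 * (norm (j - i))\<^sup>2 \<le> 1 / 4 * (norm (j - i))\<^sup>2"
        using e2 by (intro mult_right_mono) auto
      then show ?thesis using far[OF j 3] by linarith
    qed
  qed
  ultimately show ?thesis using that[of \<epsilon> \<beta>] by (auto simp: gap_def)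
qed

text \<open>The inequality involves only differences of points and the periodic \<open>r\<close>, so
  the slope found at one vertex serves all its translates, and finitely many vertices represent
  all.\<close>

lemma support_uniform:
  obtains \<epsilon> C where "\<epsilon> > 0" "\<epsilon> \<le> 1/2" "C > 0"
    "\<And>i. i \<in> V \<Longrightarrow> \<exists>\<beta>. norm \<beta> \<le> C \<and>
       (\<forall>j\<in>V. \<epsilon> / 2 * (norm (j - i))\<^sup>2 \<le> r j - r i + (norm (j - i))\<^sup>2 / 2 - \<beta> \<bullet> (j - i))"
proof -
  let ?P = "\<lambda>i \<beta> \<epsilon>. \<epsilon> > 0 \<and> \<epsilon> \<le> 1/2 \<and>
    (\<forall>j\<in>V. \<epsilon> / 2 * (norm (j - i))\<^sup>2 \<le> r j - r i + (norm (j - i))\<^sup>2 / 2 - \<beta> \<bullet> (j - i))"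
  have "\<forall>i\<in>V. \<exists>be. ?P i (fst be) (snd be)"
  proof
    fix i assume "i \<in> V"
    then show "\<exists>be. ?P i (fst be) (snd be)"
    proof (rule support_strong_at)
      fix \<epsilon> \<beta> assume "\<epsilon> > 0" "\<epsilon> \<le> 1/2"
        "\<And>j. j \<in> V \<Longrightarrow> \<epsilon> / 2 * (norm (j - i))\<^sup>2 \<le> r j - r i + (norm (j - i))\<^sup>2 / 2 - \<beta> \<bullet> (j - i)"
      then show ?thesis by (intro exI[of _ "(\<beta>, \<epsilon>)"]) simp
    qed
  qed
  from bchoice[OF this] obtain be' where "\<forall>i\<in>V. ?P i (fst (be' i)) (snd (be' i))" by blast
  define b e where "b i = fst (be' i)" and "e i = snd (be' i)" for i
  have be: "?P i (b i) (e i)" if "i \<in> V" for i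
    using \<open>\<forall>i\<in>V. ?P i (fst (be' i)) (snd (be' i))\<close> that unfolding b_def e_def by blast
  define W where "W = V \<inter> cball 0 D"
  have W: "finite W" unfolding W_def by (rule finite_V)
  define \<epsilon> where "\<epsilon> = Min (insert (1/2) (e ` W))"
  define C where "C = Max (insert 1 ((norm \<circ> b) ` W))"
  show ?thesis
  proof (rule that)
    show "\<epsilon> > 0" unfolding \<epsilon>_def using W be by (subst Min_gr_iff) (auto simp: W_def)
    show "\<epsilon> \<le> 1/2" unfolding \<epsilon>_def using W by (intro Min_le) auto
    show "C > 0" unfolding C_def using W by (subst Max_gr_iff) auto
    fix i assume i: "i \<in> V"
    define l where "l = lat \<lfloor>cs i\<rfloor> \<lfloor>ct i\<rfloor>"
    have l: "l \<in> \<Lambda>" by (simp add: l_def lat_in)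
    have i': "i - l \<in> W" using V_minus[OF i] reduce[of i] by (simp add: W_def l_def)
    then have iV: "i - l \<in> V" by (simp add: W_def)
    have "norm (b (i - l)) \<le> C" unfolding C_def using W i' by (intro Max_ge) auto
    moreover have "\<epsilon> / 2 * (norm (j - i))\<^sup>2 \<le> r j - r i + (norm (j - i))\<^sup>2 / 2 - b (i - l) \<bullet> (j - i)"
      if j: "j \<in> V" for j
    proof -
      have jV: "j - l \<in> V" using V_minus[OF j] by (simp add: l_def)
      have rr: "r (j - l) = r j" "r (i - l) = r i" using r_shift[OF jV l] r_shift[OF iV l] by simp_all
      have "\<epsilon> \<le> e (i - l)" unfolding \<epsilon>_def using W i' by (intro Min_le) auto
      then have "\<epsilon> / 2 * (norm (j - i))\<^sup>2 \<le> e (i - l) / 2 * (norm (j - i))\<^sup>2"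
        by (intro mult_right_mono) auto
      also have "\<dots> \<le> r j - r i + (norm (j - i))\<^sup>2 / 2 - b (i - l) \<bullet> (j - i)"
        using be[OF iV] jV rr by (auto dest!: bspec[where x="j - l"])
      finally show ?thesis .
    qed
    ultimately show "\<exists>\<beta>. norm \<beta> \<le> C \<and>
       (\<forall>j\<in>V. \<epsilon> / 2 * (norm (j - i))\<^sup>2 \<le> r j - r i + (norm (j - i))\<^sup>2 / 2 - \<beta> \<bullet> (j - i))"
      by blast
  qed
qed

text \<open>At every vertex the supporting affine functions of all vertices have maximum equal to
  the height minus \<open>\<epsilon> / 2 * (norm x)\<^sup>2\<close>; a smooth maximum of finitely
  many of them is \<open>G\<close>. Comparison with the paraboloid bounds the gradient by a constant
  independent of \<rho> and \<delta>, which the growing cutoffs require.\<close>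

lemma smooth_interpolation:
  obtains \<epsilon> C where "\<epsilon> > 0" "C > 0"
    "\<And>\<rho> \<delta>. \<rho> > 0 \<Longrightarrow> \<delta> > 0 \<Longrightarrow> \<delta> \<le> 1 \<Longrightarrow> \<exists>G H.
       (\<forall>x. (G has_derivative (\<lambda>h. H x \<bullet> h)) (at x)) \<and> continuous_on UNIV H \<and>
       (\<forall>x y. 0 \<le> (H y - H x) \<bullet> (y - x)) \<and>
       (\<forall>x\<in>V. norm x \<le> \<rho> \<longrightarrow> \<bar>r x + (norm x)\<^sup>2 / 2 - (G x + \<epsilon> / 2 * (norm x)\<^sup>2)\<bar> \<le> \<delta>) \<and>
       (\<forall>x. norm x \<le> \<rho> \<longrightarrow> norm (H x - (1 - \<epsilon>) *\<^sub>R x) \<le> C)"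
proof -
  obtain R where R: "R > 0" "\<And>x. x \<in> V \<Longrightarrow> \<bar>r x\<bar> \<le> R" using r_bounded by blast
  obtain \<epsilon> C where \<epsilon>: "\<epsilon> > 0" "\<epsilon> \<le> 1/2" "C > 0"
    and ex: "\<And>i. i \<in> V \<Longrightarrow> \<exists>\<beta>. norm \<beta> \<le> C \<and>
       (\<forall>j\<in>V. \<epsilon> / 2 * (norm (j - i))\<^sup>2 \<le> r j - r i + (norm (j - i))\<^sup>2 / 2 - \<beta> \<bullet> (j - i))"
    using support_uniform by blast
  obtain b where b: "\<And>i. i \<in> V \<Longrightarrow> norm (b i) \<le> C"
    and bs: "\<And>i j. i \<in> V \<Longrightarrow> j \<in> V \<Longrightarrow>
       \<epsilon> / 2 * (norm (j - i))\<^sup>2 \<le> r j - r i + (norm (j - i))\<^sup>2 / 2 - b i \<bullet> (j - i)"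
    using bchoice[of V] ex by metis
  \<comment> \<open>\<open>B i\<close> is the supporting slope at \<open>i\<close> once \<epsilon> /
    2 * |x|^2 has been subtracted from the heights, and \<open>c i\<close> makes the affine function
    attain the reduced height at \<open>i\<close>.\<close>
  define B c where "B i = b i + (1 - \<epsilon>) *\<^sub>R i" and "c i = r i + (1 - \<epsilon>) / 2 * (norm i)\<^sup>2 - B i \<bullet> i" for i
  have m: "B i \<bullet> x + c i - (1 - \<epsilon>) / 2 * (norm x)\<^sup>2 = r i + b i \<bullet> (x - i) - (1 - \<epsilon>) / 2 * (norm (x - i))\<^sup>2"
    for i x
    by (simp add: B_def c_def power2_norm_eq_inner inner_diff_left inner_diff_right inner_add_left
        inner_commute[of x i] algebra_simps) (simp add: field_simps)
  \<comment> \<open>The affine functions exceed the paraboloid by at most \<open>U\<close>, by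
    completing the square with \<open>\<epsilon> \<le> 1/2\<close>. A vertex within distance
    \<open>D\<close> keeps its function above the paraboloid minus \<open>L'\<close>.\<close>
  define U where "U = R + C\<^sup>2"
  define L' where "L' = R + C * D + D\<^sup>2 / 2"
  have upper: "B i \<bullet> x + c i \<le> (1 - \<epsilon>) / 2 * (norm x)\<^sup>2 + U" if i: "i \<in> V" for i x
  proof -
    let ?h = "norm (x - i)"
    have "b i \<bullet> (x - i) \<le> norm (b i) * ?h" by (rule norm_cauchy_schwarz)
    also have "\<dots> \<le> C * ?h" using b[OF i] by (intro mult_right_mono) auto
    also have "\<dots> \<le> C\<^sup>2 + ?h\<^sup>2 / 4"
      using sum_squares_ge_zero[of "C - ?h / 2" 0] by (simp add: power2_eq_square algebra_simps)
    also have "?h\<^sup>2 / 4 \<le> (1 - \<epsilon>) / 2 * ?h\<^sup>2"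
      using mult_right_mono[of "1/4" "(1 - \<epsilon>)/2" "?h\<^sup>2"] \<epsilon> by simp
    finally have "b i \<bullet> (x - i) \<le> C\<^sup>2 + (1 - \<epsilon>) / 2 * ?h\<^sup>2" by simp
    then show ?thesis using m[of i x] R(2)[OF i] by (simp add: U_def)
  qed
  have lower: "(1 - \<epsilon>) / 2 * (norm x)\<^sup>2 - L' \<le> B i \<bullet> x + c i" if i: "i \<in> V" "norm (x - i) \<le> D" for i x
  proof -
    let ?h = "norm (x - i)"
    have "- (b i \<bullet> (x - i)) \<le> norm (b i) * ?h" using norm_cauchy_schwarz[of "- b i" "x - i"] by simp
    also have "\<dots> \<le> C * D" using b[OF i(1)] i(2) \<epsilon> by (intro mult_mono) auto
    finally have 1: "- (C * D) \<le> b i \<bullet> (x - i)" by simp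
    have "(1 - \<epsilon>) / 2 * ?h\<^sup>2 \<le> 1 / 2 * D\<^sup>2"
      using i(2) \<epsilon> by (intro mult_mono power_mono) auto
    then show ?thesis using 1 m[of i x] R(2)[OF i(1)] by (simp add: L'_def)
  qed
  have vert: "B i \<bullet> j + c i \<le> r j + (1 - \<epsilon>) / 2 * (norm j)\<^sup>2" if "i \<in> V" "j \<in> V" for i j
    using bs[OF that] m[of i j] by (simp add: field_simps)
  have vert': "B j \<bullet> j + c j = r j + (1 - \<epsilon>) / 2 * (norm j)\<^sup>2" for j
    using m[of j j] by simp
  show ?thesis
  proof (rule that[of \<epsilon> "U + L' + 3"])
    show "0 < U + L' + 3"
      unfolding U_def L'_def using R \<epsilon> D_nonneg
      by (intro add_pos_pos add_nonneg_pos add_pos_nonneg mult_nonneg_nonneg) auto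
    fix \<rho> \<delta> :: real assume \<rho>: "\<rho> > 0" and \<delta>: "\<delta> > 0" "\<delta> \<le> 1"
    define S where "S = V \<inter> cball 0 (\<rho> + D)"
    have S: "finite S" unfolding S_def by (rule finite_V)
    have near: "\<exists>i\<in>S. norm (x - i) \<le> D" if "norm x \<le> \<rho>" for x
    proof -
      obtain i where i: "i \<in> V" "norm (x - i) \<le> D" using V_near .
      then have "norm i \<le> \<rho> + D" using that norm_triangle_ineq4[of x "x - i"] by simp
      with i show ?thesis by (auto simp: S_def)
    qed
    have "S \<noteq> {}" using near[of 0] \<rho> by auto
    obtain G H where G: "\<And>x. (G has_derivative (\<lambda>h. H x \<bullet> h)) (at x)" "continuous_on UNIV H"
      "\<And>x y. 0 \<le> (H y - H x) \<bullet> (y - x)"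
      "\<And>x i. i \<in> S \<Longrightarrow> B i \<bullet> x + c i \<le> G x"
      "\<And>x u. (\<And>i. i \<in> S \<Longrightarrow> B i \<bullet> x + c i \<le> u) \<Longrightarrow> G x \<le> u + \<delta>"
      using smooth_maximum[OF S \<open>S \<noteq> {}\<close> \<delta>(1), of B c] by blast
    have 1: "\<bar>r x + (norm x)\<^sup>2 / 2 - (G x + \<epsilon> / 2 * (norm x)\<^sup>2)\<bar> \<le> \<delta>" if x: "x \<in> V" "norm x \<le> \<rho>" for x
    proof -
      have "x \<in> S" using x D_nonneg by (auto simp: S_def)
      then have "r x + (1 - \<epsilon>) / 2 * (norm x)\<^sup>2 \<le> G x" using G(4)[of x x] vert'[of x] by simp
      moreover have "G x \<le> r x + (1 - \<epsilon>) / 2 * (norm x)\<^sup>2 + \<delta>"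
        by (rule G(5)) (use vert x in \<open>auto simp: S_def\<close>)
      ultimately show ?thesis by (simp add: diff_divide_distrib left_diff_distrib)
    qed
    have 2: "norm (H x - (1 - \<epsilon>) *\<^sub>R x) \<le> U + L' + 3" if x: "norm x \<le> \<rho>" for x
    proof -
      define v where "v = H x - (1 - \<epsilon>) *\<^sub>R x"
      \<comment> \<open>A unit step in the direction of \<open>v\<close>: along it \<open>G\<close>
        grows by at least \<open>H x \<bullet> h\<close>, while \<open>lo\<close> and
        \<open>up\<close> limit that growth. The constant \<open>3\<close> covers \<delta> and the
        quadratic increment.\<close>
      define h where "h = sgn v"
      have h: "norm h \<le> 1" "v \<bullet> h = norm v"
        by (cases "v = 0"; simp add: h_def norm_sgn sgn_div_norm dot_square_norm power2_eq_square)+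
      obtain i where i: "i \<in> S" "norm (x - i) \<le> D" using near[OF x] by blast
      then have lo: "(1 - \<epsilon>) / 2 * (norm x)\<^sup>2 - L' \<le> G x"
        using lower[of i x] G(4)[of i x] by (auto simp: S_def)
      have up: "G (x + h) \<le> ((1 - \<epsilon>) / 2 * (norm (x + h))\<^sup>2 + U) + \<delta>"
        by (rule G(5)) (use upper in \<open>auto simp: S_def\<close>)
      have "G x + H x \<bullet> h \<le> G (x + h)"
        using gradient_inequality[OF G(1-3), of x "x + h"] by simp
      moreover have "(norm (x + h))\<^sup>2 = (norm x)\<^sup>2 + 2 * (x \<bullet> h) + (norm h)\<^sup>2"
        by (simp add: power2_norm_eq_inner inner_add_left inner_add_right inner_commute)
      then have "(1 - \<epsilon>) / 2 * (norm (x + h))\<^sup>2 = (1 - \<epsilon>) / 2 * (norm x)\<^sup>2 + (1 - \<epsilon>) * (x \<bullet> h) + (1 - \<epsilon>) / 2 * (norm h)\<^sup>2"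
        by (simp add: field_simps)
      moreover have "(1 - \<epsilon>) / 2 * (norm h)\<^sup>2 \<le> 1 * 1"
        using h(1) \<epsilon> by (intro mult_mono) (auto simp: power_le_one)
      moreover have "H x \<bullet> h = norm v + (1 - \<epsilon>) * (x \<bullet> h)"
        using h(2) by (simp add: v_def inner_diff_left)
      ultimately show ?thesis using lo up \<delta> unfolding v_def by linarith
    qed
    show "\<exists>G H.
       (\<forall>x. (G has_derivative (\<lambda>h. H x \<bullet> h)) (at x)) \<and> continuous_on UNIV H \<and>
       (\<forall>x y. 0 \<le> (H y - H x) \<bullet> (y - x)) \<and>
       (\<forall>x\<in>V. norm x \<le> \<rho> \<longrightarrow> \<bar>r x + (norm x)\<^sup>2 / 2 - (G x + \<epsilon> / 2 * (norm x)\<^sup>2)\<bar> \<le> \<delta>) \<and>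
       (\<forall>x. norm x \<le> \<rho> \<longrightarrow> norm (H x - (1 - \<epsilon>) *\<^sub>R x) \<le> U + L' + 3)"
      by (intro exI[of _ G] exI[of _ H]) (use G 1 2 in auto)
  qed (rule \<epsilon>)
qed

lemma hull_in_ball:
  assumes "t \<in> T" "a \<in> t" "y \<in> convex hull t"
  shows "norm (y - a) \<le> L"
proof -
  have "convex hull t \<subseteq> cball a L"
    using edge_le assms by (intro hull_minimal) (auto simp: dist_norm)
  then show ?thesis using assms(3) by (auto simp: dist_norm norm_minus_commute)
qed

text \<open>Finitely many closed triangles cover \<open>S\<close>. Those labelled like
  \<open>s\<close> and the others would be two disjoint closed pieces of the connected set
  \<open>S\<close>.\<close>

lemma label_constant:
  fixes lab :: "complex set \<Rightarrow> 'l"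
  assumes S: "connected S" "compact S"
    and step: "\<And>s t. s \<in> T \<Longrightarrow> t \<in> T \<Longrightarrow> convex hull s \<inter> convex hull t \<inter> S \<noteq> {} \<Longrightarrow> lab s = lab t"
    and s: "s \<in> T" "convex hull s \<inter> S \<noteq> {}" and t: "t \<in> T" "convex hull t \<inter> S \<noteq> {}"
  shows "lab s = lab t"
proof (rule ccontr)
  assume ne: "lab s \<noteq> lab t"
  define F where "F = {t\<in>T. convex hull t \<inter> S \<noteq> {}}"
  have F: "finite F" unfolding F_def by (rule locfin[OF S(2)])
  define A B where "A = (\<Union>v\<in>{v\<in>F. lab v = lab s}. convex hull v)"
    and "B = (\<Union>v\<in>{v\<in>F. lab v \<noteq> lab s}. convex hull v)"
  have cl: "closed (convex hull v)" if "v \<in> F" for v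
    using that finite_T by (auto simp: F_def intro!: compact_imp_closed finite_imp_compact_convex_hull)
  have "closed A" "closed B" unfolding A_def B_def using cl F
    by (auto intro!: closed_UN finite_subset[OF _ F])
  moreover have "S \<subseteq> A \<union> B"
  proof
    fix x assume x: "x \<in> S"
    then obtain v where "v \<in> T" "x \<in> convex hull v" using cover by blast
    then show "x \<in> A \<union> B" using x by (auto simp: A_def B_def F_def)
  qed
  moreover have "A \<inter> B \<inter> S = {}"
    using step by (force simp: A_def B_def F_def)
  moreover have "A \<inter> S \<noteq> {}" using s by (auto simp: A_def F_def)
  moreover have "convex hull t \<subseteq> B" using t ne by (auto simp: B_def F_def)
  then have "B \<inter> S \<noteq> {}" using t(2) by blast
  ultimately show False using connected_closedD[OF S(1), of A B] by blast
qed

end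

section \<open>Rigidity of periodic frameworks\<close>

context periodic_framework begin

text \<open>The gradient of the affine interpolant of \<open>w\<close> on the triangle.\<close>

definition grad :: "complex \<Rightarrow> complex \<Rightarrow> complex \<Rightarrow> complex" where
  "grad a b c = (1 / cross2 (b - a) (c - a)) *\<^sub>R (\<i> * ((w c - w a) *\<^sub>R (b - a) - (w b - w a) *\<^sub>R (c - a)))"

lemma grad:
  assumes "(a,b,c) \<in> oriented"
  shows "grad a b c \<bullet> (b - a) = w b - w a" "grad a b c \<bullet> (c - a) = w c - w a"
proof -
  have A: "cross2 (b - a) (c - a) > 0" using assms by (simp add: oriented_def)
  have i: "(\<i> * x) \<bullet> y = cross2 x y" for x y by (simp add: inner_complex_def cross2_def)
  have cross2_diff: "cross2 (k *\<^sub>R x - l *\<^sub>R y) v = k * cross2 x v - l * cross2 y v" for k l x y v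
    by (simp add: cross2_simps)
  have s: "cross2 (c - a) (b - a) = - cross2 (b - a) (c - a)" by (simp add: cross2_def)
  show "grad a b c \<bullet> (b - a) = w b - w a"
    using A by (simp add: grad_def i cross2_diff cross2_simps(7) s)
  show "grad a b c \<bullet> (c - a) = w c - w a"
    using A by (simp add: grad_def i cross2_diff cross2_simps(7) s)
qed

lemma grad_shift:
  "a \<in> V \<Longrightarrow> b \<in> V \<Longrightarrow> c \<in> V \<Longrightarrow> l \<in> \<Lambda> \<Longrightarrow> grad (a + l) (b + l) (c + l) = grad a b c"
  by (simp add: grad_def w_shift)

text \<open>The Dirichlet energy of the affine interpolant on the triangle: area times squared
  gradient.\<close>

definition energy :: "complex \<Rightarrow> complex \<Rightarrow> complex \<Rightarrow> real" where
  "energy a b c = cross2 (b - a) (c - a) / 2 * (norm (grad a b c))\<^sup>2"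

lemma energy_nonneg: "(a,b,c) \<in> oriented \<Longrightarrow> 0 \<le> energy a b c"
  by (simp add: energy_def oriented_def)

text \<open>The subtracted term \<open>((1 - \<epsilon>) / 2) *\<^sub>R (a + b)\<close> is the edge
  mean of \<open>(1 - \<epsilon>) *\<^sub>R x\<close>, so only the bounded field
  \<open>H x - (1 - \<epsilon>) *\<^sub>R x\<close> enters.\<close>

lemma edge_form_bound:
  assumes H: "continuous_on UNIV H" and C: "\<And>x. norm x \<le> \<rho> \<Longrightarrow> norm (H x - (1 - \<epsilon>) *\<^sub>R x) \<le> C"
    and ab: "norm a \<le> \<rho>" "norm b \<le> \<rho>" "a \<noteq> b"
  shows "\<bar>edge_form \<epsilon> H w u a b\<bar> \<le>
    \<bar>w b - w a\<bar> * norm (u b - u a) / norm (b - a) + C * ((w b - w a)\<^sup>2 / norm (b - a))"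
proof -
  define N where "N = edge_mean H a b - ((1 - \<epsilon>) / 2) *\<^sub>R (a + b)"
  define e where "e = norm (b - a)"
  have e: "e > 0" using ab by (simp add: e_def)
  have seg: "norm (a + t *\<^sub>R (b - a)) \<le> \<rho>" if "t \<in> {0..1}" for t
  proof -
    have "a + t *\<^sub>R (b - a) = (1 - t) *\<^sub>R a + t *\<^sub>R b" by (simp add: algebra_simps)
    also have "norm \<dots> \<le> (1 - t) * norm a + t * norm b"
      using norm_triangle_ineq[of "(1 - t) *\<^sub>R a" "t *\<^sub>R b"] that by simp
    also have "\<dots> \<le> (1 - t) * \<rho> + t * \<rho>" using that ab by (intro add_mono mult_left_mono) auto
    finally show ?thesis by (simp add: algebra_simps)
  qed
  let ?K = "\<lambda>x. H x - (1 - \<epsilon>) *\<^sub>R x"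
  have i1: "(\<lambda>t. H (a + t *\<^sub>R (b - a))) integrable_on {0..1}" by (rule edge_integrable[OF H])
  have i2: "(\<lambda>t. (1 - \<epsilon>) *\<^sub>R (a + t *\<^sub>R (b - a))) integrable_on {0..1}"
    by (rule edge_integrable) (intro continuous_intros)
  have i3: "((\<lambda>t. (1 - \<epsilon>) *\<^sub>R (a + t *\<^sub>R (b - a))) has_integral ((1 - \<epsilon>) / 2) *\<^sub>R (a + b)) {0..1}"
  proof -
    have "((\<lambda>t. (1 - \<epsilon>) *\<^sub>R (a + t *\<^sub>R (b - a))) has_integral
       (1 - \<epsilon>) *\<^sub>R (1 *\<^sub>R a + (1\<^sup>2 / 2) *\<^sub>R (b - a)) - (1 - \<epsilon>) *\<^sub>R (0 *\<^sub>R a + (0\<^sup>2 / 2) *\<^sub>R (b - a))) {0..1}"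
      by (rule fundamental_theorem_of_calculus)
         (auto intro!: derivative_eq_intros simp: has_real_derivative_iff_has_vector_derivative[symmetric])
    moreover have "(1 - \<epsilon>) *\<^sub>R (1 *\<^sub>R a + (1\<^sup>2 / 2) *\<^sub>R (b - a)) - (1 - \<epsilon>) *\<^sub>R (0 *\<^sub>R a + (0\<^sup>2 / 2) *\<^sub>R (b - a))
      = ((1 - \<epsilon>) / 2) *\<^sub>R (a + b)" by (simp add: complex_eq_iff field_simps)
    ultimately show ?thesis by simp
  qed
  have "N = integral {0..1} (\<lambda>t. ?K (a + t *\<^sub>R (b - a)))"
    unfolding N_def edge_mean_def integral_diff[OF i1 i2] integral_unique[OF i3] ..
  also have "norm \<dots> \<le> integral {0..1} (\<lambda>t::real. C)"
    by (rule integral_norm_bound_integral) (use i1 i2 C seg in \<open>auto intro!: integrable_diff\<close>)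
  finally have N: "norm N \<le> C" by simp
  have i: "norm (\<i> * (b - a)) = e" by (simp add: norm_mult e_def)
  have 1: "\<bar>(w b - w a) * ((u b - u a) \<bullet> (\<i> * (b - a)))\<bar> \<le> \<bar>w b - w a\<bar> * (norm (u b - u a) * e)"
    unfolding abs_mult using Cauchy_Schwarz_ineq2[of "u b - u a" "\<i> * (b - a)"] i
    by (intro mult_left_mono) auto
  have "\<bar>N \<bullet> (\<i> * (b - a))\<bar> \<le> C * e"
    using order_trans[OF Cauchy_Schwarz_ineq2[of N "\<i> * (b - a)", unfolded i] mult_right_mono[OF N, of e]] e
    by simp
  then have 2: "\<bar>(w b - w a)\<^sup>2 * (N \<bullet> (\<i> * (b - a)))\<bar> \<le> (w b - w a)\<^sup>2 * (C * e)"
    unfolding abs_mult by (simp add: mult_left_mono)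
  have "\<bar>edge_form \<epsilon> H w u a b\<bar> = \<bar>(w b - w a) * ((u b - u a) \<bullet> (\<i> * (b - a))) + (w b - w a)\<^sup>2 * (N \<bullet> (\<i> * (b - a)))\<bar> / e\<^sup>2"
    by (simp add: edge_form_def N_def e_def)
  also have "\<dots> \<le> (\<bar>w b - w a\<bar> * (norm (u b - u a) * e) + (w b - w a)\<^sup>2 * (C * e)) / e\<^sup>2"
    using 1 2 by (intro divide_right_mono order_trans[OF abs_triangle_ineq] add_mono) auto
  also have "\<dots> = \<bar>w b - w a\<bar> * norm (u b - u a) / e + C * ((w b - w a)\<^sup>2 / e)"
    using e by (simp add: field_simps power2_eq_square)
  finally show ?thesis by (simp add: e_def)
qed

text \<open>Summing the edge forms with the cutoff \<open>chi n\<close> as a weight leaves only the variation of \<open>chi n\<close> along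
  edges, which is bounded, whereas the weights themselves grow like \<open>n\<close>. The interpolation error
  is taken to be \<open>1 / n\<close>.\<close>

lemma energy_sum_bound:
  obtains K where "K > 0" "\<And>n. n \<ge> 1 \<Longrightarrow> finite (oriented_near n) \<and>
    (\<Sum>(a,b,c)\<in>oriented_near n. chi n a * energy a b c) \<le> K * (real n)\<^sup>2"
proof -
  obtain \<epsilon> CN where \<epsilon>: "\<epsilon> > 0" "CN > 0"
    and ex: "\<And>\<rho> \<delta>. \<rho> > 0 \<Longrightarrow> \<delta> > 0 \<Longrightarrow> \<delta> \<le> 1 \<Longrightarrow> \<exists>G H.
       (\<forall>x. (G has_derivative (\<lambda>h. H x \<bullet> h)) (at x)) \<and> continuous_on UNIV H \<and>
       (\<forall>x y. 0 \<le> (H y - H x) \<bullet> (y - x)) \<and>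
       (\<forall>x\<in>V. norm x \<le> \<rho> \<longrightarrow> \<bar>r x + (norm x)\<^sup>2 / 2 - (G x + \<epsilon> / 2 * (norm x)\<^sup>2)\<bar> \<le> \<delta>) \<and>
       (\<forall>x. norm x \<le> \<rho> \<longrightarrow> norm (H x - (1 - \<epsilon>) *\<^sub>R x) \<le> CN)"
    using smooth_interpolation by blast
  obtain Cc where Cc: "Cc > 0" "\<And>n. n \<ge> 1 \<Longrightarrow> finite (oriented_near n) \<and> card (oriented_near n) \<le> Cc * (real n)\<^sup>2"
    using card_oriented_near by blast
  obtain C1 where C1: "C1 > 0" "\<And>n a b c x y. (a,b,c) \<in> oriented \<Longrightarrow> x \<in> {a,b,c} \<Longrightarrow> y \<in> {a,b,c} \<Longrightarrow>
       \<bar>cs x - cs y\<bar> \<le> C1 \<and> \<bar>ct x - ct y\<bar> \<le> C1 \<and> \<bar>chi n x - chi n y\<bar> \<le> C1"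
    using coord_diff_bound by blast
  obtain CB where CB: "CB > 0" "\<And>a b c. (a,b,c) \<in> oriented \<Longrightarrow>
     \<bar>w b - w a\<bar> * norm (u b - u a) / norm (b - a) + CN * ((w b - w a)\<^sup>2 / norm (b - a)) \<le> CB"
    by (rule types_bounded[of "\<lambda>a b c. \<bar>w b - w a\<bar> * norm (u b - u a) / norm (b - a) + CN * ((w b - w a)\<^sup>2 / norm (b - a))"])
       (auto simp: w_shift u_shift)
  obtain Ca where Ca: "Ca > 0" "\<And>a b c. (a,b,c) \<in> oriented \<Longrightarrow> (norm (grad a b c))\<^sup>2 \<le> Ca"
    by (rule types_bounded[of "\<lambda>a b c. (norm (grad a b c))\<^sup>2"]) (auto simp: grad_shift)
  \<comment> \<open>The interpolation error is at most \<open>(2 * n) * (6 * (1 / n) * Ca)\<close>.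
    Replacing the three edge weights by a common one costs \<open>C1\<close>, \<open>2 * C1\<close>
    and \<open>C1\<close>, each times the bound \<open>CB\<close> of the edge form.\<close>
  define K0 where "K0 = 12 * Ca + 4 * (C1 * CB)"
  have assemble: "t1 + t2 + t3 \<le> 12 * Ca + 4 * k - q"
    if "t1 \<le> p1 + k" "t2 \<le> p2 + 2 * k" "t3 \<le> p3 + k" "p1 + p2 + p3 \<le> A - q" "A \<le> 12 * Ca"
    for t1 t2 t3 p1 p2 p3 k q A :: real
    using that by linarith
  have K0: "K0 > 0" using Ca C1 CB by (simp add: K0_def add_pos_pos)
  show ?thesis
  proof (rule that[of "K0 * Cc / (2 * \<epsilon>)"])
    show "0 < K0 * Cc / (2 * \<epsilon>)" using K0 Cc \<epsilon> by simp
    fix n :: nat assume n: "n \<ge> 1"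
    \<comment> \<open>Vertices of triangles near the support have coordinates at most
      \<open>n + C1\<close>, so this ball contains them.\<close>
    define \<rho> where "\<rho> = (real n + C1) * D + 1"
    have \<rho>: "\<rho> > 0" using C1 D_nonneg by (simp add: \<rho>_def add_nonneg_pos)
    have in_ball: "norm x \<le> \<rho>" if t: "(a,b,c) \<in> oriented_near n" and x: "x \<in> {a,b,c}" for a b c x
    proof -
      obtain v where v: "v \<in> {a,b,c}" "chi n v > 0" using t by (auto simp: oriented_near_def)
      then have "\<bar>cs v\<bar> < n" "\<bar>ct v\<bar> < n" by (auto simp: chi_def)
      moreover have "(a,b,c) \<in> oriented" using t by (auto simp: oriented_near_def)
      ultimately have *: "\<bar>cs x\<bar> \<le> real n + C1" "\<bar>ct x\<bar> \<le> real n + C1"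
        using C1(2)[OF _ x v(1), where n=n] by fastforce+
      have "norm x \<le> \<bar>cs x\<bar> * norm a1 + \<bar>ct x\<bar> * norm a2"
        using coords[of x] norm_triangle_ineq[of "cs x *\<^sub>R a1" "ct x *\<^sub>R a2"] by simp
      also have "\<dots> \<le> (real n + C1) * norm a1 + (real n + C1) * norm a2"
        using * by (intro add_mono mult_right_mono) auto
      finally show ?thesis by (simp add: \<rho>_def D_def algebra_simps)
    qed
    define \<delta> where "\<delta> = 1 / real n"
    have \<delta>: "\<delta> > 0" "\<delta> \<le> 1" using n by (auto simp: \<delta>_def)
    obtain G H where G: "\<And>x. (G has_derivative (\<lambda>h. H x \<bullet> h)) (at x)" and H: "continuous_on UNIV H"
      and mono: "\<And>x y. 0 \<le> (H y - H x) \<bullet> (y - x)"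
      and close: "\<And>x. x \<in> V \<Longrightarrow> norm x \<le> \<rho> \<Longrightarrow> \<bar>r x + (norm x)\<^sup>2 / 2 - (G x + \<epsilon> / 2 * (norm x)\<^sup>2)\<bar> \<le> \<delta>"
      and HC: "\<And>x. norm x \<le> \<rho> \<Longrightarrow> norm (H x - (1 - \<epsilon>) *\<^sub>R x) \<le> CN"
      using ex[OF \<rho> \<delta>] by blast
    let ?B = "edge_form \<epsilon> H w u"
    have fin: "finite (oriented_near n)" using Cc(2)[OF n] by simp
    have bound: "\<bar>?B a b\<bar> \<le> CB" if t: "(a,b,c) \<in> oriented_near n" for a b c
    proof -
      have "(a,b,c) \<in> oriented" using t by (auto simp: oriented_near_def)
      then show ?thesis
        using edge_form_bound[OF H HC, where a=a and b=b] in_ball[OF t] CB(2)[of a b c] oriented_distinct \<epsilon> by fastforce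
    qed
    have term_le: "(chi n a + chi n b) * ?B a b + (chi n b + chi n c) * ?B b c + (chi n c + chi n a) * ?B c a
       \<le> K0 - 2 * \<epsilon> * (chi n a * energy a b c)" if t: "(a,b,c) \<in> oriented_near n" for a b c
    proof -
      have tT: "(a,b,c) \<in> oriented" using t by (auto simp: oriented_near_def)
      have sT: "{a,b,c} \<in> T" and ccw: "cross2 (b - a) (c - a) > 0" using tT by (auto simp: oriented_def)
      have sum: "?B a b + ?B b c + ?B c a \<le> 6 * \<delta> * (norm (grad a b c))\<^sup>2 - \<epsilon> / 2 * cross2 (b - a) (c - a) * (norm (grad a b c))\<^sup>2"
      proof (rule edge_form_triangle_le[where z="\<lambda>x. r x + (norm x)\<^sup>2 / 2", OF G H mono ccw grad[OF tT]])
        show "(y - x) \<bullet> ((u y - w y *\<^sub>R y) - (u x - w x *\<^sub>R x))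
            + ((r y + (norm y)\<^sup>2 / 2) - (r x + (norm x)\<^sup>2 / 2)) * (w y - w x) = 0"
          if "x \<in> {a,b,c}" "y \<in> {a,b,c}" for x y by (rule strain[OF sT that])
        show "\<bar>r x + (norm x)\<^sup>2 / 2 - (G x + \<epsilon> / 2 * (norm x)\<^sup>2)\<bar> \<le> \<delta>" if "x \<in> {a,b,c}" for x
          by (rule close[OF UnionI[OF sT that] in_ball[OF t that]])
      qed
      \<comment> \<open>The common weight that replaces the sums of \<open>chi n\<close> over the
        ends of the edges, so that the triangle inequality \<open>sum\<close> can be multiplied by
        it.\<close>
      define s where "s = 2 * chi n a"
      have s: "0 \<le> s" "s \<le> 2 * n" using chi_nonneg[of n a] chi_le[of n a] by (auto simp: s_def)
      have le1: "s * (?B a b + ?B b c + ?B c a) \<le> s * (6 * \<delta> * (norm (grad a b c))\<^sup>2 - \<epsilon> * energy a b c)"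
        using sum s by (intro mult_left_mono) (auto simp: energy_def)
      have le2: "s * (6 * \<delta> * (norm (grad a b c))\<^sup>2) \<le> (2 * n) * (6 * \<delta> * Ca)"
        using s Ca(2)[OF tT] \<delta> by (intro mult_mono) auto
      have le3: "(2 * n) * (6 * \<delta> * Ca) = 12 * Ca" using n by (simp add: \<delta>_def)
      have x: "x * B' \<le> s * B' + k * CB" if "\<bar>x - s\<bar> \<le> k" "\<bar>B'\<bar> \<le> CB" for x B' k
      proof -
        have "(x - s) * B' \<le> \<bar>x - s\<bar> * \<bar>B'\<bar>" by (metis abs_ge_self abs_mult)
        also have "\<dots> \<le> k * CB" using that by (intro mult_mono) auto
        finally show ?thesis by (simp add: algebra_simps)
      qed
      have d: "\<bar>chi n x - chi n y\<bar> \<le> C1" if "x \<in> {a,b,c}" "y \<in> {a,b,c}" for x y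
        using C1(2)[OF tT that] by blast
      show ?thesis unfolding K0_def
      proof (rule assemble)
        show "(chi n a + chi n b) * ?B a b \<le> s * ?B a b + C1 * CB"
          by (rule x) (use d[of a b] bound[OF t] in \<open>auto simp: s_def\<close>)
        have "(chi n b + chi n c) * ?B b c \<le> s * ?B b c + (2 * C1) * CB"
        proof (rule x)
          show "\<bar>chi n b + chi n c - s\<bar> \<le> 2 * C1"
            unfolding s_def using d[of a b] d[of a c] by (simp add: abs_le_iff)
          show "\<bar>?B b c\<bar> \<le> CB" using bound[OF oriented_near_rot[OF t]] .
        qed
        then show "(chi n b + chi n c) * ?B b c \<le> s * ?B b c + 2 * (C1 * CB)" by (simp only: mult.assoc)
        show "(chi n c + chi n a) * ?B c a \<le> s * ?B c a + C1 * CB"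
          by (rule x) (use d[of a c] bound[OF oriented_near_rot[OF oriented_near_rot[OF t]]] in \<open>auto simp: s_def\<close>)
        show "s * ?B a b + s * ?B b c + s * ?B c a
            \<le> s * (6 * \<delta> * (norm (grad a b c))\<^sup>2) - 2 * \<epsilon> * (chi n a * energy a b c)"
          using le1 by (simp add: s_def algebra_simps)
        show "s * (6 * \<delta> * (norm (grad a b c))\<^sup>2) \<le> 12 * Ca" by (rule le2[unfolded le3])
      qed
    qed
    have "0 = (\<Sum>(a,b,c)\<in>oriented_near n. (chi n a + chi n b) * ?B a b + (chi n b + chi n c) * ?B b c + (chi n c + chi n a) * ?B c a)"
      by (rule triangle_sum_zero[OF fin edge_form_swap[OF H], symmetric])
    also have "\<dots> \<le> (\<Sum>(a,b,c)\<in>oriented_near n. K0 - 2 * \<epsilon> * (chi n a * energy a b c))"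
      by (intro sum_mono) (use term_le in \<open>auto\<close>)
    also have "\<dots> = K0 * card (oriented_near n) - 2 * \<epsilon> * (\<Sum>(a,b,c)\<in>oriented_near n. chi n a * energy a b c)"
      by (simp add: split_def sum_subtractf sum_distrib_left)
    finally have "2 * \<epsilon> * (\<Sum>(a,b,c)\<in>oriented_near n. chi n a * energy a b c) \<le> K0 * card (oriented_near n)" by simp
    also have "\<dots> \<le> K0 * (Cc * (real n)\<^sup>2)" using Cc(2)[OF n] K0 by (intro mult_left_mono) auto
    finally show "finite (oriented_near n) \<and> (\<Sum>(a,b,c)\<in>oriented_near n. chi n a * energy a b c) \<le> K0 * Cc / (2 * \<epsilon>) * (real n)\<^sup>2"
      using fin \<epsilon> by (simp add: field_simps)
  qed
qed

text \<open>If all gradients near \<open>l\<close> vanished, \<open>w\<close> would be constant on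
  each triangle that meets the segment from \<open>p + l\<close> to \<open>q + l\<close>. Triangles
  that meet share a vertex, so the constants would agree along the segment.\<close>

lemma nonconstant_near:
  assumes pq: "p \<in> V" "q \<in> V" "w p \<noteq> w q" and l: "l \<in> \<Lambda>"
  shows "\<exists>a b c. (a,b,c) \<in> oriented \<and> grad a b c \<noteq> 0 \<and> norm (a - l) \<le> L + norm p + norm q"
proof (rule ccontr)
  assume no: "\<not> ?thesis"
  define S where "S = closed_segment (p + l) (q + l)"
  have Sl: "norm (y - l) \<le> norm p + norm q" if "y \<in> S" for y
  proof -
    have "S \<subseteq> cball l (norm p + norm q)"
      unfolding S_def by (rule closed_segment_subset) (auto simp: dist_norm)
    then show ?thesis using that by (auto simp: dist_norm norm_minus_commute)
  qed
  have const: "w v = w v'" if t: "t \<in> T" "convex hull t \<inter> S \<noteq> {}" "v \<in> t" "v' \<in> t" for t v v'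
  proof -
    obtain a b c where abc: "t = {a,b,c}" "(a,b,c) \<in> oriented" using T_imp_oriented[OF t(1)] .
    obtain y where y: "y \<in> convex hull t" "y \<in> S" using t(2) by blast
    have "norm (y - a) \<le> L" using hull_in_ball[OF t(1) _ y(1)] abc by auto
    then have "norm (a - l) \<le> L + norm p + norm q"
      using Sl[OF y(2)] norm_triangle_ineq[of "a - y" "y - l"] by (simp add: norm_minus_commute)
    then have "grad a b c = 0" using no abc(2) by blast
    then have "w b = w a" "w c = w a" using grad[OF abc(2)] by auto
    then show ?thesis using t abc(1) by auto
  qed
  define lab where "lab t = w (SOME v. v \<in> t)" for t :: "complex set"
  have lab: "lab t = w v" if t: "t \<in> T" "convex hull t \<inter> S \<noteq> {}" "v \<in> t" for t v
    unfolding lab_def using const[OF t(1,2) _ t(3)] someI[of "\<lambda>v. v \<in> t"] t(3) by blast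
  have "p + l \<in> V" "q + l \<in> V" using V_shift pq l by auto
  then obtain s t where s: "s \<in> T" "p + l \<in> s" and t: "t \<in> T" "q + l \<in> t" by blast
  have ms: "convex hull s \<inter> S \<noteq> {}" using hull_inc[OF s(2)] by (auto simp: S_def)
  have mt: "convex hull t \<inter> S \<noteq> {}" using hull_inc[OF t(2)] by (auto simp: S_def)
  have "lab s = lab t"
  proof (rule label_constant[of S])
    show "connected S" "compact S" by (auto simp: S_def)
    fix s t assume st: "s \<in> T" "t \<in> T" "convex hull s \<inter> convex hull t \<inter> S \<noteq> {}"
    then have "convex hull (s \<inter> t) \<noteq> {}" using inter by blast
    then have "s \<inter> t \<noteq> {}" by auto
    then obtain v where "v \<in> s" "v \<in> t" by blast
    moreover have "convex hull s \<inter> S \<noteq> {}" "convex hull t \<inter> S \<noteq> {}" using st(3) by blast+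
    ultimately show "lab s = lab t" using st(1,2) lab[of s v] lab[of t v] by simp
  qed (use s t ms mt in auto)
  then have "w (p + l) = w (q + l)" using lab[OF s(1) ms s(2)] lab[OF t(1) mt t(2)] by simp
  then show False using pq l by (simp add: w_shift)
qed

text \<open>If \<open>w\<close> were not constant, \<open>k * k\<close> separated translates would
  supply triangles of energy at least \<open>e0\<close> on which the cutoff is at least
  \<open>n / 2\<close>. With \<open>n\<close> proportional to \<open>k\<close> their contribution is
  cubic in \<open>n\<close>, against the quadratic bound.\<close>

theorem w_constant:
  assumes pq: "p \<in> V" "q \<in> V"
  shows "w p = w q"
proof (rule ccontr)
  assume ne: "w p \<noteq> w q"
  obtain K where K: "K > 0" "\<And>n. n \<ge> 1 \<Longrightarrow> finite (oriented_near n) \<and>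
    (\<Sum>(a,b,c)\<in>oriented_near n. chi n a * energy a b c) \<le> K * (real n)\<^sup>2"
    using energy_sum_bound by blast
  obtain e0 where e0: "e0 > 0" "\<And>a b c. (a,b,c) \<in> oriented \<Longrightarrow> energy a b c > 0 \<Longrightarrow> energy a b c \<ge> e0"
    by (rule types_positive[of energy]) (auto simp: energy_def grad_shift)
  obtain Kc where Kc: "Kc > 0" "\<And>x. \<bar>cs x\<bar> \<le> Kc * norm x" "\<And>x. \<bar>ct x\<bar> \<le> Kc * norm x"
    using coord_bound by blast
  define C where "C = nat \<lceil>Kc * (L + norm p + norm q)\<rceil>"
  have C: "Kc * (L + norm p + norm q) \<le> real C" by (simp add: C_def of_nat_ceiling)
  \<comment> \<open>With this spacing the coordinate intervals of radius \<open>C\<close> around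
    distinct lattice points are disjoint, so the triangles found there are distinct.\<close>
  define M where "M = 2 * C + 1"
  have "\<exists>x. x \<in> oriented \<and> grad (fst x) (fst (snd x)) (snd (snd x)) \<noteq> 0 \<and>
     \<bar>cs (fst x) - real (M * i)\<bar> \<le> C \<and> \<bar>ct (fst x) - real (M * j)\<bar> \<le> C" for i j
  proof -
    let ?l = "lat (int (M * i)) (int (M * j))"
    obtain a b c where abc: "(a,b,c) \<in> oriented" "grad a b c \<noteq> 0" "norm (a - ?l) \<le> L + norm p + norm q"
      using nonconstant_near[OF pq ne lat_in] by blast
    have "\<bar>cs (a - ?l)\<bar> \<le> C" "\<bar>ct (a - ?l)\<bar> \<le> C"
      using order_trans[OF Kc(2)[of "a - ?l"] mult_left_mono[OF abc(3), of Kc]]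
        order_trans[OF Kc(3)[of "a - ?l"] mult_left_mono[OF abc(3), of Kc]] Kc(1) C by auto
    then show ?thesis using abc by (intro exI[of _ "(a,b,c)"]) (auto simp: coord_simps simp del: of_nat_mult)
  qed
  then obtain f where f: "\<And>i j. f i j \<in> oriented"
    "\<And>i j. grad (fst (f i j)) (fst (snd (f i j))) (snd (snd (f i j))) \<noteq> 0"
    "\<And>i j. \<bar>cs (fst (f i j)) - real (M * i)\<bar> \<le> C" "\<And>i j. \<bar>ct (fst (f i j)) - real (M * j)\<bar> \<le> C"
    by metis
  have sep: "i = i'" if "\<bar>x - real (M * i)\<bar> \<le> C" "\<bar>x - real (M * i')\<bar> \<le> C" for x i i'
  proof (rule ccontr)
    assume "i \<noteq> i'"
    then have "\<bar>real i - real i'\<bar> \<ge> 1" by linarith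
    then have "\<bar>real M * (real i - real i')\<bar> \<ge> real M" using mult_left_mono[of 1 "\<bar>real i - real i'\<bar>" "real M"] by (simp add: abs_mult)
    moreover have "real M * (real i - real i') = real (M * i) - real (M * i')" by (simp add: algebra_simps)
    ultimately show False using that by (simp add: M_def del: of_nat_mult)
  qed
  have inj: "inj_on (\<lambda>(i,j). f i j) ({..<k} \<times> {..<k})" for k
  proof (rule inj_onI, clarify)
    fix i j i' j' assume "f i j = f i' j'"
    then show "i = i' \<and> j = j'"
      using sep[of "cs (fst (f i j))" i i'] sep[of "ct (fst (f i j))" j j'] f(3,4) by metis
  qed
  have main: "real k * e0 \<le> 4 * K * (M + C)" if k: "k \<ge> 1" for k :: nat
  proof -
    \<comment> \<open>The chosen first vertices have coordinates at most \<open>M * k + C\<close>,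
      half the height of the cutoff.\<close>
    define n where "n = 2 * (M * k + C)"
    have n: "n \<ge> 1" using k by (simp add: n_def M_def)
    define g where "g x = chi n (fst x) * energy (fst x) (fst (snd x)) (snd (snd x))" for x
    define I where "I = (\<lambda>(i,j). f i j) ` ({..<k} \<times> {..<k})"
    have g: "x \<in> oriented_near n \<and> real n / 2 * e0 \<le> g x" if x: "x \<in> I" for x
    proof -
      obtain i j where ij: "i < k" "j < k" "x = f i j" using x by (auto simp: I_def)
      obtain a b c where abc: "f i j = (a,b,c)" by (cases "f i j")
      have t: "(a,b,c) \<in> oriented" and gr: "grad a b c \<noteq> 0" using f(1,2)[of i j] by (auto simp: abc)
      have "M * i \<le> M * k" "M * j \<le> M * k" using ij by auto
      then have "real (M * i) \<le> real (M * k)" "real (M * j) \<le> real (M * k)" by linarith+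
      moreover have "\<bar>cs a - real (M * i)\<bar> \<le> C" "\<bar>ct a - real (M * j)\<bar> \<le> C" using f(3,4)[of i j] abc by auto
      ultimately have "\<bar>cs a\<bar> \<le> real (M * k) + real C" "\<bar>ct a\<bar> \<le> real (M * k) + real C" by linarith+
      then have chi: "chi n a \<ge> real n / 2" by (simp add: chi_def n_def del: of_nat_mult)
      have "energy a b c > 0" using t gr by (simp add: energy_def oriented_def)
      then have "energy a b c \<ge> e0" using e0(2)[OF t] by simp
      then have "real n / 2 * e0 \<le> chi n a * energy a b c" using chi e0(1) by (intro mult_mono) auto
      moreover have "chi n a > 0" using chi n by simp
      ultimately show ?thesis using t ij abc by (simp add: g_def oriented_near_def)
    qed
    have "card I = k * k" unfolding I_def by (simp add: card_image[OF inj])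
    then have "real (k * k) * (real n / 2 * e0) = (\<Sum>x\<in>I. real n / 2 * e0)" by simp
    also have "\<dots> \<le> sum g I" using g by (intro sum_mono) auto
    also have "\<dots> \<le> sum g (oriented_near n)"
      using g K(2)[OF n] chi_nonneg energy_nonneg
      by (intro sum_mono2) (auto simp: g_def oriented_near_def intro!: mult_nonneg_nonneg)
    also have "\<dots> \<le> K * (real n)\<^sup>2" using K(2)[OF n] by (simp add: g_def split_def)
    finally have "(real k * real k * e0) * (real n / 2) \<le> (2 * K * real n) * (real n / 2)"
      by (simp add: power2_eq_square algebra_simps)
    then have "real k * real k * e0 \<le> 2 * K * real n" using n by (subst (asm) mult_le_cancel_right) auto
    also have "\<dots> \<le> 4 * K * (M + C) * k"
    proof -
      have "M * k + C \<le> (M + C) * k" using k by (simp add: add_mult_distrib)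
      then have "n \<le> 2 * ((M + C) * k)" unfolding n_def by (rule mult_le_mono2)
      then have "real n \<le> real (2 * ((M + C) * k))" by (rule of_nat_mono)
      then have "2 * K * real n \<le> 2 * K * real (2 * ((M + C) * k))" using K(1) by (intro mult_left_mono) auto
      then show ?thesis by (simp add: algebra_simps)
    qed
    finally have "(real k * e0) * real k \<le> (4 * K * (M + C)) * real k" by (simp add: algebra_simps)
    then show ?thesis using k by (subst (asm) mult_le_cancel_right) auto
  qed
  obtain k :: nat where "4 * K * (M + C) / e0 < real k" using reals_Archimedean2 by blast
  then have "4 * K * (M + C) / e0 < real (Suc k)" by simp
  then have "4 * K * (M + C) < real (Suc k) * e0" using e0(1) by (simp add: divide_less_eq)
  with main[of "Suc k"] show False by simp
qed

lemma countable_V: "countable V"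
proof -
  have "V = (\<Union>n::nat. V \<inter> cball 0 (real n))"
  proof (intro equalityI subsetI)
    fix x assume "x \<in> V"
    then show "x \<in> (\<Union>n::nat. V \<inter> cball 0 (real n))" using real_arch_simple[of "norm x"] by auto
  qed auto
  also have "countable \<dots>" by (rule countable_UN[OF countableI_type countable_finite[OF finite_V]])
  finally show ?thesis .
qed

text \<open>With \<open>w\<close> constant, the strain condition makes
  \<open>u v - \<kappa> *\<^sub>R v\<close> an infinitesimal isometry of every triangle. Two common
  vertices determine such a motion, so it propagates through shared edges.\<close>

theorem rigid:
  obtains \<kappa> \<beta> \<omega> where "\<And>v. v \<in> V \<Longrightarrow> w v = \<kappa>" "\<And>v. v \<in> V \<Longrightarrow> u v = \<kappa> *\<^sub>R v + \<beta> + \<omega> *\<^sub>R (\<i> * v)"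
proof -
  obtain v0 where v0: "v0 \<in> V" using V_nonempty by blast
  define \<kappa> where "\<kappa> = w v0"
  have w: "w v = \<kappa>" if "v \<in> V" for v using w_constant[OF that v0] by (simp add: \<kappa>_def)
  define y where "y v = u v - \<kappa> *\<^sub>R v" for v
  let ?R = "\<lambda>t l. \<forall>v\<in>t. y v = fst l + snd l *\<^sub>R (\<i> * v)"
  have "\<exists>l. ?R t l" if t: "t \<in> T" for t
  proof -
    obtain a b c where abc: "t = {a,b,c}" "(a,b,c) \<in> oriented" using T_imp_oriented[OF t] .
    have s: "(q - p) \<bullet> (y q - y p) = 0" if "p \<in> t" "q \<in> t" for p q
      using strain[OF t that] w[of p] w[of q] that t by (force simp: y_def)
    obtain \<omega> where \<omega>: "y b - y a = \<omega> *\<^sub>R (\<i> * (b - a))" "y c - y a = \<omega> *\<^sub>R (\<i> * (c - a))"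
      using rigid_triangle[of b a c y] abc s by (auto simp: oriented_def)
    have "y v = (y a - \<omega> *\<^sub>R (\<i> * a)) + \<omega> *\<^sub>R (\<i> * v)" if "v \<in> t" for v
    proof -
      have "y v - y a = \<omega> *\<^sub>R (\<i> * (v - a))" using \<omega> abc that by auto
      then have "y v = y a + \<omega> *\<^sub>R (\<i> * (v - a))" by (simp add: diff_eq_eq)
      then show ?thesis by (simp add: algebra_simps)
    qed
    then show ?thesis by (intro exI[of _ "(y a - \<omega> *\<^sub>R (\<i> * a), \<omega>)"]) auto
  qed
  then obtain lab :: "complex set \<Rightarrow> complex \<times> real" where lab: "\<And>t. t \<in> T \<Longrightarrow> ?R t (lab t)" by metis
  have same: "lab s = lab t" if st: "s \<in> T" "t \<in> T" "p \<in> s \<inter> t" "q \<in> s \<inter> t" "p \<noteq> q" for s t p q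
  proof -
    have 1: "fst (lab s) + snd (lab s) *\<^sub>R (\<i> * v) = fst (lab t) + snd (lab t) *\<^sub>R (\<i> * v)" if "v \<in> s \<inter> t" for v
      using lab[OF st(1)] lab[OF st(2)] that by auto
    have "(snd (lab s) - snd (lab t)) *\<^sub>R (\<i> * (p - q)) =
       (fst (lab s) + snd (lab s) *\<^sub>R (\<i> * p)) - (fst (lab t) + snd (lab t) *\<^sub>R (\<i> * p))
       - ((fst (lab s) + snd (lab s) *\<^sub>R (\<i> * q)) - (fst (lab t) + snd (lab t) *\<^sub>R (\<i> * q)))"
      by (simp add: algebra_simps)
    also have "\<dots> = 0" using 1[OF st(3)] 1[OF st(4)] by simp
    finally have "snd (lab s) = snd (lab t)" using st(5) by simp
    then show ?thesis using 1[OF st(3)] by (simp add: prod_eq_iff)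
  qed
  have ex: "\<exists>x. x \<in> convex hull t \<and> x \<notin> V" if t: "t \<in> T" for t
  proof -
    obtain a b c where abc: "t = {a,b,c}" "(a,b,c) \<in> oriented" using T_imp_oriented[OF t] .
    have "closed_segment a b \<subseteq> convex hull t"
      unfolding segment_convex_hull using abc by (intro hull_mono) auto
    moreover have "\<not> closed_segment a b \<subseteq> V"
      using countable_V countable_subset uncountable_closed_segment oriented_distinct[OF abc(2)] by blast
    ultimately show ?thesis by blast
  qed
  have lab_eq: "lab s = lab t" if st: "s \<in> T" "t \<in> T" for s t
  proof -
    obtain x where x: "x \<in> convex hull s" "x \<notin> V" using ex[OF st(1)] by blast
    obtain x' where x': "x' \<in> convex hull t" "x' \<notin> V" using ex[OF st(2)] by blast
    \<comment> \<open>Triangles that meet at a point of a path off the vertices have at least two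
      vertices in common, so the motion cannot change along the path.\<close>
    have "path_connected (- V)"
      by (rule path_connected_complement_countable[OF _ countable_V]) simp
    then obtain g where g: "path g" "path_image g \<subseteq> - V" "pathstart g = x" "pathfinish g = x'"
      using x(2) x'(2) unfolding path_connected_def by blast
    have ends: "x \<in> path_image g" "x' \<in> path_image g"
      using g(3,4) pathstart_in_path_image pathfinish_in_path_image by metis+
    show ?thesis
    proof (rule label_constant[of "path_image g"])
      show "connected (path_image g)" "compact (path_image g)"
        using g(1) by (auto intro: connected_path_image compact_path_image)
      show "convex hull s \<inter> path_image g \<noteq> {}" "convex hull t \<inter> path_image g \<noteq> {}"
        using x x' ends by auto
      fix s t assume st: "s \<in> T" "t \<in> T" "convex hull s \<inter> convex hull t \<inter> path_image g \<noteq> {}"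
      then obtain z where z: "z \<in> convex hull (s \<inter> t)" "z \<notin> V"
        using inter[OF st(1,2)] g(2) by blast
      have "s \<inter> t \<noteq> {}" using z(1) by auto
      then obtain p where p: "p \<in> s \<inter> t" by blast
      have "s \<inter> t \<noteq> {p}" using z p st(1) by auto
      then obtain q where "q \<in> s \<inter> t" "p \<noteq> q" using p by blast
      then show "lab s = lab t" using same[OF st(1,2) p] by blast
    qed (use st in auto)
  qed
  obtain t0 where t0: "t0 \<in> T" using v0 by blast
  have "u v = \<kappa> *\<^sub>R v + fst (lab t0) + snd (lab t0) *\<^sub>R (\<i> * v)" if v: "v \<in> V" for v
  proof -
    obtain t where t: "t \<in> T" "v \<in> t" using v by blast
    then have "y v = fst (lab t0) + snd (lab t0) *\<^sub>R (\<i> * v)" using lab[OF t(1)] lab_eq[OF t(1) t0] by auto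
    then show ?thesis by (simp add: y_def algebra_simps)
  qed
  then show ?thesis using that w by blast
qed

end

section \<open>The chart at an ideal point\<close>

lemma mink_simps:
  "mink (x + y) z = mink x z + mink y z" "mink z (x + y) = mink z x + mink z y"
  "mink (x - y) z = mink x z - mink y z" "mink z (x - y) = mink z x - mink z y"
  "mink (k *\<^sub>R x) z = k * mink x z" "mink z (k *\<^sub>R x) = k * mink z x"
  "mink (- x) z = - mink x z" "mink z (- x) = - mink z x"
  "mink 0 z = 0" "mink z 0 = 0"
  by (simp_all add: mink_def algebra_simps)

lemma mink_commute: "mink x y = mink y x"
  by (simp add: mink_def mult.commute)

lemma continuous_on_mink [continuous_intros]:
  assumes "continuous_on S f" "continuous_on S g"
  shows "continuous_on S (\<lambda>x. mink (f x) (g x))"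
  unfolding mink_def using assms by (intro continuous_intros)

text \<open>Lagrange's identity bounds the spatial product \<open>s\<close>; the time component of
  \<open>x\<close> is strictly longer than its spatial part.\<close>

lemma hyp3_mink_future:
  assumes x: "x \<in> hyp3" and c: "mink c c = 0" "c $ 4 > 0"
  shows "mink x c < 0"
proof -
  define s where "s = x$1 * c$1 + x$2 * c$2 + x$3 * c$3"
  have x1: "(x$1)\<^sup>2 + (x$2)\<^sup>2 + (x$3)\<^sup>2 = (x$4)\<^sup>2 - 1" and x4: "x$4 > 0"
    using x by (auto simp: hyp3_def mink_def power2_eq_square)
  have c1: "(c$1)\<^sup>2 + (c$2)\<^sup>2 + (c$3)\<^sup>2 = (c$4)\<^sup>2"
    using c by (auto simp: mink_def power2_eq_square)
  have "s\<^sup>2 \<le> ((x$1)\<^sup>2 + (x$2)\<^sup>2 + (x$3)\<^sup>2) * ((c$1)\<^sup>2 + (c$2)\<^sup>2 + (c$3)\<^sup>2)"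
  proof -
    have "((x$1)\<^sup>2 + (x$2)\<^sup>2 + (x$3)\<^sup>2) * ((c$1)\<^sup>2 + (c$2)\<^sup>2 + (c$3)\<^sup>2) - s\<^sup>2
      = (x$1 * c$2 - x$2 * c$1)\<^sup>2 + (x$1 * c$3 - x$3 * c$1)\<^sup>2 + (x$2 * c$3 - x$3 * c$2)\<^sup>2"
      by (simp add: s_def power2_eq_square algebra_simps)
    also have "\<dots> \<ge> 0" by simp
    finally show ?thesis by simp
  qed
  also have "\<dots> = ((x$4)\<^sup>2 - 1) * (c$4)\<^sup>2" unfolding x1 c1 ..
  also have "\<dots> < (x$4 * c$4)\<^sup>2" using c by (simp add: power_mult_distrib algebra_simps)
  finally have "s < x$4 * c$4"
    using x4 c(2) by (intro power2_less_imp_less[of s]) auto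
  then show ?thesis by (simp add: mink_def s_def)
qed

lemma hyp_hull_mono: "S \<subseteq> S' \<Longrightarrow> hyp_hull S \<subseteq> hyp_hull S'"
  unfolding hyp_hull_def using hull_mono[of S S' convex_cone] by blast

lemma hyp_hull_inc: "x \<in> S \<Longrightarrow> x \<in> hyp3 \<Longrightarrow> x \<in> hyp_hull S"
  by (simp add: hyp_hull_def hull_inc)

lemma hyp_hull_subset: "hyp_hull S \<subseteq> hyp3"
  by (simp add: hyp_hull_def)

text \<open>A frame adapted to the ideal point: two light-like vectors \<open>c\<close> and
  \<open>d\<close> with product \<open>-1\<close>, and an orthonormal basis of the plane orthogonal
  to both.\<close>

locale cusp =
  fixes c d e1 e2 :: "real^4"
  assumes c4: "c $ 4 > 0"
    and gram: "mink c c = 0" "mink d d = 0" "mink c d = - 1" "mink e1 e1 = 1" "mink e2 e2 = 1"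
      "mink e1 e2 = 0" "mink c e1 = 0" "mink c e2 = 0" "mink d e1 = 0" "mink d e2 = 0"
    and basis: "\<And>x. x = (- mink x c) *\<^sub>R d + (- mink x d) *\<^sub>R c + mink x e1 *\<^sub>R e1 + mink x e2 *\<^sub>R e2"
begin

lemma gram_sym: "mink d c = - 1" "mink e2 e1 = 0" "mink e1 c = 0" "mink e2 c = 0" "mink e1 d = 0" "mink e2 d = 0"
  using gram by (simp_all add: mink_commute)

text \<open>A point \<open>x\<close> of \<open>hyp3\<close> has the chart coordinates \<open>pr x\<close> in the plane and \<open>zz x\<close> above the paraboloid
  \<open>|p|\<^sup>2 / 2\<close>. Geodesics ending at \<open>c\<close> are vertical, geodesic segments are straight, and the
  horospheres at \<open>c\<close> are the level sets of \<open>lam\<close>.\<close>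

definition lam where "lam x = - mink x c"
definition del where "del x = - mink x d"
definition prl where "prl x = Complex (mink x e1) (mink x e2)"
definition mk where "mk l \<delta> q = l *\<^sub>R d + \<delta> *\<^sub>R c + Re q *\<^sub>R e1 + Im q *\<^sub>R e2"
definition pr where "pr x = prl x /\<^sub>R lam x"
definition zz where "zz x = del x / lam x"

lemma mk_eta: "mk (lam x) (del x) (prl x) = x"
  unfolding mk_def lam_def del_def prl_def complex.sel by (rule basis[symmetric])

lemma mk_simps [simp]: "lam (mk l \<delta> q) = l" "del (mk l \<delta> q) = \<delta>" "prl (mk l \<delta> q) = q"
  by (simp_all add: lam_def del_def prl_def mk_def mink_simps gram gram_sym complex_eq_iff)

lemma ext: "lam x = lam y \<Longrightarrow> del x = del y \<Longrightarrow> prl x = prl y \<Longrightarrow> x = y"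
  by (metis mk_eta)

lemma linear_simps:
  "lam (x + y) = lam x + lam y" "lam (k *\<^sub>R x) = k * lam x" "lam (x - y) = lam x - lam y" "lam (- x) = - lam x" "lam 0 = 0"
  "del (x + y) = del x + del y" "del (k *\<^sub>R x) = k * del x" "del (x - y) = del x - del y" "del (- x) = - del x" "del 0 = 0"
  "prl (x + y) = prl x + prl y" "prl (k *\<^sub>R x) = k *\<^sub>R prl x" "prl (x - y) = prl x - prl y" "prl (- x) = - prl x" "prl 0 = 0"
  by (simp_all add: lam_def del_def prl_def mink_simps complex_eq_iff)

lemma lam_c: "lam c = 0" "del c = 1" "prl c = 0"
  by (simp_all add: lam_def del_def prl_def gram complex_eq_iff)

lemma mink_expand: "mink x y = prl x \<bullet> prl y - lam x * del y - del x * lam y"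
proof -
  have "mink x y = mink x (mk (lam y) (del y) (prl y))" by (simp add: mk_eta)
  then show ?thesis
    by (simp add: mk_def mink_simps inner_complex_def) (simp add: lam_def del_def prl_def)
qed

lemma continuous_coords [continuous_intros]:
  assumes "continuous_on S f"
  shows "continuous_on S (\<lambda>x. lam (f x))" "continuous_on S (\<lambda>x. del (f x))" "continuous_on S (\<lambda>x. prl (f x))"
  using assms unfolding lam_def del_def prl_def Complex_eq
  by (auto intro!: continuous_intros)

lemma lam_pos: "x \<in> hyp3 \<Longrightarrow> lam x > 0"
  using hyp3_mink_future[of x c] gram c4 by (simp add: lam_def)

lemma hyp3_iff: "x \<in> hyp3 \<longleftrightarrow> mink x x = - 1 \<and> lam x > 0"
proof
  assume "x \<in> hyp3" then show "mink x x = - 1 \<and> lam x > 0" using lam_pos by (simp add: hyp3_def)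
next
  assume *: "mink x x = - 1 \<and> lam x > 0"
  then have "(x$4)\<^sup>2 = 1 + (x$1)\<^sup>2 + (x$2)\<^sup>2 + (x$3)\<^sup>2" by (simp add: mink_def power2_eq_square)
  then have "(x$4)\<^sup>2 > 0" by (simp add: add_pos_nonneg)
  then have "x$4 \<noteq> 0" by simp
  moreover have "\<not> x$4 < 0"
  proof
    assume "x$4 < 0"
    then have "- x \<in> hyp3" using * by (simp add: hyp3_def mink_simps)
    then show False using lam_pos[of "- x"] * by (simp add: linear_simps)
  qed
  ultimately show "x \<in> hyp3" using * by (simp add: hyp3_def)
qed

lemma hyp3_iff': "x \<in> hyp3 \<longleftrightarrow> lam x > 0 \<and> 2 * lam x * del x = 1 + (norm (prl x))\<^sup>2"
  unfolding hyp3_iff mink_expand dot_square_norm by (auto simp: algebra_simps)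

text \<open>The height over the paraboloid depends only on the horosphere. Isometries that preserve
  the horospheres therefore preserve this height.\<close>

lemma zz_eq: "x \<in> hyp3 \<Longrightarrow> zz x = (norm (pr x))\<^sup>2 / 2 + 1 / (2 * (lam x)\<^sup>2)"
  by (auto simp: hyp3_iff' zz_def pr_def power_divide field_simps power2_eq_square)

lemma prl_eq: "x \<in> hyp3 \<Longrightarrow> prl x = lam x *\<^sub>R pr x" and del_eq: "x \<in> hyp3 \<Longrightarrow> del x = lam x * zz x"
  using lam_pos by (force simp: pr_def zz_def)+

lemma pr_scale: "k > 0 \<Longrightarrow> pr (k *\<^sub>R x) = pr x" "k > 0 \<Longrightarrow> zz (k *\<^sub>R x) = zz x"
  by (simp_all add: pr_def zz_def linear_simps)

text \<open>The inverse chart; the factor scales \<open>mk 1 z p\<close> to Minkowski square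
  \<open>-1\<close>.\<close>

definition pt where "pt p z = (1 / sqrt (2 * z - (norm p)\<^sup>2)) *\<^sub>R mk 1 z p"

lemma pt:
  assumes "2 * z > (norm p)\<^sup>2"
  shows "pt p z \<in> hyp3" "pr (pt p z) = p" "zz (pt p z) = z"
proof -
  have "(sqrt (2 * z - (norm p)\<^sup>2))\<^sup>2 = 2 * z - (norm p)\<^sup>2" using assms by simp
  then show "pt p z \<in> hyp3" using assms
    by (simp add: hyp3_iff' pt_def linear_simps power_divide) (simp add: field_simps power2_eq_square)
  show "pr (pt p z) = p" "zz (pt p z) = z" using assms
    unfolding pt_def by (simp_all add: pr_scale) (simp_all add: pr_def zz_def)
qed

lemma zz_gt: "x \<in> hyp3 \<Longrightarrow> 2 * zz x > (norm (pr x))\<^sup>2"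
  using lam_pos[of x] by (simp add: zz_eq)

lemma hyp3_eqI:
  assumes "x \<in> hyp3" "y \<in> hyp3" "pr x = pr y" "zz x = zz y"
  shows "x = y"
proof -
  have "1 / (2 * (lam x)\<^sup>2) = 1 / (2 * (lam y)\<^sup>2)" using assms zz_eq[of x] zz_eq[of y] by simp
  then have "(lam x)\<^sup>2 = (lam y)\<^sup>2" by simp
  then have "lam x = lam y" using lam_pos assms by (simp add: power2_eq_iff_nonneg less_imp_le)
  then show ?thesis using assms by (intro ext) (simp_all add: prl_eq del_eq)
qed

lemma pt_eta: "x \<in> hyp3 \<Longrightarrow> pt (pr x) (zz x) = x"
  by (intro hyp3_eqI) (simp_all add: pt zz_gt)

lemma continuous_on_pr: "continuous_on hyp3 pr" and continuous_on_zz: "continuous_on hyp3 zz"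
  unfolding pr_def zz_def using lam_pos by (auto intro!: continuous_intros; force)+

text \<open>Adding a non-negative multiple of \<open>c\<close> changes only \<open>del\<close>,
  which is an upward vertical motion in the chart.\<close>

lemma ray: 
  assumes x: "x \<in> hyp3"
  shows "hyp_hull {x, c} = {y \<in> hyp3. pr y = pr x \<and> zz y \<ge> zz x}"
proof (intro equalityI subsetI)
  fix y assume y: "y \<in> hyp_hull {x, c}"
  let ?C = "{v. \<exists>a b. v = a *\<^sub>R x + b *\<^sub>R c \<and> 0 \<le> a \<and> 0 \<le> b}"
  have "convex_cone hull {x,c} \<subseteq> ?C"
  proof (rule hull_minimal)
    show "{x, c} \<subseteq> ?C"
      by (force intro: exI[of _ 0] exI[of _ 1])
    show "convex_cone ?C"
      unfolding convex_cone_iff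
    proof (intro conjI ballI allI impI)
      show "0 \<in> ?C"
        by (auto intro!: exI[of _ 0])
    next
      fix v v' assume "v \<in> ?C" "v' \<in> ?C"
      then obtain a b a' b' where "v = a *\<^sub>R x + b *\<^sub>R c" "v' = a' *\<^sub>R x + b' *\<^sub>R c" "0 \<le> a" "0 \<le> b" "0 \<le> a'" "0 \<le> b'" by blast
      then show "v + v' \<in> ?C"
        by (intro CollectI exI[of _ "a + a'"] exI[of _ "b + b'"]) (simp add: algebra_simps)
    next
      fix v k assume "v \<in> ?C" "0 \<le> (k::real)"
      then obtain a b where "v = a *\<^sub>R x + b *\<^sub>R c" "0 \<le> a" "0 \<le> b" by blast
      then show "k *\<^sub>R v \<in> ?C" using \<open>0 \<le> k\<close>
        by (intro CollectI exI[of _ "k * a"] exI[of _ "k * b"]) (simp add: algebra_simps)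
    qed
  qed
  then obtain a b where ab: "y = a *\<^sub>R x + b *\<^sub>R c" "0 \<le> a" "0 \<le> b" using y by (auto simp: hyp_hull_def)
  have yh: "y \<in> hyp3" using y by (simp add: hyp_hull_def)
  have "lam y > 0" using lam_pos[OF yh] .
  then have a: "a > 0" using ab lam_pos[OF x] by (auto simp: linear_simps lam_c zero_less_mult_iff)
  have "pr y = pr x" "zz y \<ge> zz x" using a ab lam_pos[OF x]
    by (auto simp: ab(1) pr_def zz_def linear_simps lam_c add_divide_distrib)
  then show "y \<in> {y \<in> hyp3. pr y = pr x \<and> zz y \<ge> zz x}" using yh by simp
next
  fix y assume "y \<in> {y \<in> hyp3. pr y = pr x \<and> zz y \<ge> zz x}"
  then have y: "y \<in> hyp3" "pr y = pr x" "zz y \<ge> zz x" by auto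
  have lx: "lam x > 0" "lam y > 0" using x y lam_pos by auto
  define a b where "a = lam y / lam x" and "b = lam y * (zz y - zz x)"
  have "y = a *\<^sub>R x + b *\<^sub>R c"
    using lx x y by (intro ext) (simp_all add: linear_simps lam_c a_def b_def prl_eq del_eq algebra_simps)
  moreover have "0 \<le> a" "0 \<le> b" using lx y by (auto simp: a_def b_def)
  ultimately have "y \<in> convex_cone hull {x,c}"
    by (simp add: convex_cone_hull_add convex_cone_hull_mul hull_inc)
  then show "y \<in> hyp_hull {x,c}" using y by (simp add: hyp_hull_def)
qed

text \<open>A sum of vectors projects to the mean of their projections weighted by
  \<open>lam\<close>, and convexity of the squared norm keeps it above the paraboloid. The zero
  vector, which every convex cone contains, has no projection and is listed separately.\<close>

lemma timelike_cone:
  assumes "v \<in> convex_cone hull S" "S \<subseteq> hyp3"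
  shows "v = 0 \<or> (lam v > 0 \<and> 2 * lam v * del v > (norm (prl v))\<^sup>2 \<and> pr v \<in> convex hull (pr ` S))"
proof -
  let ?K = "{v. v = 0 \<or> (lam v > 0 \<and> 2 * lam v * del v > (norm (prl v))\<^sup>2 \<and> pr v \<in> convex hull (pr ` S))}"
  have add: "v + v' \<in> ?K" if "v \<in> ?K" "v' \<in> ?K" for v v'
  proof (cases "v = 0 \<or> v' = 0")
    case True then show ?thesis using that by auto
  next
    case False
    define q q' z z' where "q = pr v" "q' = pr v'" "z = zz v" "z' = zz v'"
    define l l' where "l = lam v" "l' = lam v'"
    have l: "l > 0" "l' > 0" using False that by (auto simp: l_l'_def)
    have c: "prl v = l *\<^sub>R q" "del v = l * z" "prl v' = l' *\<^sub>R q'" "del v' = l' * z'"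
      using l by (auto simp: q_q'_z_z'_def l_l'_def pr_def zz_def)
    have z: "2 * z > (norm q)\<^sup>2" "2 * z' > (norm q')\<^sup>2"
    proof -
      have "2 * l * del v > (norm (prl v))\<^sup>2" "2 * l' * del v' > (norm (prl v'))\<^sup>2"
        using that False by (auto simp: l_l'_def)
      then have "2 * l * (l * z) > (norm (l *\<^sub>R q))\<^sup>2" "2 * l' * (l' * z') > (norm (l' *\<^sub>R q'))\<^sup>2"
        by (simp_all only: c)
      then have "l\<^sup>2 * (2 * z) > l\<^sup>2 * (norm q)\<^sup>2" "l'\<^sup>2 * (2 * z') > l'\<^sup>2 * (norm q')\<^sup>2"
        using l by (simp_all add: power_mult_distrib power2_eq_square mult_ac)
      then show "2 * z > (norm q)\<^sup>2" "2 * z' > (norm q')\<^sup>2" using l by simp_all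
    qed
    have "norm (l *\<^sub>R q + l' *\<^sub>R q') \<le> l * norm q + l' * norm q'"
      using norm_triangle_ineq[of "l *\<^sub>R q" "l' *\<^sub>R q'"] l by simp
    then have "(norm (l *\<^sub>R q + l' *\<^sub>R q'))\<^sup>2 \<le> (l * norm q + l' * norm q')\<^sup>2"
      by (intro power_mono) auto
    also have "\<dots> \<le> (l + l') * (l * (norm q)\<^sup>2 + l' * (norm q')\<^sup>2)"
    proof -
      have "(l + l') * (l * (norm q)\<^sup>2 + l' * (norm q')\<^sup>2) - (l * norm q + l' * norm q')\<^sup>2
        = l * l' * (norm q - norm q')\<^sup>2" by (simp add: power2_eq_square algebra_simps)
      moreover have "\<dots> \<ge> 0" using l by simp
      ultimately show ?thesis by simp
    qed
    also have "\<dots> < (l + l') * (l * (2 * z) + l' * (2 * z'))"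
      using l z by (intro mult_strict_left_mono add_strict_mono) auto
    finally have *: "(norm (l *\<^sub>R q + l' *\<^sub>R q'))\<^sup>2 < 2 * (l + l') * (l * z + l' * z')" by (simp add: algebra_simps)
    have "pr (v + v') = (l / (l + l')) *\<^sub>R q + (l' / (l + l')) *\<^sub>R q'"
      by (simp add: pr_def linear_simps c l_l'_def[symmetric] scaleR_add_right divide_inverse mult.commute)
    moreover have "\<dots> \<in> convex hull (pr ` S)"
      using that False l
      by (intro convexD convex_convex_hull) (auto simp: q_q'_z_z'_def add_divide_distrib[symmetric])
    ultimately show ?thesis using l * by (simp add: linear_simps c l_l'_def[symmetric])
  qed
  have scale: "k *\<^sub>R v \<in> ?K" if "v \<in> ?K" "0 \<le> k" for v k
  proof (cases "k = 0 \<or> v = 0")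
    case True then show ?thesis by auto
  next
    case False
    then have k: "k > 0" using that by auto
    have "k\<^sup>2 * (2 * lam v * del v) > k\<^sup>2 * (norm (prl v))\<^sup>2" using that False k by simp
    then show ?thesis using that False k
      by (simp add: linear_simps pr_scale power_mult_distrib power2_eq_square mult_ac)
  qed
  have "convex_cone ?K" unfolding convex_cone_iff using add scale by blast
  moreover have "S \<subseteq> ?K" using assms(2) by (auto simp: hyp3_iff' hull_inc)
  ultimately have "convex_cone hull S \<subseteq> ?K" by (intro hull_minimal)
  then show ?thesis using assms(1) by blast
qed

lemma normalize:
  assumes "lam v > 0" "2 * lam v * del v > (norm (prl v))\<^sup>2"
  obtains k where "k > 0" "k *\<^sub>R v \<in> hyp3"
proof
  let ?k = "1 / sqrt (2 * lam v * del v - (norm (prl v))\<^sup>2)"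
  show "?k > 0" using assms by simp
  have "(sqrt (2 * lam v * del v - (norm (prl v))\<^sup>2))\<^sup>2 = 2 * lam v * del v - (norm (prl v))\<^sup>2"
    using assms by simp
  then show "?k *\<^sub>R v \<in> hyp3" using assms
    by (simp add: hyp3_iff' linear_simps power_divide) (simp add: field_simps power2_eq_square)
qed

text \<open>Scaling to \<open>lam = 1\<close> turns cone combinations into affine ones in the chart,
  and rescaling back to \<open>hyp3\<close> does not move the chart point. Hence geodesic segments
  are straight in the chart.\<close>

lemma hyp_hull_combine:
  assumes x: "x \<in> hyp_hull S" and y: "y \<in> hyp_hull S" and S: "S \<subseteq> hyp3" and velocity: "0 \<le> u" "0 \<le> v" "u + v = 1"
  obtains m where "m \<in> hyp_hull S" "pr m = u *\<^sub>R pr x + v *\<^sub>R pr y" "zz m = u * zz x + v * zz y"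
proof -
  define m where "m = (u / lam x) *\<^sub>R x + (v / lam y) *\<^sub>R y"
  have h: "x \<in> hyp3" "y \<in> hyp3" using x y by (auto simp: hyp_hull_def)
  have l: "lam x > 0" "lam y > 0" using h lam_pos by auto
  have m: "m \<in> convex_cone hull S"
    unfolding m_def using x y l velocity by (intro convex_cone_hull_add convex_cone_hull_mul) (auto simp: hyp_hull_def)
  have lm: "lam m = 1" using l velocity by (simp add: m_def linear_simps)
  have c: "prl m = u *\<^sub>R pr x + v *\<^sub>R pr y" "del m = u * zz x + v * zz y"
    using l h by (simp_all add: m_def linear_simps prl_eq del_eq)
  have "m \<noteq> 0" using lm by (auto simp: linear_simps)
  then obtain k where k: "k > 0" "k *\<^sub>R m \<in> hyp3" using normalize timelike_cone[OF m S] by metis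
  show ?thesis
  proof (rule that[of "k *\<^sub>R m"])
    show "k *\<^sub>R m \<in> hyp_hull S" using k m by (simp add: hyp_hull_def convex_cone_hull_mul)
    show "pr (k *\<^sub>R m) = u *\<^sub>R pr x + v *\<^sub>R pr y" "zz (k *\<^sub>R m) = u * zz x + v * zz y"
      using k c lm by (simp_all add: pr_scale) (simp_all add: pr_def zz_def)
  qed
qed

lemma pr_hyp_hull:
  assumes S: "S \<subseteq> hyp3"
  shows "pr ` hyp_hull S = convex hull (pr ` S)"
proof
  show "pr ` hyp_hull S \<subseteq> convex hull (pr ` S)"
  proof (rule image_subsetI)
    fix x assume "x \<in> hyp_hull S"
    then have "x \<in> convex_cone hull S" "lam x > 0" using lam_pos by (auto simp: hyp_hull_def)
    then show "pr x \<in> convex hull (pr ` S)" using timelike_cone[OF _ S, of x] by (auto simp: linear_simps)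
  qed
  show "convex hull (pr ` S) \<subseteq> pr ` hyp_hull S"
  proof (rule hull_minimal)
    show "pr ` S \<subseteq> pr ` hyp_hull S" using S by (auto intro!: imageI hyp_hull_inc)
    show "convex (pr ` hyp_hull S)"
    proof (rule convexI)
      fix p q u v assume "p \<in> pr ` hyp_hull S" "q \<in> pr ` hyp_hull S" "0 \<le> u" "0 \<le> v" "u + v = (1::real)"
      then obtain x y where "x \<in> hyp_hull S" "y \<in> hyp_hull S" "p = pr x" "q = pr y" "0 \<le> u" "0 \<le> v" "u + v = 1"
        by blast
      then obtain m where "m \<in> hyp_hull S" "pr m = u *\<^sub>R p + v *\<^sub>R q" using hyp_hull_combine[of x S y u v] S by metis
      then show "u *\<^sub>R p + v *\<^sub>R q \<in> pr ` hyp_hull S" by (metis imageI)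
    qed
  qed
qed

end

lemma cusp_exists:
  assumes "ideal_point c"
  obtains d e1 e2 where "cusp c d e1 e2"
proof -
  have c: "mink c c = 0" "c $ 4 > 0" using assms by (auto simp: ideal_point_def)
  define c1 c2 c3 c4 where "c1 = c$1" "c2 = c$2" "c3 = c$3" "c4 = c$4"
  have c4: "c4 > 0" and cc: "c1\<^sup>2 + c2\<^sup>2 + c3\<^sup>2 = c4\<^sup>2"
    using c by (auto simp: c1_c2_c3_c4_def mink_def power2_eq_square)
  define V where "V a b e f = (\<chi> i::4. if i = 1 then a else if i = 2 then b else if i = 3 then e else f)" for a b e f :: real
  have V: "V a b e f $ 1 = a" "V a b e f $ 2 = b" "V a b e f $ 3 = e" "V a b e f $ 4 = f" for a b e f
    by (simp_all add: V_def)
  \<comment> \<open>The vector \<open>c\<close> with its spatial part reversed, scaled so that its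
    product with \<open>c\<close> is \<open>-1\<close>. It remains to complete the spatial direction
    of \<open>c\<close> to an orthonormal basis of the 3-dimensional space.\<close>
  define d where "d = V (- c1 / (2 * c4\<^sup>2)) (- c2 / (2 * c4\<^sup>2)) (- c3 / (2 * c4\<^sup>2)) (1 / (2 * c4))"
  have main: "cusp c d (V a1 a2 a3 0) (V b1 b2 b3 0)"
    if "a1\<^sup>2 + a2\<^sup>2 + a3\<^sup>2 = 1" "b1\<^sup>2 + b2\<^sup>2 + b3\<^sup>2 = 1" "a1 * b1 + a2 * b2 + a3 * b3 = 0"
       "c1 * a1 + c2 * a2 + c3 * a3 = 0" "c1 * b1 + c2 * b2 + c3 * b3 = 0"
       "\<And>x1 x2 x3. x1 = (x1 * c1 + x2 * c2 + x3 * c3) * c1 / c4\<^sup>2 + (x1 * a1 + x2 * a2 + x3 * a3) * a1 + (x1 * b1 + x2 * b2 + x3 * b3) * b1"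
       "\<And>x1 x2 x3. x2 = (x1 * c1 + x2 * c2 + x3 * c3) * c2 / c4\<^sup>2 + (x1 * a1 + x2 * a2 + x3 * a3) * a2 + (x1 * b1 + x2 * b2 + x3 * b3) * b2"
       "\<And>x1 x2 x3. x3 = (x1 * c1 + x2 * c2 + x3 * c3) * c3 / c4\<^sup>2 + (x1 * a1 + x2 * a2 + x3 * a3) * a3 + (x1 * b1 + x2 * b2 + x3 * b3) * b3"
    for a1 a2 a3 b1 b2 b3
  proof
    show "c $ 4 > 0" "mink c c = 0" using c by auto
    have c4': "c4\<^sup>2 \<noteq> 0" using c4 by simp
    have "mink d d = (c1\<^sup>2 + c2\<^sup>2 + c3\<^sup>2) / (2 * c4\<^sup>2)\<^sup>2 - 1 / (2 * c4)\<^sup>2"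
      by (simp add: mink_def d_def V add_divide_distrib power2_eq_square)
    then show "mink d d = 0" unfolding cc using c4 by (simp add: field_simps power2_eq_square)
    have "mink c d = - (c1\<^sup>2 + c2\<^sup>2 + c3\<^sup>2) / (2 * c4\<^sup>2) - c4 * (1 / (2 * c4))"
      by (simp add: mink_def d_def V c1_c2_c3_c4_def[symmetric] add_divide_distrib diff_divide_distrib power2_eq_square)
    then show "mink c d = - 1" unfolding cc using c4 by (simp add: field_simps)
    show "mink (V a1 a2 a3 0) (V a1 a2 a3 0) = 1" "mink (V b1 b2 b3 0) (V b1 b2 b3 0) = 1"
      "mink (V a1 a2 a3 0) (V b1 b2 b3 0) = 0" "mink c (V a1 a2 a3 0) = 0" "mink c (V b1 b2 b3 0) = 0"
      using that(1-5) by (simp_all add: mink_def V c1_c2_c3_c4_def[symmetric] power2_eq_square)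
    have e: "mink d (V x1 x2 x3 0) = - (c1 * x1 + c2 * x2 + c3 * x3) / (2 * c4\<^sup>2)" for x1 x2 x3
      by (simp add: mink_def V d_def add_divide_distrib diff_divide_distrib)
    show "mink d (V a1 a2 a3 0) = 0" "mink d (V b1 b2 b3 0) = 0" using that(4,5) by (simp_all add: e)
    fix x :: "real^4"
    define s where "s = x$1 * c1 + x$2 * c2 + x$3 * c3"
    have xc: "mink x c = s - x$4 * c4" by (simp add: mink_def s_def c1_c2_c3_c4_def)
    have xd: "mink x d = - (s + x$4 * c4) / (2 * c4\<^sup>2)"
      using c4 by (simp add: mink_def s_def d_def V field_simps power2_eq_square)
    have k: "- (mink x c) * (- k / (2 * c4\<^sup>2)) + - (mink x d) * k = s * k / c4\<^sup>2" for k
      unfolding xc xd using c4 by (simp add: field_simps)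
    have k4: "- (mink x c) * (1 / (2 * c4)) + - (mink x d) * c4 = x $ 4"
      unfolding xc xd using c4 by (simp add: field_simps power2_eq_square)
    have xa: "mink x (V y1 y2 y3 0) = x$1 * y1 + x$2 * y2 + x$3 * y3" for y1 y2 y3 by (simp add: mink_def V)
    show "x = - mink x c *\<^sub>R d + - mink x d *\<^sub>R c + mink x (V a1 a2 a3 0) *\<^sub>R V a1 a2 a3 0 +
       mink x (V b1 b2 b3 0) *\<^sub>R V b1 b2 b3 0" (is "x = ?y")
      unfolding vec_eq_iff forall_4
    proof (intro conjI)
      have "?y $ 1 = s * c1 / c4\<^sup>2 + mink x (V a1 a2 a3 0) * a1 + mink x (V b1 b2 b3 0) * b1"
        using k[of c1] by (simp add: d_def V c1_c2_c3_c4_def)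
      then show "x $ 1 = ?y $ 1" using that(6)[of "x$1" "x$2" "x$3"] by (simp add: xa s_def)
      have "?y $ 2 = s * c2 / c4\<^sup>2 + mink x (V a1 a2 a3 0) * a2 + mink x (V b1 b2 b3 0) * b2"
        using k[of c2] by (simp add: d_def V c1_c2_c3_c4_def)
      then show "x $ 2 = ?y $ 2" using that(7)[of "x$2" "x$1" "x$3"] by (simp add: xa s_def)
      have "?y $ 3 = s * c3 / c4\<^sup>2 + mink x (V a1 a2 a3 0) * a3 + mink x (V b1 b2 b3 0) * b3"
        using k[of c3] by (simp add: d_def V c1_c2_c3_c4_def)
      then show "x $ 3 = ?y $ 3" using that(8)[of "x$3" "x$1" "x$2"] by (simp add: xa s_def)
      show "x $ 4 = ?y $ 4" using k4 by (simp add: d_def V c1_c2_c3_c4_def)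
    qed
  qed
  show ?thesis
  proof (cases "c1 = 0 \<and> c2 = 0")
    case True
    then have "c3\<^sup>2 = c4\<^sup>2" using cc by simp
    then have "x * c3 * c3 / c4\<^sup>2 = x" for x using c4 by (simp add: power2_eq_square mult.assoc)
    then have "cusp c d (V 1 0 0 0) (V 0 1 0 0)" by (intro main) (use True in auto)
    then show ?thesis by (rule that)
  next
    case False
    define s where "s = sqrt (c1\<^sup>2 + c2\<^sup>2)"
    have "c1\<^sup>2 + c2\<^sup>2 > 0" using False by (auto simp: sum_power2_gt_zero_iff)
    then have s: "s > 0" "s\<^sup>2 = c1\<^sup>2 + c2\<^sup>2" by (auto simp: s_def)
    have c4s: "c4\<^sup>2 = s\<^sup>2 + c3\<^sup>2" using cc s by simp
    have n: "s \<noteq> 0" "c4 \<noteq> 0" using s c4 by auto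
    have u1: "(c1 / s)\<^sup>2 + (c2 / s)\<^sup>2 = 1" using n by (simp add: power_divide add_divide_distrib[symmetric] s(2)[symmetric])
    have u2: "(s / c4)\<^sup>2 + (c3 / c4)\<^sup>2 = 1" using n c4s by (simp add: power_divide add_divide_distrib[symmetric])
    \<comment> \<open>Longitude (\<open>p\<close>, \<open>q\<close>) and latitude (\<open>f\<close>,
      \<open>g\<close>) of the spatial direction of \<open>c\<close>; the other two basis vectors
      are the unit vectors along the parallel and the meridian.\<close>
    define p q f g where "p = c1 / s" "q = c2 / s" "f = s / c4" "g = c3 / c4"
    have c': "c1 = c4 * f * p" "c2 = c4 * f * q" "c3 = c4 * g" using n by (auto simp: p_q_f_g_def)
    have u: "p\<^sup>2 + q\<^sup>2 = 1" "f\<^sup>2 + g\<^sup>2 = 1" using u1 u2 by (auto simp: p_q_f_g_def)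
    have cd: "(x1 * (c4 * f * p) + x2 * (c4 * f * q) + x3 * (c4 * g)) * (c4 * y) / c4\<^sup>2 = (x1 * f * p + x2 * f * q + x3 * g) * y" for x1 x2 x3 y
      using n by (simp add: field_simps power2_eq_square)
    have "cusp c d (V (- q) p 0 0) (V (- (g * p)) (- (g * q)) f 0)"
    proof (rule main)
      show "(- q)\<^sup>2 + p\<^sup>2 + 0\<^sup>2 = 1" using u by simp
      show "(- (g * p))\<^sup>2 + (- (g * q))\<^sup>2 + f\<^sup>2 = 1" using u by simp algebra
      show "- q * - (g * p) + p * - (g * q) + 0 * f = 0" by simp
      show "c1 * - q + c2 * p + c3 * 0 = 0" by (simp add: c')
      show "c1 * - (g * p) + c2 * - (g * q) + c3 * f = 0" unfolding c' using u by algebra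
      fix x1 x2 x3 :: real
      show "x1 = (x1 * c1 + x2 * c2 + x3 * c3) * c1 / c4\<^sup>2 + (x1 * - q + x2 * p + x3 * 0) * - q
        + (x1 * - (g * p) + x2 * - (g * q) + x3 * f) * - (g * p)"
        unfolding c' mult.assoc[of c4 f] cd[unfolded mult.assoc[of c4 f]] using u by algebra
      show "x2 = (x1 * c1 + x2 * c2 + x3 * c3) * c2 / c4\<^sup>2 + (x1 * - q + x2 * p + x3 * 0) * p
        + (x1 * - (g * p) + x2 * - (g * q) + x3 * f) * - (g * q)"
        unfolding c' mult.assoc[of c4 f] cd[unfolded mult.assoc[of c4 f]] using u by algebra
      show "x3 = (x1 * c1 + x2 * c2 + x3 * c3) * c3 / c4\<^sup>2 + (x1 * - q + x2 * p + x3 * 0) * 0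
        + (x1 * - (g * p) + x2 * - (g * q) + x3 * f) * f"
        unfolding c' mult.assoc[of c4 f] cd[unfolded mult.assoc[of c4 f]] using u by algebra
    qed
    then show ?thesis by (rule that)
  qed
qed

section \<open>The surface as a graph\<close>

context cusp begin

lemma horosphere_iff: "x \<in> horosphere c s \<longleftrightarrow> x \<in> hyp3 \<and> lam x = s"
  by (auto simp: horosphere_def lam_def)

lemma horo_proj_1:
  assumes x: "x \<in> hyp3"
  shows "horo_proj c 1 x \<in> horosphere c 1" "pr (horo_proj c 1 x) = pr x"
proof -
  define y where "y = mk 1 (1/2 + (norm (pr x))\<^sup>2 / 2) (pr x)"
  have lx: "lam x > 0" using lam_pos[OF x] .
  have y: "y \<in> hyp3" "lam y = 1" "pr y = pr x"
    by (simp_all add: hyp3_iff' y_def) (simp add: pr_def)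
  have sp: "\<exists>a b. v = a *\<^sub>R x + b *\<^sub>R c" if "v \<in> span {x,c}" for v
    using that by (auto simp: span_insert span_singleton algebra_simps)
  have uniq: "v = y" if v: "v \<in> horosphere c 1 \<and> v \<in> span {x,c}" for v
  proof -
    obtain a b where ab: "v = a *\<^sub>R x + b *\<^sub>R c" using sp v by blast
    have h: "v \<in> hyp3" "lam v = 1" using v by (auto simp: horosphere_iff)
    then have a: "a * lam x = 1" by (simp add: ab linear_simps lam_c)
    then have a': "a = inverse (lam x)" using lx by (simp add: field_simps)
    have "pr v = pr x" using h(2) by (simp add: pr_def ab linear_simps lam_c a')
    moreover have "zz v = zz y" using zz_eq[OF h(1)] zz_eq[OF y(1)] h(2) y \<open>pr v = pr x\<close> by simp
    ultimately show ?thesis using h y by (intro hyp3_eqI) auto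
  qed
  have "y = (1 / lam x) *\<^sub>R x + (1/2 + (norm (pr x))\<^sup>2 / 2 - del x / lam x) *\<^sub>R c"
  proof (rule ext)
    show "prl y = prl ((1 / lam x) *\<^sub>R x + (1/2 + (norm (pr x))\<^sup>2 / 2 - del x / lam x) *\<^sub>R c)"
      unfolding y_def mk_simps linear_simps lam_c by (simp add: pr_def inverse_eq_divide)
  qed (use lx in \<open>simp_all add: y_def linear_simps lam_c\<close>)
  then have "y \<in> span {x,c}"
    by (rule ssubst) (intro span_add span_scale span_base; simp)
  then have "horo_proj c 1 x = y"
    unfolding horo_proj_def using y by (intro the_equality uniq) (simp_all add: horosphere_iff)
  then show "horo_proj c 1 x \<in> horosphere c 1" "pr (horo_proj c 1 x) = pr x"
    using y by (auto simp: horosphere_iff)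
qed

lemma bij_pr_horosphere: "bij_betw pr (horosphere c 1) UNIV"
proof (rule bij_betwI')
  show "(pr x = pr y) = (x = y)" if "x \<in> horosphere c 1" "y \<in> horosphere c 1" for x y
    using that zz_eq[of x] zz_eq[of y] by (auto simp: horosphere_iff intro: hyp3_eqI)
  show "\<exists>x\<in>horosphere c 1. p = pr x" for p
    by (rule bexI[of _ "mk 1 (1/2 + (norm p)\<^sup>2 / 2) p"])
       (simp_all add: horosphere_iff hyp3_iff' pr_def)
qed auto

text \<open>The projection is a continuous bijection from a surface to the plane, and by invariance
  of domain in local charts it is open.\<close>

lemma surface_homeomorphism:
  assumes F: "polyhedral_surface F" and bij: "bij_betw (horo_proj c 1) F (horosphere c 1)"
  obtains \<sigma> where "F \<subseteq> hyp3" "homeomorphism F UNIV pr \<sigma>"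
proof -
  have Fh: "F \<subseteq> hyp3"
  proof -
    obtain T where "F = (\<Union>t\<in>T. hyp_hull t)"
      using F unfolding polyhedral_surface_def hyp_triangulation_def by blast
    then show ?thesis using hyp_hull_subset by blast
  qed
  have "bij_betw (pr \<circ> horo_proj c 1) F UNIV"
    using bij_betw_trans[OF bij bij_pr_horosphere] .
  then have pr_bij: "bij_betw pr F UNIV"
    by (rule bij_betw_cong[THEN iffD1, rotated]) (use horo_proj_1 Fh in auto)
  have cont: "continuous_on F pr" using continuous_on_pr Fh continuous_on_subset by blast
  have op: "open (pr ` W)" if W: "openin (top_of_set F) W" for W
  proof -
    have "\<exists>N. open N \<and> pr x \<in> N \<and> N \<subseteq> pr ` W" if x: "x \<in> W" for x
    proof -
      obtain B where B: "open B" "W = F \<inter> B" using W by (auto simp: openin_open)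
      obtain U where U: "openin (top_of_set F) U" "x \<in> U" "U homeomorphic (UNIV :: (real^2) set)"
      proof -
        have "x \<in> F" using x B by auto
        then show ?thesis using F that unfolding polyhedral_surface_def by blast
      qed
      obtain f g where fg: "homeomorphism U (UNIV :: (real^2) set) f g" using U(3) by (auto simp: homeomorphic_def)
      have g: "continuous_on UNIV g" "\<And>v. g v \<in> U" "\<And>v. f (g v) = v" "g (f x) = x"
        using fg U(2) by (auto simp: homeomorphism_def)
      have UF: "U \<subseteq> F" using U(1) by (auto simp: openin_open)
      let ?S = "g -` B"
      have "open ?S" using open_vimage[OF B(1) g(1)] .
      moreover have "continuous_on ?S (\<lambda>v. pr (g v))"
        by (rule continuous_on_compose2[OF cont continuous_on_subset[OF g(1)]]) (use g UF in auto)
      moreover have "inj_on (\<lambda>v. pr (g v)) ?S"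
      proof (rule inj_onI)
        fix v v' assume "pr (g v) = pr (g v')"
        then have "g v = g v'"
          using inj_onD[OF bij_betw_imp_inj_on[OF pr_bij]] g(2) UF by blast
        then show "v = v'" using g(3) by metis
      qed
      ultimately have "open ((\<lambda>v. pr (g v)) ` ?S)"
        by (rule invariance_of_domain_gen) simp
      moreover have "pr x \<in> (\<lambda>v. pr (g v)) ` ?S"
        using g(4) x B by (intro image_eqI[of _ _ "f x"]) auto
      moreover have "(\<lambda>v. pr (g v)) ` ?S \<subseteq> pr ` W" using g(2) UF B by auto
      ultimately show ?thesis by blast
    qed
    then have "\<forall>y\<in>pr ` W. \<exists>N. open N \<and> y \<in> N \<and> N \<subseteq> pr ` W" by blast
    then show ?thesis by (subst open_subopen) blast
  qed
  obtain \<sigma> where "homeomorphism F UNIV pr \<sigma>"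
    by (rule homeomorphism_injective_open_map[OF cont, of UNIV])
       (use pr_bij op in \<open>auto simp: bij_betw_def\<close>)
  then show ?thesis using that Fh by blast
qed

end

lemma cross2_0_between:
  assumes "cross2 (b - a) (c - a) = 0"
  shows "a \<in> closed_segment b c \<or> b \<in> closed_segment c a \<or> c \<in> closed_segment a b"
proof -
  have "collinear {b, c, a}"
  proof (cases "b = a")
    case False
    define v where "v = b - a"
    have v: "(norm v)\<^sup>2 \<noteq> 0" using False by (simp add: v_def)
    define k where "k = (v \<bullet> (c - a)) / (norm v)\<^sup>2"
    have "(norm v)\<^sup>2 *\<^sub>R (c - a) = (v \<bullet> (c - a)) *\<^sub>R v"
      using assms unfolding cmod_power2 v_def[symmetric]
      by (simp add: cross2_def inner_complex_def complex_eq_iff power2_eq_square) algebra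
    also have "\<dots> = (norm v)\<^sup>2 *\<^sub>R (k *\<^sub>R v)" using v by (simp add: k_def)
    finally have "c - a = k *\<^sub>R v" using v by (subst (asm) scaleR_cancel_left) auto
    then have "c = k *\<^sub>R b + (1 - k) *\<^sub>R a" by (simp add: v_def algebra_simps)
    then show ?thesis by (auto simp: collinear_3_expand)
  next
    case True
    then have "{b, c, a} = {a, c}" by auto
    then show ?thesis by (simp only: collinear_2)
  qed
  then show ?thesis
    by (auto simp: collinear_between_cases between_mem_segment closed_segment_commute)
qed

lemma norm_midpoint:
  fixes p q :: "'a::real_inner"
  shows "(norm ((1/2) *\<^sub>R p + (1/2) *\<^sub>R q))\<^sup>2 = (norm p)\<^sup>2 / 2 + (norm q)\<^sup>2 / 2 - (norm (p - q))\<^sup>2 / 4"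
  by (simp add: power2_norm_eq_inner inner_add_left inner_add_right inner_diff_left inner_diff_right
      inner_commute[of q p] field_simps)

locale cusp_surface = cusp +
  fixes F :: "(real^4) set" and \<sigma> :: "complex \<Rightarrow> real^4"
  assumes F_hyp: "F \<subseteq> hyp3" and homeo: "homeomorphism F UNIV pr \<sigma>"
begin

lemma \<sigma>: "\<sigma> p \<in> F" "pr (\<sigma> p) = p" "x \<in> F \<Longrightarrow> \<sigma> (pr x) = x" "\<sigma> p \<in> hyp3" "continuous_on UNIV \<sigma>"
  using homeo F_hyp by (auto simp: homeomorphism_def)

definition ht where "ht p = zz (\<sigma> p)"

text \<open>The height of the surface over the paraboloid, which becomes the function
  \<open>r\<close> of \<open>periodic_framework\<close>.\<close>

definition rad where "rad p = ht p - (norm p)\<^sup>2 / 2"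

lemma continuous_ht: "continuous_on UNIV ht"
  unfolding ht_def using \<sigma> by (intro continuous_on_compose2[OF continuous_on_zz]) auto

lemma rad_eq: "x \<in> F \<Longrightarrow> rad (pr x) = 1 / (2 * (lam x)\<^sup>2)"
  using zz_eq[of x] \<sigma>(3) F_hyp by (auto simp: rad_def ht_def)

lemma F_iff: "x \<in> F \<longleftrightarrow> x \<in> hyp3 \<and> zz x = ht (pr x)"
proof
  assume "x \<in> F" then show "x \<in> hyp3 \<and> zz x = ht (pr x)" using \<sigma> F_hyp by (auto simp: ht_def)
next
  assume "x \<in> hyp3 \<and> zz x = ht (pr x)"
  then have "x = \<sigma> (pr x)" using \<sigma> by (intro hyp3_eqI) (auto simp: ht_def)
  then show "x \<in> F" using \<sigma>(1) by metis
qed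

lemma cone_over_eq: "cone_over c F = {y \<in> hyp3. ht (pr y) \<le> zz y}"
proof -
  have "y \<in> cone_over c F \<longleftrightarrow> y \<in> hyp3 \<and> (\<exists>x\<in>F. pr y = pr x \<and> zz x \<le> zz y)" for y
    using F_hyp by (auto simp: cone_over_def ray subset_iff)
  moreover have "(\<exists>x\<in>F. pr y = pr x \<and> zz x \<le> zz y) \<longleftrightarrow> ht (pr y) \<le> zz y" for y
    by (metis F_iff \<sigma>(1,2))
  ultimately show ?thesis by auto
qed

lemma hyp_boundary_cone: "hyp_boundary (cone_over c F) = F"
proof -
  let ?P = "{y \<in> hyp3. ht (pr y) \<le> zz y}" and ?X = "top_of_set hyp3"
  have cont: "continuous_on hyp3 (\<lambda>y. zz y - ht (pr y))"
    by (intro continuous_intros continuous_on_zz continuous_on_compose2[OF continuous_ht continuous_on_pr]) auto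
  have "closedin ?X (hyp3 \<inter> (\<lambda>y. zz y - ht (pr y)) -` {0..})"
    by (rule continuous_closedin_preimage[OF cont]) simp
  also have "hyp3 \<inter> (\<lambda>y. zz y - ht (pr y)) -` {0..} = ?P" by auto
  finally have cl: "?X closure_of ?P = ?P" by (rule closure_of_closedin)
  have "openin ?X (hyp3 \<inter> (\<lambda>y. zz y - ht (pr y)) -` {0<..})"
    by (rule continuous_openin_preimage_gen[OF cont]) simp
  then have int: "hyp3 \<inter> (\<lambda>y. zz y - ht (pr y)) -` {0<..} \<subseteq> ?X interior_of ?P"
    by (intro interior_of_maximal) auto
  have notint: "x \<notin> ?X interior_of ?P" if x: "x \<in> F" for x
  proof
    assume "x \<in> ?X interior_of ?P"
    then obtain B where B: "open B" "x \<in> B" "hyp3 \<inter> B \<subseteq> ?P"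
      by (auto simp: interior_of_def openin_open)
    have xh: "x \<in> hyp3" and zx: "zz x = ht (pr x)" using x by (auto simp: F_iff)
    define k where "k = 2 * zz x - (norm (pr x))\<^sup>2"
    have k: "k > 0" using zz_gt[OF xh] by (simp add: k_def)
    \<comment> \<open>The cone is the epigraph of \<open>ht\<close>, so moving straight down from a
      surface point leaves it at once. The constant \<open>k\<close> is the room left above the
      paraboloid.\<close>
    define \<gamma> where "\<gamma> t = pt (pr x) (zz x - t)" for t
    have "isCont \<gamma> 0"
      unfolding \<gamma>_def pt_def mk_def using k by (intro continuous_intros) (auto simp: k_def)
    moreover have "\<gamma> 0 = x" using pt_eta[OF xh] by (simp add: \<gamma>_def)
    ultimately have "(\<gamma> \<longlongrightarrow> x) (at 0)" by (simp add: isCont_def)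
    from topological_tendstoD[OF this B(1,2)] have "\<forall>\<^sub>F t in at 0. \<gamma> t \<in> B" .
    then obtain \<delta> where \<delta>: "\<delta> > 0" "\<And>t. t \<noteq> 0 \<Longrightarrow> dist t 0 < \<delta> \<Longrightarrow> \<gamma> t \<in> B"
      by (auto simp: eventually_at)
    define t where "t = min (\<delta> / 2) (k / 4)"
    have t: "t > 0" "t < \<delta>" "2 * t < k" using \<delta> k by (auto simp: t_def min_def)
    have "2 * (zz x - t) > (norm (pr x))\<^sup>2" using t by (simp add: k_def)
    note p = pt[OF this, folded \<gamma>_def]
    have "\<gamma> t \<in> hyp3 \<inter> B" using \<delta>(2)[of t] t p(1) by simp
    then have "ht (pr (\<gamma> t)) \<le> zz (\<gamma> t)" using B(3) by blast
    then show False using p t zx by simp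
  qed
  have "?X frontier_of ?P = F"
    unfolding frontier_of_def cl using int notint by (auto simp: F_iff)
  then show ?thesis by (simp add: hyp_boundary_def cone_over_eq)
qed

end

section \<open>The triangulation projected to the plane\<close>

locale cusp_triangulation = cusp_surface +
  fixes T :: "(real^4) set set"
  assumes T: "hyp_triangulation T F"
begin

lemma T_hyp: "t \<in> T \<Longrightarrow> t \<subseteq> hyp3" and T_card: "t \<in> T \<Longrightarrow> card t = 3" and T_indep: "t \<in> T \<Longrightarrow> independent t"
  and T_inter: "s \<in> T \<Longrightarrow> t \<in> T \<Longrightarrow> hyp_hull s \<inter> hyp_hull t = hyp_hull (s \<inter> t)"
  and T_fin: "compact K \<Longrightarrow> K \<subseteq> hyp3 \<Longrightarrow> finite {t\<in>T. hyp_hull t \<inter> K \<noteq> {}}"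
  and T_cover: "F = (\<Union>t\<in>T. hyp_hull t)"
  using T unfolding hyp_triangulation_def by blast+

lemma hull_F: "t \<in> T \<Longrightarrow> hyp_hull t \<subseteq> F"
  using T_cover by blast

lemma T_F: "t \<in> T \<Longrightarrow> t \<subseteq> F"
  using hull_F hyp_hull_inc T_hyp by blast

lemma inj_pr: "inj_on pr F"
  using \<sigma>(3) by (metis inj_onI)

lemma pr_T_inter: "s \<in> T \<Longrightarrow> t \<in> T \<Longrightarrow> pr ` (s \<inter> t) = pr ` s \<inter> pr ` t"
  using T_F inj_pr by (intro inj_on_image_Int[OF inj_pr]) auto

lemma planar_inter:
  assumes "s \<in> T" "t \<in> T"
  shows "convex hull (pr ` s) \<inter> convex hull (pr ` t) = convex hull (pr ` s \<inter> pr ` t)"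
proof -
  have "pr ` hyp_hull s \<inter> pr ` hyp_hull t = pr ` (hyp_hull s \<inter> hyp_hull t)"
    using hull_F assms by (intro inj_on_image_Int[OF inj_pr, symmetric]) auto
  also have "\<dots> = convex hull (pr ` (s \<inter> t))"
    unfolding T_inter[OF assms] using T_hyp assms by (intro pr_hyp_hull) auto
  finally show ?thesis using assms T_hyp by (simp add: pr_hyp_hull pr_T_inter)
qed

lemma planar_cover: "(\<Union>t\<in>T. convex hull (pr ` t)) = UNIV"
proof -
  have "(\<Union>t\<in>T. convex hull (pr ` t)) = (\<Union>t\<in>T. pr ` hyp_hull t)" using T_hyp by (simp add: pr_hyp_hull)
  also have "\<dots> = pr ` F" unfolding T_cover by blast
  also have "\<dots> = UNIV" using homeo by (simp add: homeomorphism_def)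
  finally show ?thesis .
qed

lemma planar_finite:
  assumes K: "compact K"
  shows "finite {t\<in>T. convex hull (pr ` t) \<inter> K \<noteq> {}}"
proof -
  have "compact (\<sigma> ` K)" using K \<sigma>(5) compact_continuous_image continuous_on_subset by blast
  then have "finite {t\<in>T. hyp_hull t \<inter> \<sigma> ` K \<noteq> {}}" using \<sigma>(4) by (intro T_fin) auto
  moreover have "hyp_hull t \<inter> \<sigma> ` K \<noteq> {}" if t: "t \<in> T" "convex hull (pr ` t) \<inter> K \<noteq> {}" for t
  proof -
    have "pr ` hyp_hull t \<inter> K \<noteq> {}" using t T_hyp by (simp add: pr_hyp_hull)
    then obtain x where "x \<in> hyp_hull t" "pr x \<in> K" by blast
    moreover from this have "x \<in> F" using hull_F[OF t(1)] by blast
    then have "\<sigma> (pr x) = x" by (rule \<sigma>(3))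
    ultimately show ?thesis by force
  qed
  ultimately show ?thesis by (elim finite_subset[rotated]) blast
qed

text \<open>If the projection degenerated, a point of the opposite edge would project to the same
  place as the vertex. Injectivity of \<open>pr\<close> on the surface would make them equal,
  against linear independence.\<close>

lemma planar_not_between:
  assumes t: "t \<in> T" "t = {a,b,e}" "a \<noteq> b" "a \<noteq> e"
  shows "pr a \<notin> closed_segment (pr b) (pr e)"
proof
  assume "pr a \<in> closed_segment (pr b) (pr e)"
  then have "pr a \<in> pr ` hyp_hull {b,e}"
    using T_hyp[OF t(1)] t(2) by (simp add: pr_hyp_hull segment_convex_hull)
  then obtain x where x: "x \<in> hyp_hull {b,e}" "pr x = pr a" by force
  have "x \<in> hyp_hull t" using x(1) hyp_hull_mono[of "{b,e}" t] t(2) by auto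
  then have "x \<in> F" "a \<in> F" using hull_F[OF t(1)] T_F[OF t(1)] t(2) by auto
  then have "x = a" using x(2) inj_pr by (auto simp: inj_on_def)
  then have "a \<in> convex_cone hull {b,e}" using x(1) by (simp add: hyp_hull_def)
  also have "convex_cone hull {b,e} \<subseteq> span {b,e}"
    by (intro hull_minimal span_superset)
       (auto simp: convex_cone_iff span_zero span_add span_scale)
  also have "span {b,e} \<subseteq> span (t - {a})" using t by (intro span_mono) auto
  finally show False using T_indep[OF t(1)] t(2) by (auto simp: dependent_def)
qed

lemma planar_triangle:
  assumes t: "t \<in> T"
  shows "\<exists>a b e. pr ` t = {a,b,e} \<and> cross2 (b - a) (e - a) > 0"
proof -
  obtain x y z where xyz: "t = {x,y,z}" "x \<noteq> y" "y \<noteq> z" "x \<noteq> z"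
    using T_card[OF t] by (auto simp: card_3_iff)
  have im: "pr ` t = {pr x, pr y, pr z}" "pr ` t = {pr x, pr z, pr y}" unfolding xyz(1) by auto
  have nb: "pr x \<notin> closed_segment (pr y) (pr z)" "pr y \<notin> closed_segment (pr z) (pr x)" "pr z \<notin> closed_segment (pr x) (pr y)"
    by (rule planar_not_between[OF t]; use xyz in auto)+
  then have "cross2 (pr y - pr x) (pr z - pr x) \<noteq> 0" using cross2_0_between by blast
  then consider "cross2 (pr y - pr x) (pr z - pr x) > 0" | "cross2 (pr z - pr x) (pr y - pr x) > 0"
  proof -
    have "cross2 (pr z - pr x) (pr y - pr x) = - cross2 (pr y - pr x) (pr z - pr x)" by (simp add: cross2_def)
    then show ?thesis using that \<open>cross2 (pr y - pr x) (pr z - pr x) \<noteq> 0\<close> by linarith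
  qed
  then show ?thesis
  proof cases
    case 1 with im(1) show ?thesis by blast
  next
    case 2 with im(2) show ?thesis by blast
  qed
qed

text \<open>Over a segment of length h the chord of the paraboloid rises h^2 / 8 above it at the
  midpoint. As \<open>rad\<close> is non-negative at the ends and at most \<open>R\<close> at the
  midpoint, long edges are impossible.\<close>

lemma planar_edge:
  assumes R: "\<And>p. rad p \<le> R" and t: "t \<in> T" "x \<in> t" "y \<in> t"
  shows "(norm (pr x - pr y))\<^sup>2 \<le> 8 * R"
proof -
  have h: "x \<in> hyp_hull t" "y \<in> hyp_hull t" using t T_hyp hyp_hull_inc by blast+
  obtain m where m: "m \<in> hyp_hull t" "pr m = (1/2) *\<^sub>R pr x + (1/2) *\<^sub>R pr y" "zz m = 1/2 * zz x + 1/2 * zz y"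
    using hyp_hull_combine[OF h T_hyp[OF t(1)], of "1/2" "1/2"] by auto
  have F: "m \<in> F" "x \<in> F" "y \<in> F" using m h hull_F[OF t(1)] by auto
  have rd: "zz v = rad (pr v) + (norm (pr v))\<^sup>2 / 2" if "v \<in> F" for v
    using that \<sigma>(3) by (simp add: rad_def ht_def)
  have pos: "rad (pr v) \<ge> 0" if "v \<in> F" for v using rad_eq[OF that] by simp
  have mm: "(norm (pr m))\<^sup>2 = (norm (pr x))\<^sup>2 / 2 + (norm (pr y))\<^sup>2 / 2 - (norm (pr x - pr y))\<^sup>2 / 4"
    unfolding m(2) by (rule norm_midpoint)
  have "rad (pr m) = rad (pr x) / 2 + rad (pr y) / 2 + (norm (pr x - pr y))\<^sup>2 / 8"
    using m(3) mm rd[OF F(1)] rd[OF F(2)] rd[OF F(3)] by linarith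
  then show ?thesis using R[of "pr m"] pos[OF F(2)] pos[OF F(3)] by simp
qed

end

section \<open>Isometries that preserve the horospheres\<close>

lemma linear_mink: "linear (mink x)" "linear (\<lambda>x. mink x y)"
  by (simp_all add: linear_iff mink_simps)

lemma bounded_bilinear_mink: "bounded_bilinear mink"
  by (rule bilinear_conv_bounded_bilinear[THEN iffD1]) (simp add: bilinear_def linear_mink)

lemma matrix_inv_inverse:
  fixes A :: "real^'n^'m"
  assumes "invertible A"
  shows "A ** matrix_inv A = mat 1" "matrix_inv A ** A = mat 1"
  using someI_ex[OF assms[unfolded invertible_def]] by (auto simp: matrix_inv_def)

context cusp begin

lemma linear_coords: "linear lam" "linear del" "linear prl"
  by (simp_all add: linear_iff linear_simps)

text \<open>In the chart \<open>- mink x y\<close> equals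
  \<open>l * m * (norm (p - q))\<^sup>2 / 2 + (l / m + m / l) / 2\<close>, and a positive number
  plus its inverse is at least 2.\<close>

lemma mink_le:
  assumes "x \<in> hyp3" "y \<in> hyp3"
  shows "mink x y \<le> - 1"
proof -
  define l m p q where "l = lam x" "m = lam y" "p = pr x" "q = pr y"
  have lm: "l > 0" "m > 0" using assms lam_pos by (auto simp: l_m_p_q_def)
  have "mink x y = l * m * (p \<bullet> q) - l * (m * ((norm q)\<^sup>2 / 2 + 1 / (2 * m\<^sup>2))) - (l * ((norm p)\<^sup>2 / 2 + 1 / (2 * l\<^sup>2))) * m"
    using assms by (simp add: mink_expand prl_eq del_eq zz_eq l_m_p_q_def)
  also have "\<dots> = - (l * m * ((norm (p - q))\<^sup>2 / 2)) - (l / m + m / l) / 2"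
  proof -
    have "(norm (p - q))\<^sup>2 = (norm p)\<^sup>2 + (norm q)\<^sup>2 - 2 * (p \<bullet> q)"
      by (simp add: power2_norm_eq_inner inner_diff_left inner_diff_right inner_commute)
    then show ?thesis using lm by (simp only:) (simp add: field_simps power2_eq_square)
  qed
  also have "\<dots> \<le> - 1"
  proof -
    have "l / m + m / l - 2 = (l - m)\<^sup>2 / (l * m)" using lm by (simp add: field_simps power2_eq_square)
    moreover have "(l - m)\<^sup>2 / (l * m) \<ge> 0" using lm by simp
    ultimately have "2 \<le> l / m + m / l" by (metis diff_ge_0_iff_ge)
    moreover have "0 \<le> l * m * ((norm (p - q))\<^sup>2 / 2)" using lm by simp
    ultimately show ?thesis by argo
  qed
  finally show ?thesis .
qed

text \<open>Two points on the vertical over the origin yield \<open>c\<close> and \<open>d\<close>,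
  one further point each yields \<open>e1\<close> and \<open>e2\<close>. Linear maps are thus
  determined by their values on \<open>hyp3\<close>.\<close>

lemma span_hyp3: "span hyp3 = UNIV"
proof -
  have mkh: "mk l \<delta> q \<in> hyp3" if "l > 0" "2 * l * \<delta> = 1 + (norm q)\<^sup>2" for l \<delta> q
    using that by (simp add: hyp3_iff')
  have mk_lin: "mk l \<delta> q - mk l' \<delta>' q' = mk (l - l') (\<delta> - \<delta>') (q - q')" "k *\<^sub>R mk l \<delta> q = mk (k * l) (k * \<delta>) (k *\<^sub>R q)" for k l \<delta> q l' \<delta>' q'
    by (intro ext; simp add: linear_simps)+
  have s: "mk 1 (1/2) 0 \<in> span hyp3" "mk 2 (1/4) 0 \<in> span hyp3" "mk 1 1 1 \<in> span hyp3" "mk 1 1 \<i> \<in> span hyp3"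
    by (intro span_base mkh; simp)+
  have "2 *\<^sub>R mk 1 (1/2) 0 - mk 2 (1/4) 0 \<in> span hyp3" by (intro span_diff span_scale s)
  then have c1: "(4/3) *\<^sub>R mk 0 (3/4) 0 \<in> span hyp3" by (intro span_scale) (simp add: mk_lin)
  then have c': "mk 0 1 0 \<in> span hyp3" by (simp add: mk_lin)
  have "mk 1 (1/2) 0 - (1/2) *\<^sub>R mk 0 1 0 \<in> span hyp3" by (intro span_diff span_scale s c')
  then have d': "mk 1 0 0 \<in> span hyp3" by (simp add: mk_lin)
  have "mk 1 1 1 - mk 1 0 0 - mk 0 1 0 \<in> span hyp3" "mk 1 1 \<i> - mk 1 0 0 - mk 0 1 0 \<in> span hyp3"
    by (intro span_diff s c' d')+
  then have e': "mk 0 0 1 \<in> span hyp3" "mk 0 0 \<i> \<in> span hyp3" by (simp_all add: mk_lin)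
  have "x \<in> span hyp3" for x
  proof -
    have "x = lam x *\<^sub>R mk 1 0 0 + del x *\<^sub>R mk 0 1 0 + Re (prl x) *\<^sub>R mk 0 0 1 + Im (prl x) *\<^sub>R mk 0 0 \<i>"
      by (intro ext) (simp_all add: linear_simps complex_eq_iff)
    moreover have "\<dots> \<in> span hyp3" by (intro span_add span_scale c' d' e')
    ultimately show ?thesis by metis
  qed
  then show ?thesis by blast
qed

lemma hyp3_linear_eq:
  assumes "linear f" "linear g" "\<And>x. x \<in> hyp3 \<Longrightarrow> f x = g x"
  shows "f x = g x"
  using linear_eq_on_span[OF assms(1,2), of hyp3] assms(3) span_hyp3 by blast

lemma mink_nondegenerate:
  assumes "\<And>y. y \<in> hyp3 \<Longrightarrow> mink v y = mink v' y"
  shows "v = v'"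
proof -
  have "mink v y = mink v' y" for y by (rule hyp3_linear_eq[OF linear_mink(1) linear_mink(1) assms])
  then show ?thesis by (intro ext) (simp_all add: lam_def del_def prl_def)
qed

lemma isometry_hyp3: "hyp_isometry A \<Longrightarrow> x \<in> hyp3 \<Longrightarrow> A *v x \<in> hyp3"
  by (auto simp: hyp_isometry_def)

text \<open>By \<open>mink_le\<close> the arguments of \<open>arcosh\<close> are at least 1, where
  it is injective. This gives the identity on \<open>hyp3\<close>, and linearity extends it in one
  variable after the other.\<close>

lemma isometry_mink:
  assumes A: "hyp_isometry A"
  shows "mink (A *v x) (A *v y) = mink x y"
proof -
  have 0: "mink (A *v x) (A *v y) = mink x y" if "x \<in> hyp3" "y \<in> hyp3" for x y
  proof -
    have "arcosh (- mink (A *v x) (A *v y)) = arcosh (- mink x y)"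
      using A that by (simp add: hyp_isometry_def hyp_dist_def)
    then have "cosh (arcosh (- mink (A *v x) (A *v y))) = cosh (arcosh (- mink x y))" by simp
    then show ?thesis
      using mink_le[OF that] mink_le[OF isometry_hyp3[OF A that(1)] isometry_hyp3[OF A that(2)]]
      by (simp add: cosh_arcosh_real)
  qed
  have l1: "linear (\<lambda>x. mink (A *v x) (A *v y))" "linear (\<lambda>y. mink (A *v x) (A *v y))" for x y
    by (simp_all add: linear_iff mink_simps matrix_vector_right_distrib matrix_vector_mult_scaleR)
  have 1: "mink (A *v x) (A *v y) = mink x y" if "y \<in> hyp3" for x y
    by (rule hyp3_linear_eq[OF l1(1) linear_mink(2)]) (use 0 that in auto)
  show ?thesis
    by (rule hyp3_linear_eq[OF l1(2) linear_mink(1)]) (use 1 in auto)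
qed

lemma parabolic_lam:
  assumes A: "hyp_isometry A" "preserves_horospheres c A"
  shows "lam (A *v x) = lam x"
proof (rule hyp3_linear_eq)
  show "linear (\<lambda>x. lam (A *v x))"
    by (simp add: linear_iff linear_simps matrix_vector_right_distrib matrix_vector_mult_scaleR)
  show "linear lam" by (rule linear_coords)
  fix x assume x: "x \<in> hyp3"
  then have "A *v x \<in> (\<lambda>x. A *v x) ` horosphere c (lam x)" by (auto simp: horosphere_iff)
  also have "\<dots> = horosphere c (lam x)"
    using A(2) lam_pos[OF x] by (simp add: preserves_horospheres_def)
  finally show "lam (A *v x) = lam x" by (simp add: horosphere_iff)
qed

lemma parabolic_fix:
  assumes A: "hyp_isometry A" "preserves_horospheres c A"
  shows "A *v c = c"
proof (rule mink_nondegenerate)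
  fix y assume "y \<in> hyp3"
  then have "y \<in> (\<lambda>x. A *v x) ` hyp3" using A(1) by (simp add: hyp_isometry_def)
  then obtain x where x: "y = A *v x" by blast
  have "mink (A *v c) y = mink c x" unfolding x by (rule isometry_mink[OF A(1)])
  also have "\<dots> = mink c y" using parabolic_lam[OF A, of x] by (simp add: x lam_def mink_commute[of c])
  finally show "mink (A *v c) y = mink c y" .
qed

text \<open>As \<open>A\<close> fixes \<open>c\<close> and preserves \<open>lam\<close>, the images
  of \<open>e1\<close> and \<open>e2\<close> project to orthonormal plane vectors. The second is
  \<plusminus>\<i> times the first, the sign separating rotations from reflections.\<close>

lemma parabolic_prl:
  assumes A: "hyp_isometry A" "preserves_horospheres c A"
  obtains a m where "norm m = 1"
    "(\<forall>x. prl (A *v x) = lam x *\<^sub>R a + m * prl x) \<or> (\<forall>x. prl (A *v x) = lam x *\<^sub>R a + m * cnj (prl x))"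
proof -
  define a m m' where "a = prl (A *v d)" and "m = prl (A *v e1)" and "m' = prl (A *v e2)"
  have exp: "prl (A *v x) = lam x *\<^sub>R a + Re (prl x) *\<^sub>R m + Im (prl x) *\<^sub>R m'" for x
  proof -
    have "A *v x = A *v (mk (lam x) (del x) (prl x))" by (simp add: mk_eta)
    also have "\<dots> = lam x *\<^sub>R (A *v d) + del x *\<^sub>R (A *v c) + Re (prl x) *\<^sub>R (A *v e1) + Im (prl x) *\<^sub>R (A *v e2)"
      by (simp add: mk_def matrix_vector_right_distrib matrix_vector_mult_scaleR)
    finally show ?thesis by (simp add: parabolic_fix[OF A] linear_simps lam_c a_def m_def m'_def)
  qed
  have "lam (A *v e1) = 0" "lam (A *v e2) = 0"
    using parabolic_lam[OF A] by (simp_all add: lam_def gram_sym)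
  then have mm: "m \<bullet> m = 1" "m' \<bullet> m' = 1" "m \<bullet> m' = 0"
    using isometry_mink[OF A(1), of e1 e1] isometry_mink[OF A(1), of e2 e2] isometry_mink[OF A(1), of e1 e2]
    by (simp_all add: mink_expand[of "A *v _"] gram m_def m'_def)
  have "m' = \<i> * m \<or> m' = - (\<i> * m)"
  proof -
    define k where "k = m' \<bullet> (\<i> * m)"
    have "(m \<bullet> m) *\<^sub>R m' = (m' \<bullet> m) *\<^sub>R m + k *\<^sub>R (\<i> * m)"
      by (simp add: inner_complex_def complex_eq_iff k_def algebra_simps)
    then have m': "m' = k *\<^sub>R (\<i> * m)" using mm by (simp add: inner_commute)
    have "k\<^sup>2 * (m \<bullet> m) = m' \<bullet> m'" unfolding m' by (simp add: inner_complex_def power2_eq_square algebra_simps)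
    then have "k\<^sup>2 = 1" using mm by simp
    then have "k = 1 \<or> k = - 1" by (simp add: power2_eq_1_iff)
    then show ?thesis using m' by auto
  qed
  then have "(\<forall>x. prl (A *v x) = lam x *\<^sub>R a + m * prl x) \<or> (\<forall>x. prl (A *v x) = lam x *\<^sub>R a + m * cnj (prl x))"
  proof
    assume "m' = \<i> * m" then show ?thesis unfolding exp by (simp add: complex_eq_iff algebra_simps)
  next
    assume "m' = - (\<i> * m)" then show ?thesis unfolding exp by (simp add: complex_eq_iff algebra_simps)
  qed
  moreover have "norm m = 1" using mm(1) by (simp add: norm_eq_sqrt_inner)
  ultimately show ?thesis using that by blast
qed

lemma parabolic_pr:
  assumes A: "hyp_isometry A" "preserves_horospheres c A"
  obtains a m where "norm m = 1"
    "(\<forall>x\<in>hyp3. pr (A *v x) = a + m * pr x) \<or> (\<forall>x\<in>hyp3. pr (A *v x) = a + m * cnj (pr x))"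
proof (rule parabolic_prl[OF A])
  fix a m assume *: "norm m = 1"
    "(\<forall>x. prl (A *v x) = lam x *\<^sub>R a + m * prl x) \<or> (\<forall>x. prl (A *v x) = lam x *\<^sub>R a + m * cnj (prl x))"
  have key: "pr (A *v x) = b" if "x \<in> hyp3" "prl (A *v x) = lam x *\<^sub>R b" for x b
    using lam_pos[OF that(1)] that(2) by (simp add: pr_def parabolic_lam[OF A])
  have "(\<forall>x\<in>hyp3. pr (A *v x) = a + m * pr x) \<or> (\<forall>x\<in>hyp3. pr (A *v x) = a + m * cnj (pr x))"
    using *(2)
  proof
    assume *: "\<forall>x. prl (A *v x) = lam x *\<^sub>R a + m * prl x"
    have "pr (A *v x) = a + m * pr x" if "x \<in> hyp3" for x
      by (rule key[OF that]) (simp add: * prl_eq[OF that] scaleR_add_right)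
    then show ?thesis by blast
  next
    assume *: "\<forall>x. prl (A *v x) = lam x *\<^sub>R a + m * cnj (prl x)"
    have "pr (A *v x) = a + m * cnj (pr x)" if "x \<in> hyp3" for x
      by (rule key[OF that]) (simp add: * prl_eq[OF that] scaleR_add_right)
    then show ?thesis by blast
  qed
  with * that show ?thesis by blast
qed

lemma hyp3_horo_eqI:
  assumes "x \<in> hyp3" "y \<in> hyp3" "pr x = pr y" "lam x = lam y"
  shows "x = y"
  using assms zz_eq[of x] zz_eq[of y] by (intro hyp3_eqI) auto

end

locale cusp_group = cusp +
  fixes G :: "(real^4^4) set"
  assumes group: "discrete_isometry_group G" and acts: "acts_freely_cocompactly_on_horospheres c G"
begin

lemma G_iso: "g \<in> G \<Longrightarrow> hyp_isometry g" and G_det: "g \<in> G \<Longrightarrow> det g > 0"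
  and G_one: "mat 1 \<in> G" and G_mult: "g \<in> G \<Longrightarrow> h \<in> G \<Longrightarrow> g ** h \<in> G" and G_inv: "g \<in> G \<Longrightarrow> matrix_inv g \<in> G"
  and G_horo: "g \<in> G \<Longrightarrow> preserves_horospheres c g"
  using group acts by (auto simp: discrete_isometry_group_def Iso_plus_def acts_freely_cocompactly_on_horospheres_def)

lemma G_inverse: "g \<in> G \<Longrightarrow> g *v (matrix_inv g *v x) = x" "g \<in> G \<Longrightarrow> matrix_inv g *v (g *v x) = x"
  using G_det[of g] invertible_det_nz[of g] matrix_inv_inverse[of g]
  by (auto simp: matrix_vector_mul_assoc)

text \<open>The translations of the plane that the group induces; glide reflections, if any, are not
  recorded.\<close>

definition \<Lambda> :: "complex set" where "\<Lambda> = {a. \<exists>g\<in>G. \<forall>x\<in>hyp3. pr (g *v x) = pr x + a}"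

lemma \<Lambda>_diff:
  assumes "a \<in> \<Lambda>" "b \<in> \<Lambda>"
  shows "a - b \<in> \<Lambda>"
proof -
  obtain g h where g: "g \<in> G" "\<And>x. x \<in> hyp3 \<Longrightarrow> pr (g *v x) = pr x + a"
    and h: "h \<in> G" "\<And>x. x \<in> hyp3 \<Longrightarrow> pr (h *v x) = pr x + b" using assms by (auto simp: \<Lambda>_def)
  have "pr ((g ** matrix_inv h) *v x) = pr x + (a - b)" if x: "x \<in> hyp3" for x
  proof -
    define y where "y = matrix_inv h *v x"
    have y: "y \<in> hyp3" "h *v y = x" using x isometry_hyp3[OF G_iso[OF G_inv[OF h(1)]]] G_inverse(1)[OF h(1)]
      by (auto simp: y_def)
    have "pr ((g ** matrix_inv h) *v x) = pr (g *v y)" by (simp add: y_def matrix_vector_mul_assoc)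
    then show ?thesis using g(2)[OF y(1)] h(2)[OF y(1)] y(2) by simp
  qed
  then show ?thesis using G_mult[OF g(1) G_inv[OF h(1)]] by (auto simp: \<Lambda>_def)
qed

text \<open>A rotation of the plane has a fixed point, hence fixes a point on each horosphere.\<close>

lemma rotation_trivial:
  assumes g: "g \<in> G" and pr: "\<And>x. x \<in> hyp3 \<Longrightarrow> pr (g *v x) = a + m * pr x"
  shows "m = 1"
proof (rule ccontr)
  assume m: "m \<noteq> 1"
  define p where "p = a / (1 - m)"
  have p: "a + m * p = p" using m by (simp add: p_def field_simps)
  define x where "x = mk 1 (1/2 + (norm p)\<^sup>2 / 2) p"
  have x: "x \<in> hyp3" "lam x = 1" "pr x = p" by (simp_all add: x_def hyp3_iff') (simp add: pr_def)
  have "g *v x = x"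
    using x p isometry_hyp3[OF G_iso[OF g]] parabolic_lam[OF G_iso[OF g] G_horo[OF g]] pr
    by (intro hyp3_horo_eqI) auto
  then have g1: "g = mat 1"
    using acts g x by (auto simp: acts_freely_cocompactly_on_horospheres_def horosphere_iff dest!: spec[of _ 1])
  \<comment> \<open>The identity also fixes the point over \<open>p + 1\<close>, which is
    incompatible with \<open>m \<noteq> 1\<close>.\<close>
  define y where "y = mk 1 (1/2 + (norm (p + 1))\<^sup>2 / 2) (p + 1)"
  have y: "y \<in> hyp3" "pr y = p + 1" by (simp_all add: y_def hyp3_iff') (simp add: pr_def)
  have "p + 1 = a + m * (p + 1)" using pr[OF y(1)] y by (simp add: g1)
  then show False using p m by (simp add: distrib_left add.assoc[symmetric])
qed

lemma cocompact: obtains D where "D > 0" "\<And>p. \<exists>a\<in>\<Lambda>. norm (p - a) \<le> D"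
proof -
  obtain K where K: "compact K" "(\<Union>g\<in>G. (\<lambda>x. g *v x) ` K) = horosphere c 1"
    using acts by (auto simp: acts_freely_cocompactly_on_horospheres_def dest!: spec[of _ 1])
  have Kh: "K \<subseteq> hyp3"
  proof
    fix x assume "x \<in> K"
    then have "mat 1 *v x \<in> (\<Union>g\<in>G. (\<lambda>x. g *v x) ` K)" using G_one by blast
    then show "x \<in> hyp3" using K(2) by (simp add: horosphere_iff)
  qed
  have "compact (pr ` K)" using K(1) Kh continuous_on_pr compact_continuous_image continuous_on_subset by blast
  then obtain D0 where D0: "\<And>x. x \<in> K \<Longrightarrow> norm (pr x) \<le> D0"
    using compact_imp_bounded by (force simp: bounded_iff)
  have cov: "\<exists>g\<in>G. \<exists>x\<in>K. pr (g *v x) = p" for p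
  proof -
    define y where "y = mk 1 (1/2 + (norm p)\<^sup>2 / 2) p"
    have y: "y \<in> horosphere c 1" "pr y = p" by (simp_all add: y_def horosphere_iff hyp3_iff') (simp add: pr_def)
    then show ?thesis using K(2) by force
  qed
  define ori where "ori g = (\<exists>a m. norm m = 1 \<and> (\<forall>x\<in>hyp3. pr (g *v x) = a + m * pr x))" for g :: "real^4^4"
  have ori: "\<exists>a. \<forall>x\<in>hyp3. pr (g *v x) = pr x + a" if g: "g \<in> G" "ori g" for g
  proof -
    obtain a m where am: "\<forall>x\<in>hyp3. pr (g *v x) = a + m * pr x" using g(2) by (auto simp: ori_def)
    then have "m = 1" using rotation_trivial[OF g(1)] by blast
    then show ?thesis using am by (auto simp: add.commute)
  qed
  have rev: "\<exists>a m. norm m = 1 \<and> (\<forall>x\<in>hyp3. pr (g *v x) = a + m * cnj (pr x))" if g: "g \<in> G" "\<not> ori g" for g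
  proof (rule parabolic_pr[OF G_iso[OF g(1)] G_horo[OF g(1)]])
    fix a m assume "norm m = 1"
      "(\<forall>x\<in>hyp3. pr (g *v x) = a + m * pr x) \<or> (\<forall>x\<in>hyp3. pr (g *v x) = a + m * cnj (pr x))"
    then show ?thesis using g(2) unfolding ori_def by blast
  qed
  have "\<exists>D1. \<forall>p. \<exists>a\<in>\<Lambda>. norm (p - a) \<le> D1"
  proof (cases "\<forall>g\<in>G. ori g")
    case True
    show ?thesis
    proof (intro exI[of _ D0] allI)
      fix p obtain g x where gx: "g \<in> G" "x \<in> K" "pr (g *v x) = p" using cov by blast
      obtain a where a: "\<forall>x\<in>hyp3. pr (g *v x) = pr x + a" using ori gx True by blast
      then have "a \<in> \<Lambda>" using gx(1) by (auto simp: \<Lambda>_def)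
      moreover have "p - a = pr x" using a gx Kh by auto
      ultimately show "\<exists>a\<in>\<Lambda>. norm (p - a) \<le> D0"
        using D0[OF gx(2)] by (intro bexI[of _ a]) simp_all
    qed
  next
    case False
    then obtain g0 where g0: "g0 \<in> G" "\<not> ori g0" by blast
    obtain a0 m0 where m0: "norm m0 = 1" "\<And>x. x \<in> hyp3 \<Longrightarrow> pr (g0 *v x) = a0 + m0 * cnj (pr x)" using rev[OF g0] by blast
    show ?thesis
    proof (intro exI[of _ "D0 + norm a0"] allI)
      fix p obtain g x where gx: "g \<in> G" "x \<in> K" "pr (g *v x) = p" using cov by blast
      have xh: "x \<in> hyp3" using gx Kh by auto
      show "\<exists>a\<in>\<Lambda>. norm (p - a) \<le> D0 + norm a0"
      proof (cases "ori g")
        case True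
        then obtain a where a: "\<forall>x\<in>hyp3. pr (g *v x) = pr x + a" using ori gx by blast
        then have "a \<in> \<Lambda>" using gx(1) by (auto simp: \<Lambda>_def)
        moreover have "p - a = pr x" using a gx Kh by auto
        ultimately show ?thesis using D0[OF gx(2)] by (intro bexI[of _ a]) (simp_all add: add_increasing2)
      next
        case False
        then obtain a1 m1 where m1: "norm m1 = 1" "\<And>x. x \<in> hyp3 \<Longrightarrow> pr (g *v x) = a1 + m1 * cnj (pr x)"
          using rev[OF gx(1)] by blast
        have comp: "pr ((g ** g0) *v v) = (a1 + m1 * cnj a0) + (m1 * cnj m0) * pr v" if "v \<in> hyp3" for v
          using m1(2)[OF isometry_hyp3[OF G_iso[OF g0(1)] that]] m0(2)[OF that]
          by (simp add: matrix_vector_mul_assoc[symmetric] algebra_simps)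
        have "m1 * cnj m0 = 1" using rotation_trivial[OF G_mult[OF gx(1) g0(1)] comp] .
        then have tr: "pr ((g ** g0) *v v) = pr v + (a1 + m1 * cnj a0)" if "v \<in> hyp3" for v
          using comp[OF that] by simp
        then have "a1 + m1 * cnj a0 \<in> \<Lambda>" using G_mult[OF gx(1) g0(1)] by (auto simp: \<Lambda>_def)
        moreover have "norm (p - (a1 + m1 * cnj a0)) = norm (pr x - a0)"
        proof -
          have "p - (a1 + m1 * cnj a0) = m1 * cnj (pr x - a0)" using m1(2)[OF xh] gx(3) by (simp add: algebra_simps)
          then show ?thesis using m1(1) by (simp only: norm_mult complex_mod_cnj)
        qed
        moreover have "norm (pr x - a0) \<le> D0 + norm a0" using D0[OF gx(2)] norm_triangle_ineq4[of "pr x" a0] by linarith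
        ultimately show ?thesis by force
      qed
    qed
  qed
  then obtain D1 where D1: "\<And>p. \<exists>a\<in>\<Lambda>. norm (p - a) \<le> D1" by blast
  show ?thesis
  proof (rule that[of "max D1 1"])
    show "\<exists>a\<in>\<Lambda>. norm (p - a) \<le> max D1 1" for p using D1[of p] by (meson max.coboundedI1)
  qed simp
qed

text \<open>Translations within \<open>D\<close> of \<open>3 * D\<close> and
  \<open>3 * D * \<i>\<close> are independent: the main product in \<open>cross2\<close> is at least
  \<open>4 * D * D\<close>, the other at most \<open>D * D\<close>.\<close>

lemma lattice_basis: obtains a1 a2 where "a1 \<in> \<Lambda>" "a2 \<in> \<Lambda>" "cross2 a1 a2 > 0"
proof -
  obtain D where D: "D > 0" "\<And>p. \<exists>a\<in>\<Lambda>. norm (p - a) \<le> D" using cocompact by blast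
  obtain a1 where a1: "a1 \<in> \<Lambda>" "norm (of_real (3 * D) - a1) \<le> D" using D(2) by blast
  obtain a2 where a2: "a2 \<in> \<Lambda>" "norm (of_real (3 * D) * \<i> - a2) \<le> D" using D(2) by blast
  have "\<bar>3 * D - Re a1\<bar> \<le> D" "\<bar>Im a1\<bar> \<le> D" "\<bar>Re a2\<bar> \<le> D" "\<bar>3 * D - Im a2\<bar> \<le> D"
    using abs_Re_le_cmod[of "of_real (3 * D) - a1"] abs_Im_le_cmod[of "of_real (3 * D) - a1"]
      abs_Re_le_cmod[of "of_real (3 * D) * \<i> - a2"] abs_Im_le_cmod[of "of_real (3 * D) * \<i> - a2"] a1 a2 by auto
  then have b: "Re a1 \<ge> 2 * D" "Im a2 \<ge> 2 * D" "\<bar>Im a1\<bar> \<le> D" "\<bar>Re a2\<bar> \<le> D" by linarith+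
  have "(2 * D) * (2 * D) \<le> Re a1 * Im a2" using b D by (intro mult_mono) auto
  moreover have "\<bar>Im a1\<bar> * \<bar>Re a2\<bar> \<le> D * D" using b D by (intro mult_mono) auto
  then have "Im a1 * Re a2 \<le> D * D" by (metis abs_ge_self abs_mult order_trans)
  moreover have "D * D > 0" using D by simp
  ultimately have "cross2 a1 a2 > 0" by (simp add: cross2_def)
  then show ?thesis using that a1 a2 by blast
qed

lemma translation_prl:
  assumes g: "g \<in> G" "\<And>x. x \<in> hyp3 \<Longrightarrow> pr (g *v x) = pr x + a"
  shows "prl (g *v y) = prl y + lam y *\<^sub>R a"
proof (rule hyp3_linear_eq[of "\<lambda>y. prl (g *v y)" "\<lambda>y. prl y + lam y *\<^sub>R a"])
  show "linear (\<lambda>y. prl (g *v y))" "linear (\<lambda>y. prl y + lam y *\<^sub>R a)"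
    by (simp_all add: linear_iff linear_simps matrix_vector_right_distrib matrix_vector_mult_scaleR algebra_simps)
  fix x assume x: "x \<in> hyp3"
  then show "prl (g *v x) = prl x + lam x *\<^sub>R a"
    using g(2)[OF x] prl_eq[OF isometry_hyp3[OF G_iso[OF g(1)] x]] prl_eq[OF x]
      parabolic_lam[OF G_iso[OF g(1)] G_horo[OF g(1)]] by (simp add: scaleR_add_right)
qed

end

section \<open>Supporting planes at the vertices\<close>

context cusp begin

text \<open>The sum of the normals of the faces through \<open>x\<close> is strictly negative on the rest of \<open>Q\<close>: if all of them
  vanished at another point \<open>y\<close>, the geodesic from \<open>y\<close> could be prolonged beyond \<open>x\<close> inside \<open>Q\<close>.\<close>

lemma convex_vertex_support:
  assumes Q: "convex_polyhedron Q" and x: "x \<in> convex_vertices Q"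
  obtains s where "mink s x = 0" "\<And>y. y \<in> Q \<Longrightarrow> y \<noteq> x \<Longrightarrow> mink s y < 0"
proof -
  obtain N where fin: "\<And>K. compact K \<Longrightarrow> K \<subseteq> hyp3 \<Longrightarrow> finite {n\<in>N. \<exists>x\<in>K. mink n x = 0}"
    and QN: "Q = {x\<in>hyp3. \<forall>n\<in>N. mink n x \<le> 0}"
    using Q unfolding convex_polyhedron_def by blast
  have xQ: "x \<in> Q" and ex: "\<And>y z. y \<in> Q \<Longrightarrow> z \<in> Q \<Longrightarrow> x \<notin> hyp_hull {y, z} - {y, z}"
    using x by (auto simp: convex_vertices_def)
  have xh: "x \<in> hyp3" and xN: "\<And>n. n \<in> N \<Longrightarrow> mink n x \<le> 0" using xQ QN by auto
  define act where "act = {n\<in>N. mink n x = 0}"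
  have act: "finite act" using fin[of "{x}"] xh by (simp add: act_def)
  have key: "\<exists>n\<in>act. mink n y \<noteq> 0" if y: "y \<in> Q" "y \<noteq> x" for y
  proof (rule ccontr)
    assume "\<not> ?thesis"
    then have yact: "\<And>n. n \<in> N \<Longrightarrow> mink n x = 0 \<Longrightarrow> mink n y = 0" by (auto simp: act_def)
    have yh: "y \<in> hyp3" using y QN by auto
    define z where "z s = (1 + s) *\<^sub>R x - s *\<^sub>R y" for s
    define \<mu> where "\<mu> = - mink x y"
    have mu: "\<mu> \<ge> 1" using mink_le[OF xh yh] by (simp add: \<mu>_def)
    have xx: "mink x x = - 1" "mink y y = - 1" using xh yh by (auto simp: hyp3_iff)
    have zz: "- mink (z s) (z s) = (1 + s)\<^sup>2 + s\<^sup>2 - 2 * s * (1 + s) * \<mu>" for s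
      by (simp add: z_def mink_simps xx mink_commute[of y x] \<mu>_def power2_eq_square algebra_simps)
    \<comment> \<open>The first bound keeps the prolongation \<open>z s\<close> time-like, the
      second keeps it on the future side.\<close>
    define s0 where "s0 = min (1 / (8 * \<mu>)) (lam x / (2 * lam y))"
    have s0: "s0 > 0" using mu lam_pos[OF xh] lam_pos[OF yh] by (simp add: s0_def)
    have tl: "- mink (z s) (z s) > 0" and lz: "lam (z s) > 0" if s: "0 \<le> s" "s \<le> s0" for s
    proof -
      have s1: "s * \<mu> \<le> 1/8" using s mu by (simp add: s0_def field_simps)
      have s2: "s \<le> 1/8" using s1 mu s(1) mult_left_mono[OF mu s(1)] by simp
      have "2 * s * (1 + s) * \<mu> = 2 * (1 + s) * (s * \<mu>)" by simp
      also have "\<dots> \<le> 2 * (1 + 1/8) * (1/8)" using s s1 s2 mu by (intro mult_mono) auto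
      finally have "2 * s * (1 + s) * \<mu> < 1" by simp
      moreover have "(1 + s)\<^sup>2 + s\<^sup>2 \<ge> 1" using s by (simp add: power2_eq_square algebra_simps)
      ultimately show "- mink (z s) (z s) > 0" unfolding zz by linarith
      have "s * lam y \<le> lam x / 2" using s lam_pos[OF yh] by (simp add: s0_def field_simps)
      moreover have "s * lam x \<ge> 0" using s lam_pos[OF xh] by simp
      ultimately show "lam (z s) > 0" using lam_pos[OF xh] by (simp add: z_def linear_simps algebra_simps)
    qed
    define \<gamma> where "\<gamma> s = (1 / sqrt (- mink (z s) (z s))) *\<^sub>R z s" for s
    have \<gamma>h: "\<gamma> s \<in> hyp3" if s: "0 \<le> s" "s \<le> s0" for s
    proof -
      have "(sqrt (- mink (z s) (z s)))\<^sup>2 = - mink (z s) (z s)" using tl[OF s] by simp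
      then show ?thesis using tl[OF s] lz[OF s]
        by (simp add: hyp3_iff \<gamma>_def mink_simps linear_simps power2_eq_square[symmetric])
    qed
    have contz: "continuous_on S z" for S unfolding z_def by (intro continuous_intros)
    have "continuous_on {0..s0} \<gamma>"
      unfolding \<gamma>_def using tl by (intro continuous_intros contz) force
    then have K: "compact (\<gamma> ` {0..s0})" "\<gamma> ` {0..s0} \<subseteq> hyp3"
      using \<gamma>h by (auto intro: compact_continuous_image)
    \<comment> \<open>Only face planes that meet the prolonging arc can be crossed on it. They are
      finitely many, so those that are negative at \<open>x\<close> stay negative for small
      \<open>s\<close>.\<close>
    define B where "B = {n\<in>N. \<exists>v\<in>\<gamma> ` {0..s0}. mink n v = 0}"
    have B: "finite B" unfolding B_def by (rule fin[OF K])
    have lin: "mink n (z s) = mink n x + s * (mink n x - mink n y)" for n s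
      by (simp add: z_def mink_simps algebra_simps)
    have far: "mink n (z s) \<le> 0" if n: "n \<in> N" "n \<notin> B" "mink n x < 0" and s: "0 \<le> s" "s \<le> s0" for n s
    proof (rule ccontr)
      assume pos: "\<not> ?thesis"
      have "\<exists>t\<ge>0. t \<le> s \<and> mink n (z t) = 0"
        by (rule IVT') (use pos n s in \<open>auto simp: lin intro!: continuous_intros\<close>)
      then obtain t where t: "0 \<le> t" "t \<le> s" "mink n (z t) = 0" by blast
      then have "mink n (\<gamma> t) = 0" by (simp add: \<gamma>_def mink_simps)
      then have "n \<in> B" using n(1) t s by (auto simp: B_def)
      then show False using n by simp
    qed
    have "\<forall>\<^sub>F s in at_right 0. \<forall>n\<in>{n\<in>B. mink n x < 0}. mink n (z s) < 0"
    proof (rule eventually_ball_finite)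
      show "finite {n\<in>B. mink n x < 0}" using B by simp
      show "\<forall>n\<in>{n\<in>B. mink n x < 0}. \<forall>\<^sub>F s in at_right 0. mink n (z s) < 0"
      proof
        fix n assume "n \<in> {n\<in>B. mink n x < 0}"
        then have neg: "mink n x < 0" by simp
        have "((\<lambda>s. mink n (z s)) \<longlongrightarrow> mink n x + 0 * (mink n x - mink n y)) (at_right 0)"
          unfolding lin by (intro tendsto_intros)
        then show "\<forall>\<^sub>F s in at_right 0. mink n (z s) < 0" using neg by (simp add: order_tendstoD(2))
      qed
    qed
    moreover have "\<forall>\<^sub>F s in at_right 0. s \<le> s0" using s0
      by (auto simp: eventually_at_right[of 0 1] intro!: exI[of _ s0])
    moreover have "\<forall>\<^sub>F s in at_right (0::real). s > 0" by (rule eventually_at_right_less)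
    ultimately have "\<forall>\<^sub>F s in at_right 0. s > 0 \<and> s \<le> s0 \<and> (\<forall>n\<in>{n\<in>B. mink n x < 0}. mink n (z s) < 0)"
      by eventually_elim auto
    from eventually_happens'[OF trivial_limit_at_right_real this]
    obtain s where s: "s > 0" "s \<le> s0" "\<And>n. n \<in> B \<Longrightarrow> mink n x < 0 \<Longrightarrow> mink n (z s) < 0" by blast
    have "mink n (z s) \<le> 0" if n: "n \<in> N" for n
    proof (cases "mink n x = 0")
      case True then show ?thesis using yact[OF n] by (simp add: lin)
    next
      case False
      then have "mink n x < 0" using xN[OF n] by simp
      then show ?thesis using s far[OF n, of s] by (cases "n \<in> B") (auto simp: less_imp_le)
    qed
    then have "mink n (\<gamma> s) \<le> 0" if "n \<in> N" for n
      using that tl[of s] s by (simp add: \<gamma>_def mink_simps divide_nonpos_pos)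
    then have \<gamma>Q: "\<gamma> s \<in> Q" using \<gamma>h[of s] s by (simp add: QN)
    define k where "k = sqrt (- mink (z s) (z s))"
    have k: "k > 0" using tl[of s] s by (simp add: k_def)
    have zk: "z s = k *\<^sub>R \<gamma> s" using k by (simp add: \<gamma>_def k_def[symmetric])
    have xe: "x = (k / (1 + s)) *\<^sub>R \<gamma> s + (s / (1 + s)) *\<^sub>R y"
    proof -
      have "(1 + s) *\<^sub>R x = k *\<^sub>R \<gamma> s + s *\<^sub>R y" unfolding zk[symmetric] by (simp add: z_def)
      then have "(1 / (1 + s)) *\<^sub>R ((1 + s) *\<^sub>R x) = (1 / (1 + s)) *\<^sub>R (k *\<^sub>R \<gamma> s + s *\<^sub>R y)" by simp
      then show ?thesis using s(1) by (simp add: scaleR_add_right)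
    qed
    have "x \<in> convex_cone hull {y, \<gamma> s}"
      by (subst xe) (use k s in \<open>intro convex_cone_hull_add convex_cone_hull_mul hull_inc; simp\<close>)
    then have "x \<in> hyp_hull {y, \<gamma> s}" using xh by (simp add: hyp_hull_def)
    moreover have "x \<noteq> \<gamma> s"
    proof
      assume "x = \<gamma> s"
      then have "(1 + s) *\<^sub>R x - s *\<^sub>R y = k *\<^sub>R x" using zk by (simp add: z_def)
      then have "s *\<^sub>R y = (1 + s - k) *\<^sub>R x" by (simp add: algebra_simps)
      then have "pr (s *\<^sub>R y) = pr ((1 + s - k) *\<^sub>R x)" "zz (s *\<^sub>R y) = zz ((1 + s - k) *\<^sub>R x)"
        "lam (s *\<^sub>R y) = lam ((1 + s - k) *\<^sub>R x)" by simp_all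
      moreover have "1 + s - k > 0"
      proof (rule zero_less_mult_pos2)
        have "(1 + s - k) * lam x = s * lam y"
          using \<open>lam (s *\<^sub>R y) = lam ((1 + s - k) *\<^sub>R x)\<close> by (simp only: linear_simps)
        then show "0 < (1 + s - k) * lam x" using s(1) lam_pos[OF yh] by simp
      qed (rule lam_pos[OF xh])
      ultimately have "pr y = pr x" "zz y = zz x" using s(1) by (simp_all add: pr_scale)
      then show False using y(2) hyp3_eqI[OF yh xh] by simp
    qed
    ultimately show False using ex[OF y(1) \<gamma>Q] y(2) by auto
  qed
  show ?thesis
  proof (rule that[of "\<Sum>act"])
    have msum: "mink (\<Sum>act) v = (\<Sum>n\<in>act. mink n v)" for v
      using linear_sum[OF linear_mink(2)[of v], of "\<lambda>n. n" act] by simp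
    show "mink (\<Sum>act) x = 0" unfolding msum by (rule sum.neutral) (simp add: act_def)
    fix y assume y: "y \<in> Q" "y \<noteq> x"
    then obtain n where n: "n \<in> act" "mink n y \<noteq> 0" using key by blast
    have le: "mink n y \<le> 0" if "n \<in> act" for n using y(1) that by (auto simp: QN act_def)
    have "(\<Sum>n\<in>act. mink n y) < (\<Sum>n\<in>act. 0)"
      by (rule sum_strict_mono_ex1) (use act n le in \<open>auto simp: less_le\<close>)
    then show "mink (\<Sum>act) y < 0" by (simp add: msum)
  qed
qed

end

context cusp_surface begin

text \<open>In the chart the supporting plane at the vertex is the zero set of an affine function,
  and \<open>lam s > 0\<close> says that it is the graph of an affine function below the vertices.
  Dividing by \<open>lam s\<close> gives the slope; subtracting \<open>i\<close> passes to
  differences from the paraboloid.\<close>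

lemma planar_support:
  assumes Q: "convex_polyhedron Q" and V: "V = convex_vertices Q" "V \<subseteq> F" and i: "i \<in> pr ` V"
    and a: "a \<noteq> 0" "i + a \<in> pr ` V" "i - a \<in> pr ` V" "rad (i + a) = rad i" "rad (i - a) = rad i"
  shows "\<exists>\<beta>. \<forall>j\<in>pr ` V - {i}. \<beta> \<bullet> (j - i) < rad j - rad i + (norm (j - i))\<^sup>2 / 2"
proof -
  obtain x where x: "x \<in> V" "i = pr x" using i by blast
  obtain s where s: "mink s x = 0" "\<And>y. y \<in> Q \<Longrightarrow> y \<noteq> x \<Longrightarrow> mink s y < 0"
    using convex_vertex_support[OF Q] x V by blast
  define h where "h p = prl s \<bullet> p - lam s * (rad p + (norm p)\<^sup>2 / 2) - del s" for p
  have h: "mink s y = lam y * h (pr y)" if "y \<in> V" for y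
  proof -
    have "y \<in> F" "y \<in> hyp3" using that V F_hyp by auto
    then have z: "zz y = rad (pr y) + (norm (pr y))\<^sup>2 / 2" using \<sigma>(3) by (simp add: rad_def ht_def)
    show ?thesis unfolding mink_expand[of s] prl_eq[OF \<open>y \<in> hyp3\<close>] del_eq[OF \<open>y \<in> hyp3\<close>] h_def z
      by (simp add: algebra_simps)
  qed
  have hx: "h i = 0" using h[OF x(1)] s(1) lam_pos x V F_hyp by (metis less_irrefl mult_eq_0_iff subsetD)
  have hn: "h j < 0" if j: "j \<in> pr ` V" "j \<noteq> i" for j
  proof -
    obtain y where y: "y \<in> V" "j = pr y" using j by blast
    have "y \<in> Q" using y V by (auto simp: convex_vertices_def)
    then have "mink s y < 0" using s(2) y j x by auto
    then have "lam y * h j < 0" using h[OF y(1)] y by simp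
    moreover have "lam y > 0" using y V F_hyp lam_pos by auto
    ultimately show ?thesis by (simp add: mult_less_0_iff)
  qed
  \<comment> \<open>The translates \<open>i + a\<close> and \<open>i - a\<close> of the vertex lie
    strictly on the negative side. As all three have equal \<open>rad\<close>, the second difference
    of \<open>h\<close> is \<open>- lam s * (norm a)\<^sup>2\<close>.\<close>
  have lam_s: "lam s > 0"
  proof -
    have "h (i + a) + h (i - a) = 2 * h i - lam s * (norm a)\<^sup>2"
    proof -
      have "(norm (i + a))\<^sup>2 = (norm i)\<^sup>2 + 2 * (i \<bullet> a) + (norm a)\<^sup>2" "(norm (i - a))\<^sup>2 = (norm i)\<^sup>2 - 2 * (i \<bullet> a) + (norm a)\<^sup>2"
        by (simp_all add: power2_norm_eq_inner inner_add_left inner_add_right inner_diff_left inner_diff_right inner_commute[of a i])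
      then show ?thesis unfolding h_def a by (simp only:) (simp add: inner_add_right inner_diff_right field_simps)
    qed
    moreover have "h (i + a) < 0" "h (i - a) < 0" using hn a by auto
    ultimately have "lam s * (norm a)\<^sup>2 > 0" using hx by linarith
    then show ?thesis using a(1) by (simp add: zero_less_mult_iff)
  qed
  show ?thesis
  proof (intro exI ballI)
    fix j assume j: "j \<in> pr ` V - {i}"
    have n: "(norm j)\<^sup>2 = (norm i)\<^sup>2 + 2 * (i \<bullet> (j - i)) + (norm (j - i))\<^sup>2"
      by (simp add: power2_norm_eq_inner inner_diff_left inner_diff_right inner_commute[of j i])
    then have n': "(norm j)\<^sup>2 / 2 = (norm i)\<^sup>2 / 2 + i \<bullet> (j - i) + (norm (j - i))\<^sup>2 / 2" by simp
    have "h j - h i < 0" using hn[of j] j hx by auto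
    moreover have "h j - h i = prl s \<bullet> (j - i) - lam s * (rad j - rad i + i \<bullet> (j - i) + (norm (j - i))\<^sup>2 / 2)"
      unfolding h_def n' by (simp add: inner_diff_right algebra_simps)
    ultimately have "prl s \<bullet> (j - i) < lam s * (rad j - rad i + i \<bullet> (j - i) + (norm (j - i))\<^sup>2 / 2)" by simp
    then have "prl s \<bullet> (j - i) / lam s < rad j - rad i + i \<bullet> (j - i) + (norm (j - i))\<^sup>2 / 2"
      using lam_s by (simp add: pos_divide_less_eq mult.commute)
    then show "((1 / lam s) *\<^sub>R prl s - i) \<bullet> (j - i) < rad j - rad i + (norm (j - i))\<^sup>2 / 2"
      by (simp add: inner_diff_left)
  qed
qed

end

section \<open>Invariance of the surface under the group\<close>

locale cusp_polyhedron = cusp_surface + cusp_group +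
  assumes P_inv: "\<And>g. g \<in> G \<Longrightarrow> (\<lambda>x. g *v x) ` cone_over c F = cone_over c F"
begin

text \<open>A group element keeps the height over the paraboloid and maps surface points into the
  polyhedron, which lies above the surface.\<close>

lemma rad_le:
  assumes a: "a \<in> \<Lambda>"
  shows "rad (p + a) \<le> rad p"
proof -
  obtain g where g: "g \<in> G" "\<And>x. x \<in> hyp3 \<Longrightarrow> pr (g *v x) = pr x + a" using a by (auto simp: \<Lambda>_def)
  define y where "y = g *v \<sigma> p"
  have "\<sigma> p \<in> cone_over c F" unfolding cone_over_eq using \<sigma> by (simp add: ht_def)
  then have "y \<in> cone_over c F" using P_inv[OF g(1)] by (auto simp: y_def)
  then have y: "y \<in> hyp3" "ht (pr y) \<le> zz y" by (auto simp: cone_over_eq)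
  have pry: "pr y = p + a" using g(2)[OF \<sigma>(4)] \<sigma>(2) by (simp add: y_def)
  have "lam y = lam (\<sigma> p)" unfolding y_def by (rule parabolic_lam[OF G_iso G_horo]) (rule g)+
  then have "zz y = rad p + (norm (pr y))\<^sup>2 / 2" using zz_eq[OF y(1)] rad_eq[OF \<sigma>(1)[of p]] \<sigma>(2) by simp
  then show ?thesis using y(2) by (simp add: rad_def pry)
qed

lemma zero_\<Lambda>: "0 \<in> \<Lambda>"
proof -
  obtain a where "a \<in> \<Lambda>" using lattice_basis by blast
  from \<Lambda>_diff[OF this this] show ?thesis by simp
qed

lemma rad_shift:
  assumes a: "a \<in> \<Lambda>"
  shows "rad (p + a) = rad p" "rad (p - a) = rad p"
proof -
  have "- a \<in> \<Lambda>" using \<Lambda>_diff[OF zero_\<Lambda> a] by simp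
  then have *: "rad p \<le> rad (p + a)" "rad (p - a) \<le> rad p" using rad_le[of "- a" "p + a"] rad_le[of "-a" p] by auto
  then show "rad (p + a) = rad p" using rad_le[OF a, of p] by simp
  show "rad (p - a) = rad p" using rad_le[OF a, of "p - a"] * by simp
qed

lemma rad_bounded: obtains R where "\<And>p. rad p \<le> R"
proof -
  obtain D where D: "D > 0" "\<And>p. \<exists>a\<in>\<Lambda>. norm (p - a) \<le> D" using cocompact by blast
  have "continuous_on UNIV rad" unfolding rad_def by (intro continuous_intros continuous_ht) auto
  then have "compact (rad ` cball 0 D)"
    by (intro compact_continuous_image compact_cball) (rule continuous_on_subset, auto)
  from compact_imp_bounded[OF this] obtain R where R: "\<And>p. p \<in> cball 0 D \<Longrightarrow> norm (rad p) \<le> R"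
    unfolding bounded_iff by blast
  have "rad p \<le> R" for p
  proof -
    obtain a where a: "a \<in> \<Lambda>" "norm (p - a) \<le> D" using D by blast
    then show ?thesis using R[of "p - a"] rad_shift(2)[OF a(1), of p] by auto
  qed
  then show ?thesis using that by blast
qed

text \<open>If \<open>g\<close> moved \<open>x\<close> strictly inside the polyhedron, its inverse
  would take the surface point below the image to a point below \<open>x\<close>, outside the
  polyhedron.\<close>

lemma G_maps_F:
  assumes g: "g \<in> G" and x: "x \<in> F"
  shows "g *v x \<in> F"
proof -
  have P: "h *v v \<in> cone_over c F" if "h \<in> G" "v \<in> F" for h v
  proof -
    have "v \<in> cone_over c F" using that(2) by (simp add: cone_over_eq F_iff)
    then show ?thesis using P_inv[OF that(1)] by blast
  qed
  define y s where "y = g *v x" and "s = \<sigma> (pr y)"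
  define z where "z = matrix_inv g *v s"
  have gz: "g *v z = s" by (simp add: z_def G_inverse[OF g])
  have sF: "s \<in> F" "pr s = pr y" by (simp_all add: s_def \<sigma>)
  have z: "z \<in> hyp3" "ht (pr z) \<le> zz z" using P[OF G_inv[OF g] sF(1)] by (auto simp: cone_over_eq z_def)
  have y: "y \<in> hyp3" "ht (pr y) \<le> zz y" using P[OF g x] by (auto simp: cone_over_eq y_def)
  have xh: "x \<in> hyp3" using x F_hyp by auto
  note glam = parabolic_lam[OF G_iso[OF g] G_horo[OF g]]
  have "pr z = pr x"
  proof (rule parabolic_pr[OF G_iso[OF g] G_horo[OF g]])
    fix a m assume m: "norm m = 1"
      "(\<forall>x\<in>hyp3. pr (g *v x) = a + m * pr x) \<or> (\<forall>x\<in>hyp3. pr (g *v x) = a + m * cnj (pr x))"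
    have "m \<noteq> 0" using m(1) by auto
    moreover have "pr (g *v z) = pr (g *v x)" using gz sF(2) by (simp add: y_def)
    ultimately show ?thesis using m(2) z(1) xh by auto
  qed
  then have "rad (pr x) \<le> 1 / (2 * (lam z)\<^sup>2)" using z zz_eq[OF z(1)] by (simp add: rad_def)
  also have "\<dots> = rad (pr y)" using rad_eq[OF sF(1)] glam[of z] gz sF(2) by simp
  finally have "rad (pr x) \<le> rad (pr y)" .
  moreover have "rad (pr y) \<le> rad (pr x)"
    using y(2) zz_eq[OF y(1)] rad_eq[OF x] glam[of x] by (simp add: rad_def y_def)
  ultimately have "zz y = ht (pr y)"
    using zz_eq[OF y(1)] rad_eq[OF x] glam[of x] by (simp add: rad_def[of "pr y"] y_def[symmetric])
  then show ?thesis using y(1) by (simp add: F_iff y_def)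
qed

lemma G_image_F:
  assumes g: "g \<in> G"
  shows "(\<lambda>x. g *v x) ` F = F"
proof
  show "F \<subseteq> (\<lambda>x. g *v x) ` F"
  proof
    fix x assume "x \<in> F"
    then have "matrix_inv g *v x \<in> F" using G_maps_F[OF G_inv[OF g]] by blast
    then show "x \<in> (\<lambda>x. g *v x) ` F" using G_inverse(1)[OF g, of x] by (metis imageI)
  qed
qed (use G_maps_F[OF g] in blast)

end

section \<open>Killing fields in the chart\<close>

lemma bounded_linear_matrix_apply: "bounded_linear (\<lambda>A :: real^4^4. A *v x)"
  unfolding linear_conv_bounded_linear[symmetric]
  by (simp add: linear_iff matrix_vector_mult_add_rdistrib scaleR_matrix_vector_assoc)

context cusp begin

lemma mink_antisym_of_paths:
  assumes x: "(a has_vector_derivative a') (at 0)" and y: "(b has_vector_derivative b') (at 0)"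
    and const: "\<And>t. mink (a t) (b t) = k"
  shows "mink a' (b 0) + mink (a 0) b' = 0"
proof -
  have "((\<lambda>t. mink (a t) (b t)) has_vector_derivative mink (a 0) b' + mink a' (b 0)) (at 0)"
    by (rule bounded_bilinear.has_vector_derivative[OF bounded_bilinear_mink x y])
  then have "((\<lambda>t::real. k) has_vector_derivative mink (a 0) b' + mink a' (b 0)) (at 0)"
    by (simp add: const)
  moreover have "((\<lambda>t::real. k) has_vector_derivative 0) (at 0)" by simp
  ultimately show ?thesis using vector_derivative_unique_at by fastforce
qed

lemma killing_antisym:
  assumes X: "killing_field X" and x: "x \<in> hyp3" "y \<in> hyp3"
  shows "mink (X x) y + mink x (X y) = 0"
proof -
  obtain \<Phi> where \<Phi>: "\<And>t. hyp_isometry (\<Phi> t)" "\<Phi> 0 = mat 1"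
    "\<And>t x. x \<in> hyp3 \<Longrightarrow> ((\<lambda>s. \<Phi> s *v x) has_vector_derivative X (\<Phi> t *v x)) (at t)"
    using X unfolding killing_field_def by blast
  have "((\<lambda>s. \<Phi> s *v x) has_vector_derivative X x) (at 0)" "((\<lambda>s. \<Phi> s *v y) has_vector_derivative X y) (at 0)"
    using \<Phi>(3)[OF x(1), of 0] \<Phi>(3)[OF x(2), of 0] by (simp_all add: \<Phi>(2))
  from mink_antisym_of_paths[OF this isometry_mink[OF \<Phi>(1)]] show ?thesis by (simp add: \<Phi>(2))
qed

text \<open>A Killing field is not given as a linear map, so agreement on \<open>S\<close> cannot
  simply be extended. Antisymmetry moves the field to the other argument:
  \<open>mink x (X y) = mink x (M y)\<close> is linear in \<open>x\<close> and so passes from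
  \<open>S\<close> to its cone.\<close>

lemma killing_determined:
  assumes X: "killing_field X" and M: "\<And>v y. mink (M v) y + mink v (M y) = 0" "linear M"
    and S: "S \<subseteq> hyp3" "\<And>v. v \<in> S \<Longrightarrow> X v = M v" and x: "x \<in> hyp_hull S"
  shows "X x = M x"
proof -
  have xh: "x \<in> hyp3" "x \<in> convex_cone hull S" using x by (auto simp: hyp_hull_def)
  let ?K = "{x. \<forall>y\<in>hyp3. mink x (X y) = mink x (M y)}"
  have "convex_cone hull S \<subseteq> ?K"
  proof (rule hull_minimal)
    show "convex_cone ?K" by (simp add: convex_cone_iff mink_simps)
    show "S \<subseteq> ?K"
    proof clarify
      fix v y assume v: "v \<in> S" "y \<in> hyp3"
      then have "mink (X v) y + mink v (X y) = 0" using killing_antisym[OF X] S by blast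
      then show "mink v (X y) = mink v (M y)" using M(1)[of v y] S(2)[OF v(1)] by simp
    qed
  qed
  then have K: "mink x (X y) = mink x (M y)" if "y \<in> hyp3" for y using xh that by blast
  show ?thesis
  proof (rule mink_nondegenerate)
    fix y assume y: "y \<in> hyp3"
    show "mink (X x) y = mink (M x) y" using killing_antisym[OF X xh(1) y] M(1)[of x y] K[OF y] by simp
  qed
qed

text \<open>The vertical and the horizontal component of the Pogorelov image of a tangent vector
  \<open>v\<close> at \<open>x\<close>.\<close>

definition stretch_rate where "stretch_rate v x = - lam v / lam x"
definition planar_rate where "planar_rate v x = prl v /\<^sub>R lam x"

text \<open>Tangency determines the \<open>del\<close> components of \<open>A\<close> and
  \<open>B\<close>. Substituted into the hyperbolic edge condition and divided by the two values of
  \<open>lam\<close>, they leave the Euclidean edge condition.\<close>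

lemma strain_planar:
  assumes x: "x \<in> hyp3" "y \<in> hyp3" and A: "mink A x = 0" "mink B y = 0" "mink A y + mink x B = 0"
  shows "(pr y - pr x) \<bullet> (planar_rate B y - planar_rate A x) + (zz y - zz x) * (stretch_rate B y - stretch_rate A x) = 0"
proof -
  define l m p q z z' where "l = lam x" "m = lam y" "p = pr x" "q = pr y" "z = zz x" "z' = zz y"
  note defs = this
  have lm: "l > 0" "m > 0" using x lam_pos by (auto simp: defs)
  define w w' Q Q' h h' where "w = stretch_rate A x" "w' = stretch_rate B y" "Q = planar_rate A x" "Q' = planar_rate B y" "h = del A / l" "h' = del B / m"
  note defs' = this
  have c: "lam x = l" "del x = l * z" "prl x = l *\<^sub>R p" "lam y = m" "del y = m * z'" "prl y = m *\<^sub>R q"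
    using x by (auto simp: defs prl_eq del_eq)
  have d: "lam A = - (l * w)" "prl A = l *\<^sub>R Q" "del A = l * h" "lam B = - (m * w')" "prl B = m *\<^sub>R Q'" "del B = m * h'"
    using lm by (simp_all add: defs' stretch_rate_def planar_rate_def c(1,4))
  have "l * (l * (Q \<bullet> p + w * z - h)) = 0" using A(1) unfolding mink_expand c d by (simp add: algebra_simps)
  then have 1: "h = Q \<bullet> p + w * z" using lm by simp
  have "m * (m * (Q' \<bullet> q + w' * z' - h')) = 0" using A(2) unfolding mink_expand c d by (simp add: algebra_simps)
  then have 2: "h' = Q' \<bullet> q + w' * z'" using lm by simp
  have "l * (m * (Q \<bullet> q + w * z' - h + p \<bullet> Q' + w' * z - h')) = 0"
    using A(3) unfolding mink_expand c d by (simp add: algebra_simps)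
  then have "Q \<bullet> q + w * z' - h + p \<bullet> Q' + w' * z - h' = 0" using lm by simp
  then have "(q - p) \<bullet> (Q' - Q) + (z' - z) * (w' - w) = 0"
    unfolding 1 2 by (simp add: inner_diff_left inner_diff_right inner_commute algebra_simps)
  then show ?thesis by (simp add: defs defs')
qed

text \<open>The Killing fields of \<open>hyp3\<close> that fix the ideal point \<open>c\<close> and so act on the plane by infinitesimal
  similarities.\<close>

definition similarity where
  "similarity \<kappa> \<omega> \<beta> x = mk (- (\<kappa> * lam x)) (\<kappa> * del x + \<beta> \<bullet> prl x) (lam x *\<^sub>R \<beta> + \<omega> *\<^sub>R (\<i> * prl x))"

lemma similarity_antisym: "mink (similarity \<kappa> \<omega> \<beta> x) y + mink x (similarity \<kappa> \<omega> \<beta> y) = 0"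
  unfolding mink_expand similarity_def mk_simps by (simp add: inner_complex_def algebra_simps)

lemma similarity_linear: "linear (similarity \<kappa> \<omega> \<beta>)"
proof (rule linearI)
  show "similarity \<kappa> \<omega> \<beta> (x + y) = similarity \<kappa> \<omega> \<beta> x + similarity \<kappa> \<omega> \<beta> y" for x y
    by (rule ext) (simp_all add: similarity_def linear_simps inner_add_right algebra_simps)
  show "similarity \<kappa> \<omega> \<beta> (k *\<^sub>R x) = k *\<^sub>R similarity \<kappa> \<omega> \<beta> x" for k x
    by (rule ext) (simp_all add: similarity_def linear_simps algebra_simps)
qed

lemma similarity_eqI:
  assumes x: "x \<in> hyp3" and A: "mink A x = 0" "stretch_rate A x = \<kappa>" "planar_rate A x = \<beta> + \<omega> *\<^sub>R (\<i> * pr x)"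
  shows "A = similarity \<kappa> \<omega> \<beta> x"
proof -
  have lx: "lam x > 0" using lam_pos[OF x] .
  have l: "lam A = - (\<kappa> * lam x)" using A(2) lx by (simp add: stretch_rate_def field_simps)
  have p: "prl A = lam x *\<^sub>R \<beta> + \<omega> *\<^sub>R (\<i> * prl x)"
  proof -
    have "prl A = lam x *\<^sub>R planar_rate A x" using lx by (simp add: planar_rate_def)
    then show ?thesis by (simp add: A(3) prl_eq[OF x] algebra_simps)
  qed
  have "lam x * del A = lam x * (\<kappa> * del x + \<beta> \<bullet> prl x)"
    using A(1) unfolding mink_expand l p by (simp add: inner_complex_def algebra_simps)
  then have "del A = \<kappa> * del x + \<beta> \<bullet> prl x" using lx by simp
  then show ?thesis using l p by (intro ext) (simp_all add: similarity_def)
qed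

text \<open>The integral of \<open>exp (s *\<^sub>R \<zeta>)\<close> over \<open>s\<close> from \<open>0\<close> to \<open>t\<close>.\<close>

definition exp_integral :: "complex \<Rightarrow> real \<Rightarrow> complex" where
  "exp_integral \<zeta> t = (if \<zeta> = 0 then of_real t else (exp (t *\<^sub>R \<zeta>) - 1) / \<zeta>)"

lemma exp_integral: "exp_integral \<zeta> 0 = 0" "exp_integral \<zeta> (s + t) = exp (s *\<^sub>R \<zeta>) * exp_integral \<zeta> t + exp_integral \<zeta> s"
  "(exp_integral \<zeta> has_vector_derivative 1) (at 0)"
proof -
  show "exp_integral \<zeta> 0 = 0" by (simp add: exp_integral_def)
  show "exp_integral \<zeta> (s + t) = exp (s *\<^sub>R \<zeta>) * exp_integral \<zeta> t + exp_integral \<zeta> s"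
    by (simp add: exp_integral_def scaleR_add_left exp_add field_simps)
  show "(exp_integral \<zeta> has_vector_derivative 1) (at 0)"
  proof (cases "\<zeta> = 0")
    case True
    then have "exp_integral \<zeta> = of_real" by (simp add: exp_integral_def fun_eq_iff)
    then show ?thesis using has_vector_derivative_of_real[OF DERIV_ident] by simp
  next
    case False
    have "((\<lambda>t. exp (t *\<^sub>R \<zeta>)) has_vector_derivative exp (0 *\<^sub>R \<zeta>) * \<zeta>) (at 0)"
      by (rule exp_scaleR_has_vector_derivative_right)
    then have "((\<lambda>t. (exp (t *\<^sub>R \<zeta>) - 1) * inverse \<zeta>) has_vector_derivative (exp (0 *\<^sub>R \<zeta>) * \<zeta> - 0) * inverse \<zeta>) (at 0)"
      by (intro has_vector_derivative_mult_left has_vector_derivative_diff has_vector_derivative_const)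
    then show ?thesis using False by (simp add: exp_integral_def[abs_def] divide_inverse)
  qed
qed

text \<open>The one-parameter group of \<open>similarity\<close>. In the plane it is multiplication
  by \<open>exp (t * (\<kappa> + \<i> * \<omega>))\<close> followed by translation by
  \<open>B\<close>; the \<open>del\<close> component is the one that preserves
  \<open>mink\<close>.\<close>

definition flow where
  "flow \<kappa> \<omega> \<beta> t x = (let B = exp_integral (Complex \<kappa> \<omega>) t * \<beta>; q = exp (t *\<^sub>R (\<i> * of_real \<omega>)) * prl x in
     mk (exp (- (t * \<kappa>)) * lam x)
        (exp (t * \<kappa>) * del x + q \<bullet> B + exp (- (t * \<kappa>)) * (norm B)\<^sup>2 / 2 * lam x)
        (q + (exp (- (t * \<kappa>)) * lam x) *\<^sub>R B))"

lemma flow_coords: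
  "lam (flow \<kappa> \<omega> \<beta> t x) = exp (- (t * \<kappa>)) * lam x"
  "prl (flow \<kappa> \<omega> \<beta> t x) = exp (t *\<^sub>R (\<i> * of_real \<omega>)) * prl x
     + of_real (exp (- (t * \<kappa>))) * of_real (lam x) * (exp_integral (Complex \<kappa> \<omega>) t * \<beta>)"
  unfolding flow_def Let_def mk_simps scaleR_conv_of_real[of "exp (- (t * \<kappa>)) * lam x"] of_real_mult
  by (rule refl)+

lemma flow_linear: "linear (flow \<kappa> \<omega> \<beta> t)"
proof (rule linearI)
  show "flow \<kappa> \<omega> \<beta> t (x + y) = flow \<kappa> \<omega> \<beta> t x + flow \<kappa> \<omega> \<beta> t y" for x y
    by (rule ext) (simp_all add: flow_def Let_def linear_simps inner_add_left algebra_simps)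
  show "flow \<kappa> \<omega> \<beta> t (k *\<^sub>R x) = k *\<^sub>R flow \<kappa> \<omega> \<beta> t x" for k x
    by (rule ext) (simp_all add: flow_def Let_def linear_simps algebra_simps)
qed

lemma norm_exp_i: "norm (exp (t *\<^sub>R (\<i> * of_real \<omega>))) = 1"
proof -
  have "t *\<^sub>R (\<i> * of_real \<omega>) = \<i> * of_real (t * \<omega>)" by (simp add: complex_eq_iff)
  then show ?thesis by (simp only: norm_exp_i_times)
qed

lemma unit_mult_inner: "norm e = 1 \<Longrightarrow> (e * p) \<bullet> (e * q) = p \<bullet> q" for e p q :: complex
proof -
  assume "norm e = 1"
  then have "(Re e)\<^sup>2 + (Im e)\<^sup>2 = 1" by (metis cmod_power2 one_power2)
  then show ?thesis by (simp add: inner_complex_def) algebra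
qed

lemma flow_mink: "mink (flow \<kappa> \<omega> \<beta> t x) (flow \<kappa> \<omega> \<beta> t y) = mink x y"
proof -
  define B where "B = exp_integral (Complex \<kappa> \<omega>) t * \<beta>"
  define e where "e = exp (t *\<^sub>R (\<i> * of_real \<omega>))"
  define k K where "k = exp (- (t * \<kappa>))" and "K = exp (t * \<kappa>)"
  have kK: "k * K = 1" by (simp add: k_def K_def exp_add[symmetric])
  have e: "(e * prl x) \<bullet> (e * prl y) = prl x \<bullet> prl y" by (rule unit_mult_inner) (simp add: e_def norm_exp_i)
  define X Y where "X = e * prl x" and "Y = e * prl y"
  have f: "flow \<kappa> \<omega> \<beta> t x = mk (k * lam x) (K * del x + X \<bullet> B + k * (B \<bullet> B) / 2 * lam x) (X + (k * lam x) *\<^sub>R B)"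
    "flow \<kappa> \<omega> \<beta> t y = mk (k * lam y) (K * del y + Y \<bullet> B + k * (B \<bullet> B) / 2 * lam y) (Y + (k * lam y) *\<^sub>R B)"
    by (simp_all add: flow_def Let_def B_def e_def k_def K_def X_def Y_def power2_norm_eq_inner)
  have "mink (flow \<kappa> \<omega> \<beta> t x) (flow \<kappa> \<omega> \<beta> t y) = X \<bullet> Y - (k * K) * (lam x * del y) - (k * K) * (del x * lam y)"
    unfolding mink_expand f mk_simps
    by (simp add: inner_add_left inner_add_right inner_commute[of B X] inner_commute[of B Y] algebra_simps)
  then show ?thesis using e by (simp add: kK mink_expand X_def Y_def)
qed

lemma flow_hyp3: "x \<in> hyp3 \<Longrightarrow> flow \<kappa> \<omega> \<beta> t x \<in> hyp3"
  by (simp add: hyp3_iff flow_mink) (simp add: flow_def Let_def)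

lemma flow_0: "flow \<kappa> \<omega> \<beta> 0 x = x"
  by (rule ext) (simp_all add: flow_def Let_def exp_integral)

text \<open>On \<open>hyp3\<close> it suffices to compare \<open>lam\<close> and the planar
  coordinate, where the claim is the cocycle identity of \<open>exp_integral\<close>. Linearity
  extends it to all vectors.\<close>

lemma flow_add: "flow \<kappa> \<omega> \<beta> (s + t) x = flow \<kappa> \<omega> \<beta> s (flow \<kappa> \<omega> \<beta> t x)"
proof (rule hyp3_linear_eq[of "flow \<kappa> \<omega> \<beta> (s + t)" "\<lambda>x. flow \<kappa> \<omega> \<beta> s (flow \<kappa> \<omega> \<beta> t x)"])
  show "linear (flow \<kappa> \<omega> \<beta> (s + t))" by (rule flow_linear)
  show "linear (\<lambda>x. flow \<kappa> \<omega> \<beta> s (flow \<kappa> \<omega> \<beta> t x))"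
    using linear_compose[OF flow_linear flow_linear] by (simp add: o_def)
  fix x assume x: "x \<in> hyp3"
  show "flow \<kappa> \<omega> \<beta> (s + t) x = flow \<kappa> \<omega> \<beta> s (flow \<kappa> \<omega> \<beta> t x)"
  proof (rule hyp3_horo_eqI)
    show l: "lam (flow \<kappa> \<omega> \<beta> (s + t) x) = lam (flow \<kappa> \<omega> \<beta> s (flow \<kappa> \<omega> \<beta> t x))"
      by (simp add: flow_def Let_def exp_add[symmetric] algebra_simps)
    have z: "exp (s *\<^sub>R Complex \<kappa> \<omega>) = of_real (exp (s * \<kappa>)) * exp (s *\<^sub>R (\<i> * of_real \<omega>))"
    proof -
      have "s *\<^sub>R Complex \<kappa> \<omega> = of_real (s * \<kappa>) + s *\<^sub>R (\<i> * of_real \<omega>)" by (simp add: complex_eq_iff)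
      then show ?thesis by (simp only: exp_add exp_of_real)
    qed
    define es et ks kt Ks lx px Es Et where "es = exp (s *\<^sub>R (\<i> * of_real \<omega>))" "et = exp (t *\<^sub>R (\<i> * of_real \<omega>))"
      "ks = complex_of_real (exp (- (s * \<kappa>)))" "kt = complex_of_real (exp (- (t * \<kappa>)))" "Ks = complex_of_real (exp (s * \<kappa>))"
      "lx = complex_of_real (lam x)" "px = prl x" "Es = exp_integral (Complex \<kappa> \<omega>) s" "Et = exp_integral (Complex \<kappa> \<omega>) t"
    note defs = this
    have kK: "ks * Ks = 1" by (simp add: defs of_real_mult[symmetric] exp_add[symmetric])
    have est: "exp ((s + t) *\<^sub>R (\<i> * of_real \<omega>)) = es * et"
      by (simp add: defs scaleR_add_left exp_add)
    have kst: "complex_of_real (exp (- ((s + t) * \<kappa>))) = ks * kt"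
      by (simp add: defs of_real_mult[symmetric] exp_add[symmetric] distrib_right)
    have "prl (flow \<kappa> \<omega> \<beta> (s + t) x) = es * et * px + ks * kt * lx * ((Ks * es * Et + Es) * \<beta>)"
      unfolding flow_coords exp_integral(2) z est kst by (simp only: defs)
    also have "\<dots> = es * (et * px + kt * lx * (Et * \<beta>)) + ks * (kt * lx) * (Es * \<beta>)"
      using kK by algebra
    also have "\<dots> = prl (flow \<kappa> \<omega> \<beta> s (flow \<kappa> \<omega> \<beta> t x))"
      unfolding flow_coords of_real_mult by (simp only: defs)
    finally show "pr (flow \<kappa> \<omega> \<beta> (s + t) x) = pr (flow \<kappa> \<omega> \<beta> s (flow \<kappa> \<omega> \<beta> t x))"
      using l by (simp add: pr_def)
  qed (use flow_hyp3 x in auto)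
qed

lemma flow_derivative:
  "((\<lambda>t. flow \<kappa> \<omega> \<beta> t x) has_vector_derivative similarity \<kappa> \<omega> \<beta> x) (at 0)"
proof -
  define \<zeta> where "\<zeta> = Complex \<kappa> \<omega>"
  define q B l where "q t = exp (t *\<^sub>R (\<i> * of_real \<omega>)) * prl x" and "B t = exp_integral \<zeta> t * \<beta>" and "l t = exp (- (t * \<kappa>)) * lam x" for t
  have q: "(q has_vector_derivative \<omega> *\<^sub>R (\<i> * prl x)) (at 0)"
  proof -
    have "(q has_vector_derivative (exp (0 *\<^sub>R (\<i> * of_real \<omega>)) * (\<i> * of_real \<omega>)) * prl x) (at 0)"
      unfolding q_def by (intro has_vector_derivative_mult_left exp_scaleR_has_vector_derivative_right)
    then show ?thesis by (simp add: scaleR_conv_of_real mult_ac)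
  qed
  have B: "(B has_vector_derivative \<beta>) (at 0)"
    using has_vector_derivative_mult_left[OF exp_integral(3)[of \<zeta>], of \<beta>] by (simp add: B_def[abs_def])
  have l: "(l has_vector_derivative - (\<kappa> * lam x)) (at 0)"
    unfolding l_def has_real_derivative_iff_has_vector_derivative[symmetric]
    by (auto intro!: derivative_eq_intros)
  have K: "((\<lambda>t. exp (t * \<kappa>) * del x) has_vector_derivative \<kappa> * del x) (at 0)"
    unfolding has_real_derivative_iff_has_vector_derivative[symmetric]
    by (auto intro!: derivative_eq_intros)
  have at0: "B 0 = 0" "q 0 = prl x" "l 0 = lam x" by (simp_all add: B_def q_def l_def exp_integral)
  have qB: "((\<lambda>t. q t \<bullet> B t) has_vector_derivative prl x \<bullet> \<beta>) (at 0)"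
    using bounded_bilinear.has_vector_derivative[OF bounded_bilinear_inner q B] by (simp add: at0)
  have BB: "((\<lambda>t. (B t \<bullet> B t) * (l t / 2)) has_vector_derivative 0) (at 0)"
  proof -
    have b: "((\<lambda>t. B t \<bullet> B t) has_vector_derivative 0) (at 0)"
      using bounded_bilinear.has_vector_derivative[OF bounded_bilinear_inner B B] by (simp add: at0)
    have l2: "((\<lambda>t. l t / 2) has_vector_derivative - (\<kappa> * lam x) / 2) (at 0)"
      using has_vector_derivative_mult_left[OF l, of "1/2"] by simp
    show ?thesis using has_vector_derivative_mult[OF b l2] by (simp add: at0)
  qed
  have lB: "((\<lambda>t. l t *\<^sub>R B t) has_vector_derivative lam x *\<^sub>R \<beta>) (at 0)"
    using bounded_bilinear.has_vector_derivative[OF bounded_bilinear_scaleR l B] by (simp add: at0)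
  have f: "flow \<kappa> \<omega> \<beta> t x = l t *\<^sub>R d + (exp (t * \<kappa>) * del x + q t \<bullet> B t + (B t \<bullet> B t) * (l t / 2)) *\<^sub>R c
      + (Re (q t + l t *\<^sub>R B t)) *\<^sub>R e1 + (Im (q t + l t *\<^sub>R B t)) *\<^sub>R e2" for t
    by (simp add: flow_def Let_def mk_def q_def B_def l_def \<zeta>_def power2_norm_eq_inner mult_ac)
  have re: "((\<lambda>t. Re (g t)) has_vector_derivative Re g') (at 0)" and im: "((\<lambda>t. Im (g t)) has_vector_derivative Im g') (at 0)"
    if "(g has_vector_derivative g') (at 0)" for g g'
    using bounded_linear.has_vector_derivative[OF bounded_linear_Re that]
      bounded_linear.has_vector_derivative[OF bounded_linear_Im that] by auto
  have sc: "((\<lambda>t. g t *\<^sub>R v) has_vector_derivative g' *\<^sub>R v) (at 0)" if "(g has_vector_derivative g') (at 0)"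
    for g :: "real \<Rightarrow> real" and g' and v :: "real^4"
    using bounded_linear.has_vector_derivative[OF bounded_linear_scaleR_left that] .
  have "((\<lambda>t. flow \<kappa> \<omega> \<beta> t x) has_vector_derivative
      (- (\<kappa> * lam x)) *\<^sub>R d + (\<kappa> * del x + prl x \<bullet> \<beta> + 0) *\<^sub>R c
      + (Re (\<omega> *\<^sub>R (\<i> * prl x) + lam x *\<^sub>R \<beta>)) *\<^sub>R e1 + (Im (\<omega> *\<^sub>R (\<i> * prl x) + lam x *\<^sub>R \<beta>)) *\<^sub>R e2) (at 0)"
    unfolding f by (intro has_vector_derivative_add sc re im l K qB BB q lB)
  then show ?thesis by (simp add: similarity_def mk_def inner_commute add.commute)
qed

lemma similarity_killing: "killing_field (similarity \<kappa> \<omega> \<beta>)"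
proof -
  let ?F = "flow \<kappa> \<omega> \<beta>"
  define \<Phi> where "\<Phi> t = matrix (?F t)" for t
  have \<Phi>: "\<Phi> t *v x = ?F t x" for t x
    unfolding \<Phi>_def using flow_linear by (intro matrix_works) (simp add: linear_matrix_vector_mul_eq)
  show ?thesis unfolding killing_field_def
  proof (intro exI[of _ \<Phi>] conjI allI ballI)
    fix t
    show "hyp_isometry (\<Phi> t)" unfolding hyp_isometry_def hyp_dist_def \<Phi> flow_mink
    proof (intro conjI ballI refl)
      show "(\<lambda>x. ?F t x) ` hyp3 = hyp3"
      proof
        show "?F t ` hyp3 \<subseteq> hyp3" using flow_hyp3 by blast
        show "hyp3 \<subseteq> ?F t ` hyp3"
        proof
          fix x assume x: "x \<in> hyp3"
          have "x = ?F t (?F (- t) x)" by (simp add: flow_add[symmetric] flow_0)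
          then show "x \<in> ?F t ` hyp3" using flow_hyp3[OF x] by blast
        qed
      qed
    qed
    show "\<Phi> 0 = mat 1" by (simp add: matrix_eq \<Phi> flow_0)
    show "\<Phi> (s + t) = \<Phi> s ** \<Phi> t" for s by (simp add: matrix_eq \<Phi> flow_add matrix_vector_mul_assoc[symmetric])
    fix x
    \<comment> \<open>The group law restarts the flow at time \<open>t\<close>, so the derivative at
      time 0 suffices.\<close>
    have "((\<lambda>s. ?F (s - t) (?F t x)) has_vector_derivative 1 *\<^sub>R similarity \<kappa> \<omega> \<beta> (?F t x)) (at t)"
    proof (rule vector_diff_chain_at[unfolded o_def])
      show "((\<lambda>s. s - t) has_vector_derivative 1) (at t)"
        by (auto intro!: derivative_eq_intros simp: has_real_derivative_iff_has_vector_derivative[symmetric])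
      show "((\<lambda>s. ?F s (?F t x)) has_vector_derivative similarity \<kappa> \<omega> \<beta> (?F t x)) (at (t - t))"
        using flow_derivative by simp
    qed
    then show "((\<lambda>s. \<Phi> s *v x) has_vector_derivative similarity \<kappa> \<omega> \<beta> (\<Phi> t *v x)) (at t)"
      by (simp add: \<Phi> flow_add[symmetric])
  qed
qed

end

context cusp_group begin

text \<open>Differentiating the invariance of \<open>mink\<close> and \<open>lam\<close> along the
  path shows that \<open>A\<close> is antisymmetric and has no \<open>lam\<close> component, hence
  annihilates \<open>c\<close>. So it acts on the plane as an infinitesimal isometry.\<close>

lemma parabolic_killing_planar:
  assumes X: "parabolic_killing_field c g X" and g: "g \<in> G"
  obtains b \<omega> where "\<And>x. x \<in> hyp3 \<Longrightarrow> lam (X x) = 0"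
    "\<And>x. x \<in> hyp3 \<Longrightarrow> prl (X x) = lam x *\<^sub>R b + \<omega> *\<^sub>R (\<i> * prl x)"
proof -
  obtain \<gamma> where \<gamma>: "smooth_path \<gamma>" "\<gamma> 0 = g" "\<And>t. hyp_isometry (\<gamma> t)" "\<And>t. preserves_horospheres c (\<gamma> t)"
    "\<And>x. x \<in> hyp3 \<Longrightarrow> X x = matrix_inv g *v vector_derivative (\<lambda>t. \<gamma> t *v x) (at 0)"
    using X unfolding parabolic_killing_field_def by blast
  obtain Dm where "(\<gamma> has_vector_derivative Dm) (at 0)" using \<gamma>(1) unfolding smooth_path_def by metis
  then have D: "((\<lambda>t. \<gamma> t *v x) has_vector_derivative Dm *v x) (at 0)" for x
    using bounded_linear.has_vector_derivative[OF bounded_linear_matrix_apply] by blast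
  define A where "A x = matrix_inv g *v (Dm *v x)" for x
  have XA: "X x = A x" if "x \<in> hyp3" for x
    using \<gamma>(5)[OF that] vector_derivative_at[OF D] by (simp add: A_def)
  have gA: "g *v A x = Dm *v x" for x by (simp add: A_def G_inverse[OF g])
  have giso: "mink (g *v x) (g *v y) = mink x y" for x y by (rule isometry_mink[OF G_iso[OF g]])
  have anti: "mink (A x) y + mink x (A y) = 0" for x y
  proof -
    have "mink (Dm *v x) (g *v y) + mink (g *v x) (Dm *v y) = 0"
      using mink_antisym_of_paths[OF D[of x] D[of y] isometry_mink[OF \<gamma>(3)]] by (simp add: \<gamma>(2))
    then show ?thesis unfolding gA[symmetric] giso .
  qed
  have lamA: "lam (A x) = 0" for x
  proof -
    have "mink (Dm *v x) c + mink (\<gamma> 0 *v x) 0 = 0"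
      using parabolic_lam[OF \<gamma>(3,4), of _ x]
      by (intro mink_antisym_of_paths[OF D[of x], where k="mink x c", of "\<lambda>_. c", simplified]) (simp_all add: lam_def)
    then have "mink (g *v A x) c = 0" by (simp add: gA mink_simps)
    then show ?thesis using parabolic_lam[OF G_iso[OF g] G_horo[OF g], of "A x"] by (simp add: lam_def)
  qed
  have linA: "linear A" unfolding A_def
    by (simp add: linear_iff matrix_vector_right_distrib matrix_vector_mult_scaleR)
  have Ac: "A c = 0"
  proof (rule mink_nondegenerate)
    fix y show "mink (A c) y = mink 0 y" using anti[of c y] lamA[of y] by (simp add: lam_def mink_commute[of c] mink_simps)
  qed
  define b \<omega> where "b = prl (A d)" and "\<omega> = mink (A e1) e2"
  have "mink (A e1) e1 = 0" "mink (A e2) e2 = 0" "mink (A e2) e1 = - \<omega>"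
    using anti[of e1 e1] anti[of e2 e2] anti[of e1 e2] by (simp_all add: mink_commute \<omega>_def)
  then have pe: "prl (A e1) = \<omega> *\<^sub>R \<i>" "prl (A e2) = - (of_real \<omega>)"
    by (simp_all add: prl_def complex_eq_iff \<omega>_def)
  have "prl (A x) = lam x *\<^sub>R b + \<omega> *\<^sub>R (\<i> * prl x)" for x
  proof -
    have "A x = A (mk (lam x) (del x) (prl x))" by (simp add: mk_eta)
    also have "\<dots> = lam x *\<^sub>R A d + del x *\<^sub>R A c + Re (prl x) *\<^sub>R A e1 + Im (prl x) *\<^sub>R A e2"
      by (simp add: mk_def linear_add[OF linA] linear_scale[OF linA])
    finally show ?thesis by (simp add: linear_simps Ac pe b_def complex_eq_iff)
  qed
  then show ?thesis using that[of b \<omega>] XA lamA by simp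
qed

end

section \<open>Parabolic deformations\<close>

locale cusp_deformation = cusp_triangulation + cusp_polyhedron +
  fixes Q :: "(real^4) set" and Z :: "real^4 \<Rightarrow> real^4"
  assumes Q: "convex_polyhedron Q" "\<Union>T = convex_vertices Q"
    and V_inv: "\<And>g x. g \<in> G \<Longrightarrow> x \<in> \<Union>T \<Longrightarrow> g *v x \<in> \<Union>T"
    and Z_killing: "\<And>t. t \<in> T \<Longrightarrow> \<exists>X. killing_field X \<and> (\<forall>x\<in>hyp_hull t. Z x = X x)"
    and Z_parabolic: "\<And>g. g \<in> G \<Longrightarrow> \<exists>X. parabolic_killing_field c g X \<and> (\<forall>i\<in>\<Union>T. Z (g *v i) = g *v (Z i + X i))"
begin

abbreviation VT where "VT \<equiv> \<Union>T"

lemma VT_F: "VT \<subseteq> F" using T_F by blast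

lemma VT_hyp: "x \<in> VT \<Longrightarrow> x \<in> hyp3" using VT_F F_hyp by blast

definition stretch where "stretch p = stretch_rate (Z (\<sigma> p)) (\<sigma> p)"
text \<open>The derivative of the planar position by the quotient rule, since \<open>pr\<close> is
  \<open>prl\<close> divided by \<open>lam\<close>. With \<open>stretch\<close> it plays the role of
  \<open>u\<close> and \<open>w\<close> in \<open>periodic_framework\<close>.\<close>

definition velocity where "velocity p = planar_rate (Z (\<sigma> p)) (\<sigma> p) + stretch p *\<^sub>R p"

lemma Z_tangent: assumes "x \<in> VT" shows "mink (Z x) x = 0"
proof -
  obtain t where t: "t \<in> T" "x \<in> t" using assms by blast
  obtain X where X: "killing_field X" "\<forall>x\<in>hyp_hull t. Z x = X x" using Z_killing[OF t(1)] by blast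
  have "x \<in> hyp_hull t" using t T_hyp hyp_hull_inc by blast
  then show ?thesis using killing_antisym[OF X(1) VT_hyp[OF assms] VT_hyp[OF assms]] X(2) by (simp add: mink_commute)
qed

lemma Z_edge: assumes "t \<in> T" "x \<in> t" "y \<in> t" shows "mink (Z x) y + mink x (Z y) = 0"
proof -
  obtain X where X: "killing_field X" "\<forall>x\<in>hyp_hull t. Z x = X x" using Z_killing[OF assms(1)] by blast
  have "x \<in> hyp_hull t" "y \<in> hyp_hull t" "x \<in> hyp3" "y \<in> hyp3" using assms T_hyp hyp_hull_inc by blast+
  then show ?thesis using killing_antisym[OF X(1), of x y] X(2) by simp
qed

text \<open>The parabolic field has no \<open>lam\<close> component and leaves
  \<open>stretch\<close> unchanged; to the planar velocity it adds a translation and a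
  rotation.\<close>

lemma translation_step:
  assumes a: "a \<in> \<Lambda>"
  obtains b \<omega> where "\<And>p. p \<in> pr ` VT \<Longrightarrow> p + a \<in> pr ` VT" "\<And>p. p \<in> pr ` VT \<Longrightarrow> stretch (p + a) = stretch p"
    "\<And>p. p \<in> pr ` VT \<Longrightarrow> velocity (p + a) = velocity p + b + \<omega> *\<^sub>R (\<i> * p)"
proof -
  obtain g where g: "g \<in> G" "\<And>x. x \<in> hyp3 \<Longrightarrow> pr (g *v x) = pr x + a" using a by (auto simp: \<Lambda>_def)
  obtain X where X: "parabolic_killing_field c g X" "\<And>i. i \<in> VT \<Longrightarrow> Z (g *v i) = g *v (Z i + X i)"
    using Z_parabolic[OF g(1)] by blast
  obtain b \<omega> where b: "\<And>x. x \<in> hyp3 \<Longrightarrow> lam (X x) = 0"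
    "\<And>x. x \<in> hyp3 \<Longrightarrow> prl (X x) = lam x *\<^sub>R b + \<omega> *\<^sub>R (\<i> * prl x)"
    using parabolic_killing_planar[OF X(1) g(1)] by blast
  have glam: "lam (g *v y) = lam y" for y by (rule parabolic_lam[OF G_iso[OF g(1)] G_horo[OF g(1)]])
  have main: "p + a \<in> pr ` VT \<and> stretch (p + a) = stretch p \<and> velocity (p + a) = velocity p + b + \<omega> *\<^sub>R (\<i> * p)" if p: "p \<in> pr ` VT" for p
  proof -
    obtain x where x: "x \<in> VT" "p = pr x" using p by blast
    have xF: "x \<in> F" and xh: "x \<in> hyp3" using x VT_F VT_hyp by auto
    have gx: "g *v x \<in> VT" using V_inv g x by blast
    have prg: "pr (g *v x) = p + a" using g(2)[OF xh] x by simp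
    have s: "\<sigma> p = x" "\<sigma> (p + a) = g *v x" using \<sigma>(3)[OF xF] \<sigma>(3)[of "g *v x"] gx VT_F prg x by auto
    have lx: "lam x > 0" using lam_pos[OF xh] .
    define Y where "Y = Z x + X x"
    have Zg: "Z (g *v x) = g *v Y" using X(2)[OF x(1)] by (simp add: Y_def)
    have lY: "lam Y = lam (Z x)" using b(1)[OF xh] by (simp add: Y_def linear_simps)
    have w: "stretch (p + a) = stretch p" by (simp add: stretch_def s stretch_rate_def Zg glam lY)
    have "prl (g *v Y) = prl (Z x) + (lam x *\<^sub>R b + \<omega> *\<^sub>R (\<i> * prl x)) + lam (Z x) *\<^sub>R a"
      using translation_prl[OF g, of Y] b(2)[OF xh] by (simp add: lY) (simp add: Y_def linear_simps)
    also have "lam (Z x) = - (lam x * stretch p)" using lx by (simp add: stretch_def s stretch_rate_def)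
    also have "prl x = lam x *\<^sub>R p" using prl_eq[OF xh] x by simp
    also have "prl (Z x) = lam x *\<^sub>R planar_rate (Z x) x" using lx by (simp add: planar_rate_def)
    also have "lam x *\<^sub>R planar_rate (Z x) x + (lam x *\<^sub>R b + \<omega> *\<^sub>R (\<i> * lam x *\<^sub>R p)) + - (lam x * stretch p) *\<^sub>R a
      = lam x *\<^sub>R (planar_rate (Z x) x + b + \<omega> *\<^sub>R (\<i> * p) - stretch p *\<^sub>R a)"
      by (simp add: algebra_simps)
    finally have "planar_rate (Z (g *v x)) (g *v x) = planar_rate (Z x) x + b + \<omega> *\<^sub>R (\<i> * p) - stretch p *\<^sub>R a"
      using lx by (simp add: planar_rate_def glam Zg)
    then have "velocity (p + a) = velocity p + b + \<omega> *\<^sub>R (\<i> * p)"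
      by (simp add: velocity_def s w scaleR_add_right)
    then show ?thesis using w gx prg by (metis imageI)
  qed
  show ?thesis by (rule that[of b \<omega>]) (use main in auto)
qed

text \<open>The rotational part of the parabolic field of a translation vanishes, because translations commute
  and there are two independent ones.\<close>

lemma velocity_shift:
  assumes a: "a \<in> \<Lambda>"
  obtains b where "\<And>p. p \<in> pr ` VT \<Longrightarrow> velocity (p + a) = velocity p + b"
proof (cases "a = 0")
  case True
  then show ?thesis using that[of 0] by simp
next
  case False
  obtain a1 a2 where a12: "a1 \<in> \<Lambda>" "a2 \<in> \<Lambda>" "cross2 a1 a2 > 0" using lattice_basis by blast
  have "\<exists>a'\<in>\<Lambda>. cross2 a a' \<noteq> 0"
  proof (rule ccontr)
    assume "\<not> ?thesis"
    then have 0: "cross2 a a1 = 0" "cross2 a a2 = 0" using a12 by auto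
    have "cross2 a1 a2 *\<^sub>R a = cross2 a a2 *\<^sub>R a1 - cross2 a a1 *\<^sub>R a2"
      by (simp add: cross2_def complex_eq_iff algebra_simps)
    then show False using 0 a12(3) False by simp
  qed
  then obtain a' where a': "a' \<in> \<Lambda>" "cross2 a a' \<noteq> 0" by blast
  obtain b \<omega> where b: "\<And>p. p \<in> pr ` VT \<Longrightarrow> p + a \<in> pr ` VT"
      "\<And>p. p \<in> pr ` VT \<Longrightarrow> stretch (p + a) = stretch p"
      "\<And>p. p \<in> pr ` VT \<Longrightarrow> velocity (p + a) = velocity p + b + \<omega> *\<^sub>R (\<i> * p)"
    using translation_step[OF a] by metis
  obtain b' \<omega>' where b': "\<And>p. p \<in> pr ` VT \<Longrightarrow> p + a' \<in> pr ` VT"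
      "\<And>p. p \<in> pr ` VT \<Longrightarrow> stretch (p + a') = stretch p"
      "\<And>p. p \<in> pr ` VT \<Longrightarrow> velocity (p + a') = velocity p + b' + \<omega>' *\<^sub>R (\<i> * p)"
    using translation_step[OF a'(1)] by metis
  have "F \<noteq> {}" using \<sigma>(1) by blast
  then obtain t where t: "t \<in> T" using T_cover by blast
  then have "t \<noteq> {}" using T_card[OF t] by auto
  then obtain p where p: "p \<in> pr ` VT" using t by blast
  \<comment> \<open>Comparing both orders of translation leaves
    \<open>\<omega>' *\<^sub>R a = \<omega> *\<^sub>R a'\<close>, with \<open>a\<close> and
    \<open>a'\<close> independent.\<close>
  have "velocity (p + a + a') = velocity p + b + \<omega> *\<^sub>R (\<i> * p) + b' + \<omega>' *\<^sub>R (\<i> * (p + a))" using b'(3)[OF b(1)[OF p]] b(3)[OF p] by simp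
  moreover have "velocity (p + a' + a) = velocity p + b' + \<omega>' *\<^sub>R (\<i> * p) + b + \<omega> *\<^sub>R (\<i> * (p + a'))" using b(3)[OF b'(1)[OF p]] b'(3)[OF p] by simp
  moreover have "p + a + a' = p + a' + a" by simp
  ultimately have "\<i> * (\<omega>' *\<^sub>R a) = \<i> * (\<omega> *\<^sub>R a')" by (simp add: algebra_simps)
  then have "\<omega>' *\<^sub>R a = \<omega> *\<^sub>R a'"
    by (rule mult_left_cancel[THEN iffD1, OF complex_i_not_zero])
  then have "cross2 a (\<omega>' *\<^sub>R a) = cross2 a (\<omega> *\<^sub>R a')" by simp
  then have "\<omega> = 0" using a'(2) by (simp add: cross2_simps)
  then show ?thesis using that[of b] b(3) by simp
qed

lemma planar_framework:
  obtains a1 a2 L where "periodic_framework ((`) pr ` T) \<Lambda> a1 a2 rad stretch velocity L"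
proof -
  obtain a1 a2 where a12: "a1 \<in> \<Lambda>" "a2 \<in> \<Lambda>" "cross2 a1 a2 > 0" using lattice_basis by blast
  obtain R where R: "\<And>p. rad p \<le> R" using rad_bounded by blast
  have U: "\<Union> ((`) pr ` T) = pr ` VT" by blast
  have plus: "p + l \<in> pr ` VT" "stretch (p + l) = stretch p" if p: "p \<in> pr ` VT" and l: "l \<in> \<Lambda>" for p l
    by (rule translation_step[OF l]; use p in simp)+
  have neg: "- l \<in> \<Lambda>" if "l \<in> \<Lambda>" for l using \<Lambda>_diff[OF zero_\<Lambda> that] by simp
  have "periodic_framework ((`) pr ` T) \<Lambda> a1 a2 rad stretch velocity (sqrt (8 * R))"
  proof
    fix t assume "t \<in> (`) pr ` T"
    then show "\<exists>a b c. t = {a,b,c} \<and> cross2 (b - a) (c - a) > 0" using planar_triangle by blast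
  next
    fix s t assume "s \<in> (`) pr ` T" "t \<in> (`) pr ` T"
    then show "convex hull s \<inter> convex hull t = convex hull (s \<inter> t)" using planar_inter by blast
  next
    fix K :: "complex set" assume "compact K"
    have "{t \<in> (`) pr ` T. convex hull t \<inter> K \<noteq> {}} = (`) pr ` {t\<in>T. convex hull (pr ` t) \<inter> K \<noteq> {}}" by blast
    then show "finite {t \<in> (`) pr ` T. convex hull t \<inter> K \<noteq> {}}" using planar_finite[OF \<open>compact K\<close>] by simp
  next
    show "(\<Union>t\<in>(`) pr ` T. convex hull t) = UNIV" using planar_cover by simp
  next
    fix t a b assume "t \<in> (`) pr ` T" "a \<in> t" "b \<in> t"
    then obtain t' x y where "t' \<in> T" "x \<in> t'" "y \<in> t'" "a = pr x" "b = pr y" by blast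
    then have "(norm (a - b))\<^sup>2 \<le> 8 * R" using planar_edge[OF R] by blast
    then show "norm (a - b) \<le> sqrt (8 * R)" by (rule real_le_rsqrt)
  next
    fix x y assume "x \<in> \<Lambda>" "y \<in> \<Lambda>" then show "x - y \<in> \<Lambda>" by (rule \<Lambda>_diff)
  next
    show "a1 \<in> \<Lambda>" "a2 \<in> \<Lambda>" "0 < cross2 a1 a2" by fact+
  next
    fix x l assume x: "x \<in> \<Union> ((`) pr ` T)" "l \<in> \<Lambda>"
    then show "x + l \<in> \<Union> ((`) pr ` T)" "rad (x + l) = rad x" "stretch (x + l) = stretch x"
      unfolding U using plus rad_shift by auto
  next
    fix x y l assume x: "x \<in> \<Union> ((`) pr ` T)" "y \<in> \<Union> ((`) pr ` T)" "l \<in> \<Lambda>"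
    obtain b where "\<And>p. p \<in> pr ` VT \<Longrightarrow> velocity (p + l) = velocity p + b" using velocity_shift[OF x(3)] by blast
    then show "velocity (x + l) - velocity (y + l) = velocity x - velocity y" using x unfolding U by simp
  next
    fix t p q assume "t \<in> (`) pr ` T" "p \<in> t" "q \<in> t"
    then obtain t' x y where t: "t' \<in> T" "x \<in> t'" "y \<in> t'" "p = pr x" "q = pr y" by blast
    have v: "x \<in> VT" "y \<in> VT" using t by auto
    have "x \<in> F" "y \<in> F" using v VT_F by auto
    then have s: "\<sigma> p = x" "\<sigma> q = y" using \<sigma>(3) t by auto
    have z: "zz x = rad p + (norm p)\<^sup>2 / 2" "zz y = rad q + (norm q)\<^sup>2 / 2" by (simp_all add: rad_def ht_def s)
    have "mink (Z y) y = 0" "mink (Z x) x = 0" using Z_tangent v by auto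
    then have "(pr y - pr x) \<bullet> (planar_rate (Z y) y - planar_rate (Z x) x) + (zz y - zz x) * (stretch_rate (Z y) y - stretch_rate (Z x) x) = 0"
      by (intro strain_planar VT_hyp v Z_edge[OF t(1-3)])
    then show "(q - p) \<bullet> ((velocity q - stretch q *\<^sub>R q) - (velocity p - stretch p *\<^sub>R p))
        + ((rad q + (norm q)\<^sup>2 / 2) - (rad p + (norm p)\<^sup>2 / 2)) * (stretch q - stretch p) = 0"
      by (simp add: z velocity_def stretch_def s t(4,5)[symmetric])
  next
    fix i assume "i \<in> \<Union> ((`) pr ` T)"
    then have i: "i \<in> pr ` VT" by blast
    have "a1 \<noteq> 0" using a12(3) by (auto simp: cross2_def)
    then show "\<exists>\<beta>. \<forall>j\<in>\<Union> ((`) pr ` T) - {i}. \<beta> \<bullet> (j - i) < rad j - rad i + (norm (j - i))\<^sup>2 / 2"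
      unfolding U using planar_support[OF Q(1) Q(2) VT_F i, of a1] plus(1)[OF i a12(1)] plus(1)[OF i neg[OF a12(1)]]
        rad_shift[OF a12(1)] by simp
  qed
  then show ?thesis using that by blast
qed

text \<open>Rigidity in the plane identifies the field at the vertices with a
  \<open>similarity\<close>; on each triangle the Killing field is determined by its vertex
  values.\<close>

theorem deformation_trivial: "trivial_deformation F Z"
proof -
  obtain a1 a2 L where fw: "periodic_framework ((`) pr ` T) \<Lambda> a1 a2 rad stretch velocity L" using planar_framework by blast
  obtain \<kappa> \<beta> \<omega> where k: "\<And>v. v \<in> pr ` VT \<Longrightarrow> stretch v = \<kappa>" "\<And>v. v \<in> pr ` VT \<Longrightarrow> velocity v = \<kappa> *\<^sub>R v + \<beta> + \<omega> *\<^sub>R (\<i> * v)"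
  proof -
    have "\<Union> ((`) pr ` T) = pr ` VT" by blast
    then show ?thesis using periodic_framework.rigid[OF fw] that by metis
  qed
  let ?M = "similarity \<kappa> \<omega> \<beta>"
  have ZM: "Z x = ?M x" if x: "x \<in> VT" for x
  proof (rule similarity_eqI)
    have s: "\<sigma> (pr x) = x" using \<sigma>(3) x VT_F by auto
    show "x \<in> hyp3" "mink (Z x) x = 0" using VT_hyp Z_tangent x by auto
    show "stretch_rate (Z x) x = \<kappa>" using k(1)[of "pr x"] x by (simp add: stretch_def s)
    then show "planar_rate (Z x) x = \<beta> + \<omega> *\<^sub>R (\<i> * pr x)"
      using k(2)[of "pr x"] x by (simp add: velocity_def stretch_def s)
  qed
  have "Z x = ?M x" if x: "x \<in> F" for x
  proof -
    obtain t where t: "t \<in> T" "x \<in> hyp_hull t" using x T_cover by blast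
    obtain X where X: "killing_field X" "\<forall>x\<in>hyp_hull t. Z x = X x" using Z_killing[OF t(1)] by blast
    have "X v = ?M v" if "v \<in> t" for v
    proof -
      have "v \<in> hyp_hull t" using that T_hyp[OF t(1)] hyp_hull_inc by blast
      then show ?thesis using X(2) ZM[of v] that t(1) by auto
    qed
    then have "X x = ?M x"
      by (intro killing_determined[OF X(1) similarity_antisym similarity_linear T_hyp[OF t(1)] _ t(2)])
    then show ?thesis using X(2) t(2) by simp
  qed
  then show ?thesis using similarity_killing unfolding trivial_deformation_def by blast
qed

end

section \<open>Group invariance of the vertices, and the conclusion\<close>

lemma hyp_hull_image:
  assumes "linear f" "f ` hyp3 = hyp3" "inj f"
  shows "hyp_hull (f ` S) = f ` hyp_hull S"
  unfolding hyp_hull_def convex_cone_hull_linear_image[OF assms(1)]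
  using assms(2) image_Int[OF assms(3)] by metis

text \<open>Applied to inverses of group elements, this shows that the group maps vertices of the
  surface to vertices.\<close>

lemma wedge_point_image:
  fixes f :: "real^4 \<Rightarrow> real^4"
  assumes f: "linear f" "f ` hyp3 = hyp3" "inj f" "f ` F = F" and w: "wedge_point F x"
  shows "wedge_point F (f x)"
proof -
  obtain a b p q U where h: "a \<in> hyp3" "b \<in> hyp3" "p \<in> hyp3" "q \<in> hyp3"
    and x: "x \<in> hyp_hull {a,b} - {a,b}" and U: "open U" "x \<in> U"
    and eq: "F \<inter> U = (hyp_hull {a,b,p} \<union> hyp_hull {a,b,q}) \<inter> U"
    using w unfolding wedge_point_def by blast
  have H: "hyp_hull (f ` S) = f ` hyp_hull S" for S by (rule hyp_hull_image[OF f(1-3)])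
  have "f x \<in> hyp_hull {f a, f b} - {f a, f b}"
    using x H[of "{a,b}"] inj_eq[OF f(3)] by auto
  moreover have "open (f ` U)" by (rule open_surjective_linear_image[OF U(1) f(1)])
     (use f(1,3) linear_injective_imp_surjective in auto)
  moreover have "F \<inter> f ` U = (hyp_hull {f a, f b, f p} \<union> hyp_hull {f a, f b, f q}) \<inter> f ` U"
  proof -
    have "F \<inter> f ` U = f ` (F \<inter> U)" using f(4) image_Int[OF f(3)] by metis
    also have "\<dots> = (f ` hyp_hull {a,b,p} \<union> f ` hyp_hull {a,b,q}) \<inter> f ` U"
      unfolding eq by (simp add: image_Int[OF f(3)] image_Un)
    finally show ?thesis using H[of "{a,b,p}"] H[of "{a,b,q}"] by simp
  qed
  moreover have "f v \<in> hyp3" if "v \<in> hyp3" for v using that f(2) by blast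
  ultimately show ?thesis unfolding wedge_point_def using h U by (metis imageI)
qed

theorem theoremD:
  fixes c :: "real^4" and P :: "(real^4) set" and G :: "(real^4^4) set"
    and Z :: "real^4 \<Rightarrow> real^4"
  assumes "star_shaped_parabolic_polyhedron c P G"
    and "weakly_convex P"
    and "parabolic_deformation c P G Z"
  shows "trivial_deformation (hyp_boundary P) Z"
proof -
  obtain F where c: "ideal_point c" and F: "polyhedral_surface F" "\<forall>s>0. bij_betw (horo_proj c s) F (horosphere c s)"
    and P: "P = cone_over c F" and G: "discrete_isometry_group G" "acts_freely_cocompactly_on_horospheres c G"
    and inv: "\<forall>g\<in>G. (\<lambda>x. g *v x) ` P = P"
    using assms(1) unfolding star_shaped_parabolic_polyhedron_def by blast
  obtain d e1 e2 where "cusp c d e1 e2" using cusp_exists[OF c] .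
  then interpret cusp c d e1 e2 .
  obtain \<sigma> where \<sigma>: "F \<subseteq> hyp3" "homeomorphism F UNIV pr \<sigma>" using surface_homeomorphism[OF F(1)] F(2) by force
  interpret cusp_surface c d e1 e2 F \<sigma> by unfold_locales (fact \<sigma>)+
  have bd: "hyp_boundary P = F" unfolding P by (rule hyp_boundary_cone)
  interpret cusp_group c d e1 e2 G by unfold_locales (fact G)+
  interpret cusp_polyhedron c d e1 e2 F \<sigma> G by unfold_locales (use inv P in blast)
  obtain Q where Q: "convex_polyhedron Q" "surface_vertices F = convex_vertices Q"
    using assms(2) unfolding weakly_convex_def vertices_of_def bd by blast
  obtain T where T: "hyp_triangulation T F" "\<Union>T = surface_vertices F"
    "\<forall>t\<in>T. \<exists>X. killing_field X \<and> (\<forall>x\<in>hyp_hull t. Z x = X x)"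
    and Zp: "\<forall>g\<in>G. \<exists>X. parabolic_killing_field c g X \<and> (\<forall>i\<in>surface_vertices F. Z (g *v i) = g *v (Z i + X i))"
    using assms(3) unfolding parabolic_deformation_def inf_isometric_deformation_def vertices_of_def bd by blast
  have V_inv: "g *v x \<in> \<Union>T" if g: "g \<in> G" and x: "x \<in> \<Union>T" for g x
  proof -
    let ?h = "\<lambda>x. matrix_inv g *v x"
    have "\<not> wedge_point F (g *v x)"
    proof
      assume "wedge_point F (g *v x)"
      then have "wedge_point F (?h (g *v x))"
      proof (rule wedge_point_image[rotated -1])
        show "linear ?h" by (simp add: linear_iff matrix_vector_right_distrib matrix_vector_mult_scaleR)
        show "?h ` hyp3 = hyp3" using G_iso[OF G_inv[OF g]] by (simp add: hyp_isometry_def)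
        show "inj ?h" by (rule injI) (metis G_inverse(1)[OF g])
        show "?h ` F = F" by (rule G_image_F[OF G_inv[OF g]])
      qed
      then show False using x T(2) by (simp add: G_inverse[OF g] surface_vertices_def)
    qed
    then show ?thesis using x T(2) G_maps_F[OF g] by (simp add: surface_vertices_def)
  qed
  interpret cusp_deformation c d e1 e2 F \<sigma> T G Q Z
    by unfold_locales (use T Q V_inv Zp in auto)
  show ?thesis unfolding bd by (rule deformation_trivial)
qed

end
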